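(* Let $g>2$ be an integer. Then the closure of the divisor $D_g\subset X_g$ in the Baily-Borel compactification $X_g^{bb}$ is not a $\mathbb{Q}$-Cartier divisor. In particular, $D_g$ is not definable by an automorphic form: there is no $\Gamma_g$-automorphic form on $\mathbb{D}_g$ whose zero divisor in $X_g$ has support equal to $D_g$.
   Context: Let $\Lambda=E_8(-1)\perp E_8(-1)\perp U\perp U\perp U$ be the K3 lattice ($E_8(-1)$ is the negative definite $E_8$ lattice, $U$ the hyperbolic plane with isotropic basis $e,f$, $e\cdot f=1$; $e_i,f_i$ is this basis of the $i$-th copy). Put $h_g=e_3+(g-1)f_3$, so $h_g\cdot h_g=2g-2$, and $\Lambda_g=h_g^\perp\subset\Lambda$, a lattice of signature $(2,19)$. $\mathbb{D}_g$ is one of the two connected components of $\{[z]\in\mathbb{P}(\Lambda_g\otimes\mathbb{C}):z\cdot z=0,\ z\cdot\bar z>0\}$. $\Gamma_g$ is the group of $\gamma\in\mathrm{O}(\Lambda)$ which fix $h_g$ and leave $\mathbb{D}_g$ invariant. $X_g=\Gamma_g\backslash\mathbb{D}_g$. $N_g$ is the set of vectors $v\in\Lambda_g$ with $v\cdot v=-2$ which span with $h_g$ a primitive sublattice of $\Lambda$ (for $g>2$ every $(-2)$-vector of $\Lambda_g$ has this property). $D_g$ is the irreducible divisor in $X_g$ that is the image of the union of the hyperplane sections of $\mathbb{D}_g$ orthogonal to members of $N_g$; $X_g$ is the moduli space of (primitively semipolarized) K3 surfaces of genus $g$ and $D_g$ is its rational double point locus. A $\Gamma_g$-automorphic form of degree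 $k$ is a section of the $k$-th power of the automorphic line bundle on $X_g^{bb}$. *)

theory Defs
  imports "HOL-Analysis.Analysis"
begin

section \<open>Divisors on normal complex spaces given by their functions\<close>

text \<open>
  A reduced complex space is given by a topology \<open>T\<close> and its sheaf of regular functions:
  \<open>\<O> W\<close> is the set of functions that are regular on the open set \<open>W\<close> (their values outside \<open>W\<close>
  are irrelevant). A reduced divisor is identified with the closed set that supports it.
\<close>

text \<open>The germ of \<open>t\<close> at \<open>x\<close> generates the ideal of germs at \<open>x\<close> that vanish on \<open>D\<close>.\<close>

definition generates_ideal_at ::
  "'a topology \<Rightarrow> ('a set \<Rightarrow> ('a \<Rightarrow> complex) set) \<Rightarrow> 'a set \<Rightarrow> 'a \<Rightarrow> 'a set \<Rightarrow> ('a \<Rightarrow> complex) \<Rightarrow> bool"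
  where
  "generates_ideal_at T \<O> D x W t \<longleftrightarrow>
     openin T W \<and> x \<in> W \<and> t \<in> \<O> W \<and> (\<forall>y\<in>W \<inter> D. t y = 0) \<and>
     (\<forall>W' s. openin T W' \<and> x \<in> W' \<and> s \<in> \<O> W' \<and> (\<forall>y\<in>W' \<inter> D. s y = 0) \<longrightarrow>
        (\<exists>W'' q. openin T W'' \<and> x \<in> W'' \<and> W'' \<subseteq> W \<inter> W' \<and> q \<in> \<O> W'' \<and>
                 (\<forall>y\<in>W''. s y = t y * q y)))"

definition has_order_at ::
  "'a topology \<Rightarrow> ('a set \<Rightarrow> ('a \<Rightarrow> complex) set) \<Rightarrow> 'a set \<Rightarrow> ('a \<Rightarrow> complex) \<Rightarrow> nat \<Rightarrow> 'a \<Rightarrow> bool"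
  where
  "has_order_at T \<O> D f m x \<longleftrightarrow>
     (\<exists>W t u. generates_ideal_at T \<O> D x W t \<and> u \<in> \<O> W \<and> u x \<noteq> 0 \<and>
              (\<forall>y\<in>W. f y = u y * t y ^ m))"

text \<open>
  The Weil divisor of \<open>f\<close> on \<open>W\<close> is \<open>m D\<close>: there are no zeros outside \<open>D\<close>, and the order of \<open>f\<close> along
  every irreducible component of \<open>D \<inter> W\<close> is \<open>m\<close>. The order along a component is read off at its
  generic points, where the ideal of \<open>D\<close> is principal.
\<close>

definition divisor_is_multiple ::
  "'a topology \<Rightarrow> ('a set \<Rightarrow> ('a \<Rightarrow> complex) set) \<Rightarrow> 'a set \<Rightarrow> 'a set \<Rightarrow> ('a \<Rightarrow> complex) \<Rightarrow> nat \<Rightarrow> bool"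
  where
  "divisor_is_multiple T \<O> D W f m \<longleftrightarrow>
     f \<in> \<O> W \<and> (\<forall>y\<in>W - D. f y \<noteq> 0) \<and>
     W \<inter> D \<subseteq> T closure_of {x \<in> W \<inter> D. has_order_at T \<O> D f m x}"

text \<open>
  Some positive multiple of \<open>D\<close> is locally principal. On a normal space a local equation of an
  effective divisor is regular, so meromorphic equations need not be considered.
\<close>

definition Q_Cartier ::
  "'a topology \<Rightarrow> ('a set \<Rightarrow> ('a \<Rightarrow> complex) set) \<Rightarrow> 'a set \<Rightarrow> bool" where
  "Q_Cartier T \<O> D \<longleftrightarrow>
     (\<exists>m>0. \<forall>x\<in>topspace T. \<exists>W f. openin T W \<and> x \<in> W \<and> divisor_is_multiple T \<O> D W f m)"


section \<open>Holomorphic functions of several variables\<close>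

definition holo_open :: "(complex ^ 'n \<Rightarrow> complex) \<Rightarrow> (complex ^ 'n) set \<Rightarrow> bool" where
  "holo_open f S \<longleftrightarrow> open S \<and>
     (\<forall>z\<in>S. \<exists>L. (f has_derivative L) (at z) \<and> (\<forall>c v. L (c *s v) = c * L v))"

text \<open>Holomorphy on a locally closed complex submanifold, via local holomorphic extensions.\<close>

definition holo_on :: "(complex ^ 'n \<Rightarrow> complex) \<Rightarrow> (complex ^ 'n) set \<Rightarrow> bool" where
  "holo_on f A \<longleftrightarrow> (\<forall>z\<in>A. \<exists>S F. z \<in> S \<and> holo_open F S \<and> (\<forall>x\<in>S \<inter> A. F x = f x))"


section \<open>The K3 lattice\<close>

text \<open>
  Coordinates on the complexified K3 lattice: \<open>R1\<close> and \<open>R2\<close> are orthogonal coordinates for the two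
  copies of \<open>E\<^sub>8(-1)\<close>, and \<open>E i\<close>, \<open>F i\<close> belong to the isotropic basis of the \<open>i\<close>-th copy of \<open>U\<close>,
  \<open>i \<in> {1,2,3}\<close> (in the type \<open>3\<close> one has \<open>3 = 0\<close>).
\<close>

datatype k3_index = R1 8 | R2 8 | E 3 | F 3

instance k3_index :: finite
proof
  have "(UNIV :: k3_index set) = range R1 \<union> range R2 \<union> range E \<union> range F"
    by (auto, metis k3_index.exhaust rangeI)
  then show "finite (UNIV :: k3_index set)"
    by (metis finite_UnI finite_imageI finite)
qed

type_synonym k3_vec = "complex ^ k3_index"

definition k3_form :: "k3_vec \<Rightarrow> k3_vec \<Rightarrow> complex" (infixl "\<cdot>" 70) where
  "z \<cdot> w = - (\<Sum>i\<in>UNIV. z $ R1 i * w $ R1 i) - (\<Sum>i\<in>UNIV. z $ R2 i * w $ R2 i)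
           + (\<Sum>i\<in>UNIV. z $ E i * w $ F i + z $ F i * w $ E i)"

definition E8_lattice :: "(complex ^ 8) set" where
  "E8_lattice = {x. ((\<forall>i. x $ i \<in> \<int>) \<or> (\<forall>i. x $ i - 1 / 2 \<in> \<int>)) \<and> (\<Sum>i\<in>UNIV. x $ i) / 2 \<in> \<int>}"

definition K3_lattice :: "k3_vec set" where
  "K3_lattice = {x. (\<chi> i. x $ R1 i) \<in> E8_lattice \<and> (\<chi> i. x $ R2 i) \<in> E8_lattice \<and>
                    (\<forall>i. x $ E i \<in> \<int> \<and> x $ F i \<in> \<int>)}"

definition conj_vec :: "k3_vec \<Rightarrow> k3_vec" where
  "conj_vec z = (\<chi> i. cnj (z $ i))"

definition h_vec :: "int \<Rightarrow> k3_vec" where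
  "h_vec g = axis (E 3) 1 + (of_int g - 1) *s axis (F 3) 1"

definition Lambda_g :: "int \<Rightarrow> k3_vec set" where
  "Lambda_g g = {x \<in> K3_lattice. x \<cdot> h_vec g = 0}"


section \<open>Period domain, arithmetic group, Baily-Borel compactification\<close>

text \<open>
  Subsets of the projective space of \<open>\<Lambda>\<^sub>g \<otimes> \<complex>\<close> are represented by the cones of nonzero vectors over
  them. The cone over one of the two components of the period domain is a component of \<open>period_cone\<close>,
  because the fibres \<open>\<complex>\<^sup>\<times>\<close> are connected. Below, \<open>C\<close> stands for the cone over \<open>\<D>\<^sub>g\<close>.
\<close>

definition period_cone :: "int \<Rightarrow> k3_vec set" where
  "period_cone g = {z \<in> vec.span (Lambda_g g). z \<cdot> z = 0 \<and> Re (z \<cdot> conj_vec z) > 0}"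

text \<open>Isometries of the lattice are represented by their complex linear extensions.\<close>

definition O_K3 :: "(k3_vec \<Rightarrow> k3_vec) set" where
  "O_K3 = {\<gamma>. Vector_Spaces.linear (*s) (*s) \<gamma> \<and> \<gamma> ` K3_lattice = K3_lattice \<and>
               (\<forall>x y. \<gamma> x \<cdot> \<gamma> y = x \<cdot> y)}"

definition Gamma_g :: "int \<Rightarrow> k3_vec set \<Rightarrow> (k3_vec \<Rightarrow> k3_vec) set" where
  "Gamma_g g C = {\<gamma> \<in> O_K3. \<gamma> (h_vec g) = h_vec g \<and> \<gamma> ` C = C}"

text \<open>The \<open>\<Gamma>\<^sub>g\<close>-orbit of the line through \<open>z\<close>, as the cone of its nonzero vectors.\<close>

definition orbit_class :: "int \<Rightarrow> k3_vec set \<Rightarrow> k3_vec \<Rightarrow> k3_vec set" where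
  "orbit_class g C z = {c *s \<gamma> z | c \<gamma>. c \<noteq> 0 \<and> \<gamma> \<in> Gamma_g g C}"

definition X_g :: "int \<Rightarrow> k3_vec set \<Rightarrow> k3_vec set set" where
  "X_g g C = orbit_class g C ` C"

definition isotropic_vecs :: "int \<Rightarrow> k3_vec set" where
  "isotropic_vecs g = {e \<in> Lambda_g g. e \<noteq> 0 \<and> e \<cdot> e = 0}"

definition isotropic_pair :: "int \<Rightarrow> k3_vec \<Rightarrow> k3_vec \<Rightarrow> bool" where
  "isotropic_pair g a b \<longleftrightarrow> a \<in> Lambda_g g \<and> b \<in> Lambda_g g \<and> a \<noteq> b \<and> vec.independent {a, b} \<and>
     a \<cdot> a = 0 \<and> a \<cdot> b = 0 \<and> b \<cdot> b = 0"

text \<open>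
  Let \<open>J\<close> be the isotropic plane spanned by \<open>a\<close> and \<open>b\<close>. The projection of \<open>\<D>\<^sub>g\<close> to its boundary
  component sends \<open>z\<close> to its class modulo the orthogonal complement of \<open>J\<close>, that is, to the functional
  that \<open>z\<close> defines on \<open>J\<close> up to scalars, or equivalently to the kernel of this functional. This kernel is
  spanned by \<open>plane_proj a b z\<close>, which is also the limit in projective space of
  \<open>z + i t ((z \<cdot> b) a - (z \<cdot> a) b)\<close> for \<open>t \<rightarrow> \<plusminus>\<infinity>\<close>. Thus the boundary components become subsets
  of the closure of \<open>\<D>\<^sub>g\<close> in projective space; an isotropic line spanned by \<open>e\<close> contributes the
  point \<open>[e]\<close>.
\<close>

definition plane_proj :: "k3_vec \<Rightarrow> k3_vec \<Rightarrow> k3_vec \<Rightarrow> k3_vec" where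
  "plane_proj a b z = (z \<cdot> b) *s a - (z \<cdot> a) *s b"

definition plane_stratum :: "k3_vec set \<Rightarrow> k3_vec \<Rightarrow> k3_vec \<Rightarrow> k3_vec set" where
  "plane_stratum C a b = plane_proj a b ` C"

definition boundary_cone :: "int \<Rightarrow> k3_vec set \<Rightarrow> k3_vec set" where
  "boundary_cone g C = {w. \<exists>a b. isotropic_pair g a b \<and> w \<in> plane_stratum C a b}
                       \<union> {c *s e | c e. c \<noteq> 0 \<and> e \<in> isotropic_vecs g}"

definition X_bb_set :: "int \<Rightarrow> k3_vec set \<Rightarrow> k3_vec set set" where
  "X_bb_set g C = X_g g C \<union> orbit_class g C ` boundary_cone g C"

definition preimage :: "int \<Rightarrow> k3_vec set \<Rightarrow> k3_vec set set \<Rightarrow> k3_vec set" where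
  "preimage g C W = {z \<in> C \<union> boundary_cone g C. orbit_class g C z \<in> W}"

text \<open>
  Fundamental neighbourhoods for the Satake topology (traces on \<open>\<D>\<^sub>g\<close>, given by their cones).

  For the plane \<open>J\<close> spanned by \<open>a\<close> and \<open>b\<close>: normalize \<open>z \<cdot> a = 1\<close> and write \<open>\<tau> = z \<cdot> b\<close>. In the coordinates
  of a Siegel domain of the third kind, the quotient of \<open>z \<cdot> conj z\<close> by the absolute value of
  \<open>Im ((z \<cdot> a) * cnj (z \<cdot> b))\<close> is up to a constant \<open>Im u - L\<^sub>\<tau>(v,v)\<close>.

  For the line spanned by \<open>e\<close>: in the tube domain model, \<open>Im (z \<cdot> b / z \<cdot> e) = y \<cdot> b\<close> with \<open>y\<close> in a
  component of the positive cone of \<open>e\<^sup>\<bottom> / e\<close>, and the set is the multiple by \<open>t\<close> of the cocore: all \<open>y\<close>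
  with \<open>\<bar>y \<cdot> b\<bar> > t\<close> for all nonzero lattice points \<open>b\<close> in the closed light cone.
\<close>

definition plane_nbhd ::
  "k3_vec set \<Rightarrow> k3_vec \<Rightarrow> k3_vec \<Rightarrow> k3_vec \<Rightarrow> real \<Rightarrow> real \<Rightarrow> k3_vec set" where
  "plane_nbhd C a b w \<epsilon> t =
     {z \<in> C. dist (plane_proj a b z) w < \<epsilon> \<and>
             Re (z \<cdot> conj_vec z) > t * \<bar>Im ((z \<cdot> a) * cnj (z \<cdot> b))\<bar>}"

definition line_nbhd :: "int \<Rightarrow> k3_vec set \<Rightarrow> k3_vec \<Rightarrow> real \<Rightarrow> k3_vec set" where
  "line_nbhd g C e t =
     {z \<in> C. \<forall>b\<in>Lambda_g g. b \<cdot> e = 0 \<and> Re (b \<cdot> b) \<ge> 0 \<and> b \<notin> vec.span {e} \<longrightarrow>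
               \<bar>Im ((z \<cdot> b) * cnj (z \<cdot> e))\<bar> > t * (cmod (z \<cdot> e))\<^sup>2}"

text \<open>
  The open neighbourhood of a boundary point also contains the images of its trace in the adjacent
  boundary components.
\<close>

definition satake_open :: "int \<Rightarrow> k3_vec set \<Rightarrow> k3_vec set \<Rightarrow> bool" where
  "satake_open g C P \<longleftrightarrow>
     openin (top_of_set C) (P \<inter> C) \<and>
     (\<forall>a b w. isotropic_pair g a b \<and> w \<in> P \<inter> plane_stratum C a b \<longrightarrow>
        (\<exists>\<epsilon>>0. \<exists>t. \<forall>z\<in>plane_nbhd C a b w \<epsilon> t. z \<in> P \<and> plane_proj a b z \<in> P)) \<and>
     (\<forall>e\<in>P \<inter> isotropic_vecs g.
        (\<exists>t. \<forall>z\<in>line_nbhd g C e t. z \<in> P \<and> (\<forall>b. isotropic_pair g e b \<longrightarrow> plane_proj e b z \<in> P)))"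

definition X_bb :: "int \<Rightarrow> k3_vec set \<Rightarrow> k3_vec set topology" where
  "X_bb g C = topology (\<lambda>W. W \<subseteq> X_bb_set g C \<and> satake_open g C (preimage g C W))"

lemma satake_open_Int:
  assumes "satake_open g C P" "satake_open g C Q"
  shows "satake_open g C (P \<inter> Q)"
  unfolding satake_open_def
proof (intro conjI allI ballI impI; (elim conjE)?)
  have "P \<inter> Q \<inter> C = (P \<inter> C) \<inter> (Q \<inter> C)" by blast
  then show "openin (top_of_set C) (P \<inter> Q \<inter> C)"
    using assms unfolding satake_open_def by (metis openin_Int)
next
  fix a b w assume *: "isotropic_pair g a b" "w \<in> P \<inter> Q \<inter> plane_stratum C a b"
  from * assms(1) obtain r1 t1 where 1: "r1 > 0"
    "\<forall>z\<in>plane_nbhd C a b w r1 t1. z \<in> P \<and> plane_proj a b z \<in> P"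
    unfolding satake_open_def by blast
  from * assms(2) obtain r2 t2 where 2: "r2 > 0"
    "\<forall>z\<in>plane_nbhd C a b w r2 t2. z \<in> Q \<and> plane_proj a b z \<in> Q"
    unfolding satake_open_def by blast
  have "plane_nbhd C a b w (min r1 r2) (max t1 t2)
          \<subseteq> plane_nbhd C a b w r1 t1 \<inter> plane_nbhd C a b w r2 t2"
    unfolding plane_nbhd_def
    by (auto intro: le_less_trans[OF mult_right_mono[OF max.cobounded1]]
                    le_less_trans[OF mult_right_mono[OF max.cobounded2]])
  with 1 2 show "\<exists>\<epsilon>>0. \<exists>t. \<forall>z\<in>plane_nbhd C a b w \<epsilon> t. z \<in> P \<inter> Q \<and> plane_proj a b z \<in> P \<inter> Q"
    by (intro exI[of _ "min r1 r2"] conjI exI[of _ "max t1 t2"]) auto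
next
  fix e assume *: "e \<in> P \<inter> Q \<inter> isotropic_vecs g"
  let ?good = "\<lambda>S z. z \<in> S \<and> (\<forall>b. isotropic_pair g e b \<longrightarrow> plane_proj e b z \<in> S)"
  from * assms(1) obtain t1 where 1: "\<forall>z\<in>line_nbhd g C e t1. ?good P z"
    unfolding satake_open_def by blast
  from * assms(2) obtain t2 where 2: "\<forall>z\<in>line_nbhd g C e t2. ?good Q z"
    unfolding satake_open_def by blast
  have "line_nbhd g C e (max t1 t2) \<subseteq> line_nbhd g C e t1 \<inter> line_nbhd g C e t2"
    unfolding line_nbhd_def
    by (auto intro: le_less_trans[OF mult_right_mono[OF max.cobounded1]]
                    le_less_trans[OF mult_right_mono[OF max.cobounded2]])
  with 1 2 show "\<exists>t. \<forall>z\<in>line_nbhd g C e t. ?good (P \<inter> Q) z"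
    by (intro exI[of _ "max t1 t2"]) blast
qed

lemma satake_open_Union:
  assumes "\<And>P. P \<in> K \<Longrightarrow> satake_open g C P"
  shows "satake_open g C (\<Union>K)"
  unfolding satake_open_def
proof (intro conjI allI ballI impI; (elim conjE)?)
  have "\<Union>K \<inter> C = \<Union>((\<lambda>P. P \<inter> C) ` K)" by blast
  moreover have "openin (top_of_set C) (\<Union>((\<lambda>P. P \<inter> C) ` K))"
    using assms unfolding satake_open_def by (intro openin_Union) blast
  ultimately show "openin (top_of_set C) (\<Union>K \<inter> C)" by simp
next
  fix a b w assume *: "isotropic_pair g a b" "w \<in> \<Union>K \<inter> plane_stratum C a b"
  then obtain P where P: "P \<in> K" "w \<in> P \<inter> plane_stratum C a b" by blast
  with * assms[OF P(1)] obtain r t where "r > 0"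
    "\<forall>z\<in>plane_nbhd C a b w r t. z \<in> P \<and> plane_proj a b z \<in> P"
    unfolding satake_open_def by blast
  with P(1) show "\<exists>\<epsilon>>0. \<exists>t. \<forall>z\<in>plane_nbhd C a b w \<epsilon> t. z \<in> \<Union>K \<and> plane_proj a b z \<in> \<Union>K"
    by blast
next
  fix e assume *: "e \<in> \<Union>K \<inter> isotropic_vecs g"
  then obtain P where P: "P \<in> K" "e \<in> P \<inter> isotropic_vecs g" by blast
  with assms[OF P(1)] obtain t where
    "\<forall>z\<in>line_nbhd g C e t. z \<in> P \<and> (\<forall>b. isotropic_pair g e b \<longrightarrow> plane_proj e b z \<in> P)"
    unfolding satake_open_def by blast
  with P(1) show "\<exists>t. \<forall>z\<in>line_nbhd g C e t. z \<in> \<Union>K \<and>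
      (\<forall>b. isotropic_pair g e b \<longrightarrow> plane_proj e b z \<in> \<Union>K)"
    by blast
qed

lemma openin_X_bb:
  "openin (X_bb g C) W \<longleftrightarrow> W \<subseteq> X_bb_set g C \<and> satake_open g C (preimage g C W)"
proof -
  have "istopology (\<lambda>W. W \<subseteq> X_bb_set g C \<and> satake_open g C (preimage g C W))"
    unfolding istopology_def
  proof (intro conjI allI impI; (elim conjE)?)
    fix S T assume "satake_open g C (preimage g C S)" "satake_open g C (preimage g C T)"
    moreover have "preimage g C (S \<inter> T) = preimage g C S \<inter> preimage g C T"
      by (auto simp: preimage_def)
    ultimately show "satake_open g C (preimage g C (S \<inter> T))" by (simp add: satake_open_Int)
  next
    fix K assume "\<forall>W\<in>K. W \<subseteq> X_bb_set g C \<and> satake_open g C (preimage g C W)"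
    moreover have "preimage g C (\<Union>K) = \<Union>(preimage g C ` K)"
      by (auto simp: preimage_def)
    ultimately show "satake_open g C (preimage g C (\<Union>K))"
      by (metis (no_types, lifting) imageE satake_open_Union)
  qed auto
  then show ?thesis by (simp add: X_bb_def)
qed

text \<open>
  The structure sheaf of the Baily-Borel compactification: continuous functions that are analytic on
  every stratum (for the strata that are single points there is no condition).
\<close>

definition X_bb_regular :: "int \<Rightarrow> k3_vec set \<Rightarrow> k3_vec set set \<Rightarrow> (k3_vec set \<Rightarrow> complex) set" where
  "X_bb_regular g C W =
     {f. continuous_map (subtopology (X_bb g C) W) euclidean f \<and>
         holo_on (\<lambda>z. f (orbit_class g C z)) (preimage g C W \<inter> C) \<and>
         (\<forall>a b. isotropic_pair g a b \<longrightarrow>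
            holo_on (\<lambda>z. f (orbit_class g C z)) (preimage g C W \<inter> plane_stratum C a b))}"


section \<open>The divisor and automorphic forms\<close>

definition N_g :: "int \<Rightarrow> k3_vec set" where
  "N_g g = {v \<in> Lambda_g g. v \<cdot> v = - 2 \<and>
     (let S = {of_int m *s v + of_int n *s h_vec g | m n :: int. True}
      in \<forall>x\<in>K3_lattice. \<forall>k::int. k \<noteq> 0 \<and> of_int k *s x \<in> S \<longrightarrow> x \<in> S)}"

definition D_g :: "int \<Rightarrow> k3_vec set \<Rightarrow> k3_vec set set" where
  "D_g g C = orbit_class g C ` (\<Union>v\<in>N_g g. {z \<in> C. z \<cdot> v = 0})"

text \<open>
  A form of degree \<open>k\<close>, that is, a section of the \<open>k\<close>-th power of the automorphic line bundle, is a
  \<open>\<Gamma>\<^sub>g\<close>-invariant holomorphic function on the cone \<open>C\<close>, homogeneous of degree \<open>-k\<close>. By Koecher's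
  principle holomorphy at the boundary is automatic.
\<close>

definition automorphic_form :: "int \<Rightarrow> k3_vec set \<Rightarrow> int \<Rightarrow> (k3_vec \<Rightarrow> complex) \<Rightarrow> bool" where
  "automorphic_form g C k \<Phi> \<longleftrightarrow> holo_on \<Phi> C \<and>
     (\<forall>z\<in>C. \<forall>c. c \<noteq> 0 \<longrightarrow> \<Phi> (c *s z) = c powi (- k) * \<Phi> z) \<and>
     (\<forall>\<gamma>\<in>Gamma_g g C. \<forall>z\<in>C. \<Phi> (\<gamma> z) = \<Phi> z)"

definition zero_support :: "int \<Rightarrow> k3_vec set \<Rightarrow> (k3_vec \<Rightarrow> complex) \<Rightarrow> k3_vec set set" where
  "zero_support g C \<Phi> = {x \<in> X_g g C. \<exists>z\<in>C. x = orbit_class g C z \<and> \<Phi> z = 0}"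

end

theory Submission
  imports Defs "HOL-Complex_Analysis.Conformal_Mappings"
begin

text \<open>
  Consider the boundary component of the isotropic plane \<open>J\<close> spanned by \<open>e\<^sub>1, e\<^sub>2\<close>. Then
  \<open>J\<^sup>\<bottom> / J\<close> is the sum of two copies of \<open>E\<^sub>8(-1)\<close> and of \<open>\<int> \<kappa>\<close> with \<open>\<kappa> \<cdot> \<kappa> = 2 - 2g\<close>. For
  \<open>g > 2\<close> all its roots are orthogonal to \<open>\<kappa>\<close>, and close to the boundary only roots in \<open>J\<^sup>\<bottom>\<close> matter.
  Let \<open>\<Phi>\<close> be a local equation of a multiple of \<open>D\<^sub>g\<close> there, or an automorphic form. Fix \<open>\<tau> = \<plusminus>\<i>\<close>; then
  \<open>\<Phi>\<close> is a function of the coordinate \<open>u\<close> along the centre of the Heisenberg group, of the coordinate \<open>s\<close>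
  in the direction \<open>\<kappa>\<close>, and of a coordinate \<open>x\<close> in a direction of \<open>E\<^sub>8\<close>. Its vanishing depends on \<open>x\<close>
  only. If it does not vanish for a given \<open>x\<close>, then \<open>log \<Phi>\<close> exists on the simply connected domain of
  \<open>(s, u)\<close>, and since the translation of \<open>u\<close> is a commutator up to torsion, \<open>log \<Phi>\<close> is periodic in \<open>u\<close>.
  Hence the mean of \<open>log \<bar>\<Phi>\<bar>\<close> over a period does not depend on \<open>u\<close>, and its exponential is a doubly
  periodic function of \<open>x\<close>, locally the modulus of a holomorphic function away from its zeros. By
  the maximum principle it is constant, so \<open>\<Phi>\<close> cannot vanish for some \<open>x\<close> and not for others.
\<close>

section \<open>Functions invariant under a Heisenberg group\<close>

text \<open>The solutions of exp w = 1 are the integral multiples of 2 pi i, at mutual distance at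
  least 2 pi, so a continuous function with values there cannot jump. This is what makes the change
  of a logarithm under a translation a constant.\<close>

lemma continuous_exp_eq_1_imp_constant:
  fixes a :: "'a::topological_space \<Rightarrow> complex"
  assumes "connected S" "continuous_on S a" "\<And>x. x \<in> S \<Longrightarrow> exp (a x) = 1"
  shows "a constant_on S"
proof (rule continuous_discrete_range_constant[OF assms(1,2)])
  fix x assume x: "x \<in> S"
  have "2 * pi \<le> norm (a y - a x)" if y: "y \<in> S" "a y \<noteq> a x" for y
  proof -
    from assms(3)[OF x] assms(3)[OF y(1)]
    obtain m n :: int where mn: "Re (a x) = 0" "Im (a x) = of_int (2 * m) * pi"
      "Re (a y) = 0" "Im (a y) = of_int (2 * n) * pi"
      by (auto simp: exp_eq_1)
    with y(2) have "m \<noteq> n" by (auto simp: complex_eq_iff)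
    then have "\<bar>real_of_int n - of_int m\<bar> \<ge> 1" by linarith
    then have "2 * pi * 1 \<le> 2 * pi * \<bar>real_of_int n - of_int m\<bar>" by (intro mult_left_mono) auto
    also have "\<dots> = \<bar>Im (a y - a x)\<bar>"
    proof -
      have "Im (a y - a x) = 2 * pi * (of_int n - of_int m)" by (simp add: mn algebra_simps)
      then show ?thesis by (simp add: abs_mult)
    qed
    also have "\<dots> \<le> norm (a y - a x)" by (rule abs_Im_le_cmod)
    finally show ?thesis by simp
  qed
  then show "\<exists>e>0. \<forall>y. y \<in> S \<and> a y \<noteq> a x \<longrightarrow> e \<le> norm (a y - a x)"
    by (intro exI[of _ "2 * pi"]) auto
qed

text \<open>A convex open set carries some holomorphic logarithm; \<open>g\<close> differs from it
  by a continuous function with values in the discrete kernel of exp, hence by a constant.\<close>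

lemma continuous_log_holomorphic:
  assumes "convex S" "open S" "continuous_on S g" "(\<lambda>z. exp (g z)) holomorphic_on S"
  shows "g holomorphic_on S"
proof (cases "S = {}")
  case False
  then obtain z0 where z0: "z0 \<in> S" by blast
  obtain h where h: "h holomorphic_on S" "\<And>x. x \<in> S \<Longrightarrow> exp (h x) = exp (g x)"
    using holomorphic_logarithm_exists[OF assms(1,2,4) _ z0] by auto
  have "(\<lambda>z. g z - h z) constant_on S"
    using assms h by (intro continuous_exp_eq_1_imp_constant convex_connected continuous_intros)
      (auto simp: exp_diff holomorphic_on_imp_continuous_on)
  then obtain c where c: "\<forall>z\<in>S. g z - h z = c" unfolding constant_on_def by blast
  have "(\<lambda>z. h z + c) holomorphic_on S" using h(1) by (intro holomorphic_intros)
  then show ?thesis using c by (elim holomorphic_transform) (auto simp: algebra_simps)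
qed (simp add: holomorphic_on_def)

text \<open>With n = g - 1 this is the range of (s, u) in a Siegel domain of the third kind when x
  and \<tau> are fixed; the contribution of x is absorbed in \<open>t\<close>.\<close>

definition parabolic_domain :: "nat \<Rightarrow> real \<Rightarrow> (complex \<times> complex) set" where
  "parabolic_domain n t = {(s, u). Im u > t + real n * (Im s)\<^sup>2}"

lemma convex_parabolic_domain: "convex (parabolic_domain n t)"
proof (rule convexI)
  fix z w :: "complex \<times> complex" and a b :: real
  assume zw: "z \<in> parabolic_domain n t" "w \<in> parabolic_domain n t" and ab: "0 \<le> a" "0 \<le> b" "a + b = 1"
  obtain s u s' u' where [simp]: "z = (s, u)" "w = (s', u')" by fastforce
  let ?q = "\<lambda>x. real n * x\<^sup>2"
  have b: "b = 1 - a" using ab by simp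
  have "(a * Im s + b * Im s')\<^sup>2 = a * (Im s)\<^sup>2 + b * (Im s')\<^sup>2 - a * b * (Im s - Im s')\<^sup>2"
    unfolding b by algebra
  also have "\<dots> \<le> a * (Im s)\<^sup>2 + b * (Im s')\<^sup>2" using ab by simp
  finally have "?q (a * Im s + b * Im s') \<le> real n * (a * (Im s)\<^sup>2 + b * (Im s')\<^sup>2)"
    by (rule mult_left_mono) simp
  then have "t + ?q (a * Im s + b * Im s') \<le> a * (t + ?q (Im s)) + b * (t + ?q (Im s'))"
    unfolding b by (simp add: algebra_simps)
  also have "\<dots> < a * Im u + b * Im u'"
  \<comment> \<open>The strict inequality is taken from the summand with weight \<open>a\<close>, so
    \<open>a = 0\<close> is a case of its own.\<close>
  proof (cases "a = 0")
    case True
    then show ?thesis using zw ab by (simp add: parabolic_domain_def)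
  next
    case False
    then have "a * (t + ?q (Im s)) < a * Im u" "b * (t + ?q (Im s')) \<le> b * Im u'"
      using zw ab by (auto simp: parabolic_domain_def intro: mult_left_mono)
    then show ?thesis by linarith
  qed
  finally show "a *\<^sub>R z + b *\<^sub>R w \<in> parabolic_domain n t"
    by (simp add: parabolic_domain_def)
qed

text \<open>Each translation changes the logarithm by a constant. The commutator of the last two translations
  is the translation of \<open>u\<close> by \<open>2n\<close>, so the constant of \<open>u \<mapsto> u + 1\<close> vanishes.\<close>

lemma Heisenberg_invariant_log_periodic:
  fixes F :: "complex \<times> complex \<Rightarrow> complex"
  assumes n: "n > 0"
    and cont: "continuous_on (parabolic_domain n t) F"
    and nz: "\<And>z. z \<in> parabolic_domain n t \<Longrightarrow> F z \<noteq> 0"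
    and inv: "\<And>s u. (s, u) \<in> parabolic_domain n t \<Longrightarrow>
         F (s, u + 1) = F (s, u) \<and> F (s + 1, u) = F (s, u) \<and>
         F (s + \<i>, u + 2 * of_nat n * s + of_nat n * \<i>) = F (s, u)"
  obtains G where "continuous_on (parabolic_domain n t) G"
    "\<And>z. z \<in> parabolic_domain n t \<Longrightarrow> F z = exp (G z)"
    "\<And>s u. (s, u) \<in> parabolic_domain n t \<Longrightarrow> G (s, u + 1) = G (s, u)"
proof -
  let ?H = "parabolic_domain n t"
  obtain G where G: "continuous_on ?H G" "\<And>z. z \<in> ?H \<Longrightarrow> F z = exp (G z)"
    using continuous_logarithm_on_contractible[OF cont convex_imp_contractible[OF convex_parabolic_domain] nz]
    by blast
  have const: "\<exists>k. \<forall>s u. (s, u) \<in> ?H \<longrightarrow> G (a s u, b s u) = G (s, u) + k"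
    if c: "continuous_on ?H (\<lambda>z. (a (fst z) (snd z), b (fst z) (snd z)))"
      and H: "\<And>s u. (s, u) \<in> ?H \<Longrightarrow> (a s u, b s u) \<in> ?H"
      and F: "\<And>s u. (s, u) \<in> ?H \<Longrightarrow> F (a s u, b s u) = F (s, u)" for a b
  proof -
    have "(\<lambda>z. G (a (fst z) (snd z), b (fst z) (snd z)) - G z) constant_on ?H"
    proof (rule continuous_exp_eq_1_imp_constant)
      show "connected ?H" by (rule convex_connected[OF convex_parabolic_domain])
      show "continuous_on ?H (\<lambda>z. G (a (fst z) (snd z), b (fst z) (snd z)) - G z)"
        by (rule continuous_on_diff[OF continuous_on_compose2[OF G(1) c] G(1)]) (use H in auto)
      show "exp (G (a (fst z) (snd z), b (fst z) (snd z)) - G z) = 1" if "z \<in> ?H" for z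
        using G(2)[of z] G(2)[OF H, of "fst z" "snd z"] F[of "fst z" "snd z"] that
        by (simp add: exp_diff)
    qed
    then obtain k where "\<forall>z\<in>?H. G (a (fst z) (snd z), b (fst z) (snd z)) - G z = k"
      unfolding constant_on_def by blast
    then show ?thesis by (intro exI[of _ k]) (auto simp: algebra_simps)
  qed
  have memT: "(s, u + 1) \<in> ?H" and memA: "(s + 1, u) \<in> ?H"
    and memB: "(s + \<i>, u + 2 * of_nat n * s + of_nat n * \<i>) \<in> ?H" if "(s, u) \<in> ?H" for s u
    using that by (auto simp: parabolic_domain_def power2_eq_square algebra_simps)
  have "\<exists>k. \<forall>s u. (s, u) \<in> ?H \<longrightarrow> G (s, u + 1) = G (s, u) + k"
    by (rule const) (use memT inv in \<open>auto intro!: continuous_intros\<close>)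
  then obtain kT where kT: "\<And>s u. (s, u) \<in> ?H \<Longrightarrow> G (s, u + 1) = G (s, u) + kT" by blast
  have "\<exists>k. \<forall>s u. (s, u) \<in> ?H \<longrightarrow> G (s + 1, u) = G (s, u) + k"
    by (rule const) (use memA inv in \<open>auto intro!: continuous_intros\<close>)
  then obtain kA where kA: "\<And>s u. (s, u) \<in> ?H \<Longrightarrow> G (s + 1, u) = G (s, u) + kA" by blast
  have "\<exists>k. \<forall>s u. (s, u) \<in> ?H \<longrightarrow>
      G (s + \<i>, u + 2 * of_nat n * s + of_nat n * \<i>) = G (s, u) + k"
    by (rule const) (use memB inv in \<open>auto intro!: continuous_intros\<close>)
  then obtain kB where kB: "\<And>s u. (s, u) \<in> ?H \<Longrightarrow>
      G (s + \<i>, u + 2 * of_nat n * s + of_nat n * \<i>) = G (s, u) + kB" by blast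
  have kTm: "(s, u + of_nat m) \<in> ?H \<and> G (s, u + of_nat m) = G (s, u) + of_nat m * kT"
    if "(s, u) \<in> ?H" for s u m
  proof (induction m)
    case (Suc m)
    then show ?case using memT[of s "u + of_nat m"] kT[of s "u + of_nat m"]
      by (simp add: algebra_simps)
  qed (use that in auto)
  define u0 :: complex where "u0 = of_real (t + 1) * \<i>"
  have u0: "(0, u0) \<in> ?H" by (simp add: parabolic_domain_def u0_def)
  have AB: "G (\<i> + 1, u0 + of_nat n * \<i>) = G (0, u0) + kB + kA"
    using kA[OF memB[OF u0]] kB[OF u0] by simp
  have "G (1 + \<i>, u0 + 2 * of_nat n + of_nat n * \<i>) = G (0, u0) + kA + kB"
    using kB[OF memA[OF u0]] kA[OF u0] by simp
  moreover have "G (\<i> + 1, u0 + of_nat n * \<i> + of_nat (2 * n)) = G (\<i> + 1, u0 + of_nat n * \<i>) + of_nat (2 * n) * kT"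
    using kTm[of "\<i> + 1" "u0 + of_nat n * \<i>" "2 * n"] memA[OF memB[OF u0]] by simp
  ultimately have "of_nat (2 * n) * kT = 0" using AB by (simp add: algebra_simps)
  then have "kT = 0" using n by simp
  then show ?thesis using that G kT by simp
qed

section \<open>The mean of the logarithm of the modulus over a period\<close>

definition log_mean :: "(complex \<Rightarrow> complex) \<Rightarrow> complex \<Rightarrow> real" where
  "log_mean \<phi> u = integral {0..1} (\<lambda>\<xi>. ln (cmod (\<phi> (u + of_real \<xi>))))"

text \<open>Since Re log is the logarithm of the modulus, the real mean is the real part of a
  contour integral of any continuous branch. This makes primitives and Morera's theorem
  available.\<close>

lemma Re_contour_integral_log:
  assumes "continuous_on (closed_segment u (u + 1)) g"
    and "\<And>z. z \<in> closed_segment u (u + 1) \<Longrightarrow> \<phi> z = exp (g z)"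
  shows "Re (contour_integral (linepath u (u + 1)) g) = log_mean \<phi> u"
proof -
  have lp: "linepath u (u + 1) \<xi> = u + of_real \<xi>" for \<xi>
    by (simp add: linepath_def scaleR_conv_of_real algebra_simps)
  have seg: "u + of_real \<xi> \<in> closed_segment u (u + 1)" if "\<xi> \<in> {0..1}" for \<xi>
    using that linepath_in_path[of \<xi> u "u + 1"] by (simp add: lp)
  have "continuous_on {0..1} (\<lambda>\<xi>. g (u + of_real \<xi>))"
    using seg by (intro continuous_on_compose2[OF assms(1)] continuous_intros) auto
  then have int: "(\<lambda>\<xi>. g (u + of_real \<xi>)) integrable_on {0..1}"
    by (rule integrable_continuous_real)
  have "contour_integral (linepath u (u + 1)) g = integral {0..1} (\<lambda>\<xi>. g (u + of_real \<xi>))"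
    by (simp add: contour_integral_integral lp)
  then have "Re (contour_integral (linepath u (u + 1)) g) = integral {0..1} (\<lambda>\<xi>. Re (g (u + of_real \<xi>)))"
    using integral_linear[OF int bounded_linear_Re] by (simp add: o_def)
  also have "\<dots> = log_mean \<phi> u"
    unfolding log_mean_def using assms(2) seg by (intro integral_cong) auto
  finally show ?thesis .
qed

text \<open>A primitive of the logarithm changes by a constant under \<open>u \<mapsto> u + 1\<close>.\<close>

lemma log_mean_constant:
  assumes hol: "\<phi> holomorphic_on {u. Im u > t}"
    and g: "continuous_on {u. Im u > t} g" "\<And>u. Im u > t \<Longrightarrow> \<phi> u = exp (g u)"
    and per: "\<And>u. Im u > t \<Longrightarrow> g (u + 1) = g u"
    and uv: "Im u > t" "Im v > t"
  shows "log_mean \<phi> u = log_mean \<phi> v"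
proof -
  let ?H = "{u. Im u > t}"
  have H: "convex ?H" "open ?H"
    by (simp_all add: convex_halfspace_Im_gt open_halfspace_Im_gt)
  have "(\<lambda>z. exp (g z)) holomorphic_on ?H"
    using hol by (rule holomorphic_transform) (use g(2) in auto)
  then have "g holomorphic_on ?H" by (rule continuous_log_holomorphic[OF H g(1)])
  then obtain P where "\<And>x. x \<in> ?H \<Longrightarrow> (P has_field_derivative g x) (at x within ?H)"
    using holomorphic_convex_primitive'[OF H] by blast
  then have P: "(P has_field_derivative g x) (at x)" if "x \<in> ?H" for x
    using at_within_open[OF that H(2)] that by metis
  have seg: "closed_segment w (w + 1) \<subseteq> ?H" if "w \<in> ?H" for w
    using that by (intro closed_segment_subset H) auto
  have ci: "contour_integral (linepath w (w + 1)) g = P (w + 1) - P w" if "w \<in> ?H" for w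
    using contour_integral_primitive[OF has_field_derivative_at_within[OF P], of ?H "linepath w (w + 1)"]
      seg[OF that] by (auto intro: contour_integral_unique)
  have "\<exists>c. \<forall>w\<in>?H. P (w + 1) - P w = c"
  proof (rule has_field_derivative_zero_constant[OF H(1)])
    fix w assume w: "w \<in> ?H"
    then have "((\<lambda>w. P (w + 1) - P w) has_field_derivative g (w + 1) * 1 - g w) (at w)"
      by (intro DERIV_diff DERIV_chain2[of P "g (w + 1)" "\<lambda>w. w + 1"] P)
        (auto intro!: derivative_eq_intros)
    then show "((\<lambda>w. P (w + 1) - P w) has_field_derivative 0) (at w within ?H)"
      using per w by (auto intro: has_field_derivative_at_within)
  qed
  then have "P (u + 1) - P u = P (v + 1) - P v" using uv by auto
  moreover have "Re (P (w + 1) - P w) = log_mean \<phi> w" if "w \<in> ?H" for w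
    unfolding ci[OF that, symmetric]
    by (rule Re_contour_integral_log[OF continuous_on_subset[OF g(1) seg[OF that]]])
      (use seg[OF that] g(2) in auto)
  ultimately show ?thesis using uv by (metis mem_Collect_eq)
qed

section \<open>Contour integrals that depend on a parameter\<close>

lemma continuous_contour_integral_param:
  fixes L :: "'a::topological_space \<Rightarrow> complex \<Rightarrow> complex"
  assumes "continuous_on (U \<times> closed_segment a b) (\<lambda>(x, u). L x u)"
  shows "continuous_on U (\<lambda>x. contour_integral (linepath a b) (L x))"
proof -
  have "continuous_on (U \<times> cbox 0 1) (\<lambda>z. L (fst z) (linepath a b (snd z)) * (b - a))"
    using continuous_on_compose2[OF assms, of "U \<times> cbox 0 1" "\<lambda>z. (fst z, linepath a b (snd z))"]
    by (force simp: linepath_in_path intro!: continuous_intros continuous_on_compose2[OF continuous_on_linepath])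
  then have "continuous_on U (\<lambda>x. integral (cbox 0 1) (\<lambda>t. L x (linepath a b t) * (b - a)))"
    by (intro integral_continuous_on_param) (simp add: case_prod_unfold)
  then show ?thesis by (simp add: contour_integral_integral)
qed

text \<open>Morera's theorem: after exchanging the two integrals, the integral over a triangle
  stands inside, where it vanishes for each fixed u by Cauchy's theorem.\<close>

lemma holomorphic_contour_integral_param:
  assumes "open S" and cont: "continuous_on (S \<times> closed_segment a b) (\<lambda>(x, u). L x u)"
    and hol: "\<And>u. u \<in> closed_segment a b \<Longrightarrow> (\<lambda>x. L x u) holomorphic_on S"
  shows "(\<lambda>x. contour_integral (linepath a b) (L x)) holomorphic_on S"
proof -
  let ?c = "\<lambda>x. contour_integral (linepath a b) (L x)"
  have swap: "contour_integral (linepath p q) ?c =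
      contour_integral (linepath a b) (\<lambda>u. contour_integral (linepath p q) (\<lambda>x. L x u))"
    and int: "(\<lambda>u. contour_integral (linepath p q) (\<lambda>x. L x u)) contour_integrable_on (linepath a b)"
    if "closed_segment p q \<subseteq> S" for p q
  proof -
    have c: "continuous_on (closed_segment p q \<times> closed_segment a b) (\<lambda>(x, u). L x u)"
      using that by (intro continuous_on_subset[OF cont]) auto
    show "contour_integral (linepath p q) ?c =
      contour_integral (linepath a b) (\<lambda>u. contour_integral (linepath p q) (\<lambda>x. L x u))"
      by (rule contour_integral_swap) (use c in auto)
    have "continuous_on (closed_segment a b \<times> closed_segment p q) (\<lambda>(u, x). L x u)"
      using continuous_on_compose2[OF c continuous_on_swap[of "closed_segment a b \<times> closed_segment p q"]]
      by (simp add: case_prod_unfold image_subset_iff)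
    then show "(\<lambda>u. contour_integral (linepath p q) (\<lambda>x. L x u)) contour_integrable_on (linepath a b)"
      by (intro contour_integrable_continuous_linepath continuous_contour_integral_param)
  qed
  have "?c analytic_on S"
  proof (rule Morera_triangle[OF continuous_contour_integral_param[OF cont] assms(1)], intro impI)
    fix p q r assume hull: "convex hull {p, q, r} \<subseteq> S"
    have seg: "closed_segment p q \<subseteq> S" "closed_segment q r \<subseteq> S" "closed_segment r p \<subseteq> S"
      by (rule order_trans[OF segments_subset_convex_hull(1) hull]
          order_trans[OF segments_subset_convex_hull(3) hull]
          order_trans[OF segments_subset_convex_hull(5) hull])+
    let ?I = "\<lambda>p q u. contour_integral (linepath p q) (\<lambda>x. L x u)"
    have z: "?I p q u + ?I q r u + ?I r p u = 0" if u: "u \<in> closed_segment a b" for u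
    proof -
      have h: "(\<lambda>x. L x u) holomorphic_on S" by (rule hol[OF u])
      have i: "(\<lambda>x. L x u) contour_integrable_on linepath v w" if "closed_segment v w \<subseteq> S" for v w
        using that h holomorphic_on_imp_continuous_on holomorphic_on_subset
        by (blast intro: contour_integrable_continuous_linepath)
      have "((\<lambda>x. L x u) has_contour_integral 0) (linepath p q +++ linepath q r +++ linepath r p)"
        by (rule Cauchy_theorem_triangle) (rule holomorphic_on_subset[OF h hull])
      from contour_integral_unique[OF this] show ?thesis
        using i seg by (simp add: add.assoc)
    qed
    have "contour_integral (linepath p q) ?c + contour_integral (linepath q r) ?c + contour_integral (linepath r p) ?c
      = contour_integral (linepath a b) (\<lambda>u. ?I p q u + ?I q r u + ?I r p u)"
      using int seg by (simp add: swap contour_integral_add contour_integrable_add)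
    also have "\<dots> = contour_integral (linepath a b) (\<lambda>u. 0)"
      by (rule contour_integral_eq) (use z in auto)
    finally show "contour_integral (linepath p q) ?c + contour_integral (linepath q r) ?c +
      contour_integral (linepath r p) ?c = 0" by simp
  qed
  then show ?thesis by (rule analytic_imp_holomorphic)
qed

text \<open>By periodicity \<open>m\<close> attains its maximum, on the unit square. If the maximum
  is positive, the set where it is attained is closed, and by the maximum modulus principle for the
  local functions \<open>h\<close> it is open, so it is the whole plane.\<close>

lemma doubly_periodic_modulus_constant:
  fixes m :: "complex \<Rightarrow> real"
  assumes cont: "continuous_on UNIV m" and nonneg: "\<And>x. m x \<ge> 0"
    and per: "\<And>x. m (x + 1) = m x" "\<And>x. m (x + \<i>) = m x"
    and loc: "\<And>x. m x > 0 \<Longrightarrow> \<exists>r>0. \<exists>h. h holomorphic_on ball x r \<and> (\<forall>y\<in>ball x r. m y = cmod (h y))"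
  shows "m x = m y"
proof -
  have pern: "m (x + of_nat k) = m x" "m (x + of_nat k * \<i>) = m x" for x k
  proof -
    show "m (x + of_nat k) = m x"
    proof (induction k)
      case (Suc k)
      then show ?case using per(1)[of "x + of_nat k"] by (simp add: ac_simps)
    qed simp
    show "m (x + of_nat k * \<i>) = m x"
    proof (induction k)
      case (Suc k)
      then show ?case using per(2)[of "x + of_nat k * \<i>"] by (simp add: algebra_simps)
    qed simp
  qed
  have per1: "m (x + of_int k) = m x" for x k
    using pern(1)[of x "nat k"] pern(1)[of "x + of_int k" "nat (- k)"] by (cases "k \<ge> 0") auto
  have per2: "m (x + of_int k * \<i>) = m x" for x k
    using pern(2)[of x "nat k"] pern(2)[of "x + of_int k * \<i>" "nat (- k)"]
    by (cases "k \<ge> 0") (auto simp: algebra_simps)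
  have red: "\<exists>y\<in>cbox 0 (1 + \<i>). m y = m x" for x
  proof
    let ?y = "x + of_int (- \<lfloor>Re x\<rfloor>) + of_int (- \<lfloor>Im x\<rfloor>) * \<i>"
    show "m ?y = m x" by (metis per1 per2)
    have "Re x - of_int \<lfloor>Re x\<rfloor> \<le> 1" "Im x - of_int \<lfloor>Im x\<rfloor> \<le> 1" by linarith+
    then show "?y \<in> cbox 0 (1 + \<i>)" by (simp add: in_cbox_complex_iff)
  qed
  obtain x0 where x0: "\<forall>y\<in>cbox 0 (1 + \<i>). m y \<le> m x0"
    using continuous_attains_sup[of "cbox 0 (1 + \<i>)" m] continuous_on_subset[OF cont subset_UNIV] red[of 0]
    by (metis compact_cbox empty_iff)
  then have max: "m y \<le> m x0" for y using red by metis
  show ?thesis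
  proof (cases "m x0 > 0")
    case False
    then show ?thesis using max nonneg by (metis order.antisym order.trans not_less)
  next
    case True
    let ?M = "{x. m x = m x0}"
    have "closed ?M" by (intro closed_Collect_eq cont continuous_intros)
    moreover have "open ?M" unfolding open_contains_ball
    proof
      fix z assume z: "z \<in> ?M"
      with True have "m z > 0" by simp
      from loc[OF this] obtain r h where
        r: "r > 0" "h holomorphic_on ball z r" "\<forall>y\<in>ball z r. m y = cmod (h y)" by blast
      have "cmod (h w) \<le> cmod (h z)" if "w \<in> ball z r" for w
        using r(1,3) that z max[of w] by (metis centre_in_ball mem_Collect_eq)
      then have "h constant_on ball z r"
        by (intro maximum_modulus_principle[OF r(2), of "ball z r" z]) (use r(1) in auto)
      then obtain k where k: "\<forall>w\<in>ball z r. h w = k" unfolding constant_on_def by blast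
      then have "m w = m x0" if "w \<in> ball z r" for w
        using r(1,3) that z by simp
      then show "\<exists>e>0. ball z e \<subseteq> ?M" using r(1) by blast
    qed
    ultimately have "?M = UNIV"
      using clopen[of ?M] by auto
    then have "m x = m x0" "m y = m x0" by blast+
    then show ?thesis by simp
  qed
qed

text \<open>What is left of a local equation or of a form on a slice of fixed \<tau>. The
  translations in \<open>inv\<close> generate the Heisenberg group acting on (s, u), those in
  \<open>inv_x\<close> are the two periods in x. The shift of u by 4 x + c + 2 i raises Im u by 2
  (Im x + 1)^2 - 2 (Im x)^2 and so respects the domain. Vanishing depends on x alone by
  \<open>dich\<close>.\<close>

locale jacobi_family =
  fixes F :: "complex \<Rightarrow> complex \<Rightarrow> complex \<Rightarrow> complex" and n :: nat and c t :: real
  assumes n_pos: "n > 0"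
    and cont: "continuous_on {(x, s, u). (s, u) \<in> parabolic_domain n (t + 2 * (Im x)\<^sup>2)} (\<lambda>(x, s, u). F x s u)"
    and hol_x: "\<And>x u. Im u > t + 2 * (Im x)\<^sup>2 \<Longrightarrow> (\<lambda>x. F x 0 u) field_differentiable (at x)"
    and hol_u: "\<And>x u. Im u > t + 2 * (Im x)\<^sup>2 \<Longrightarrow> (\<lambda>u. F x 0 u) field_differentiable (at u)"
    and inv: "\<And>x s u. (s, u) \<in> parabolic_domain n (t + 2 * (Im x)\<^sup>2) \<Longrightarrow>
         F x s (u + 1) = F x s u \<and> F x (s + 1) u = F x s u \<and>
         F x (s + \<i>) (u + 2 * of_nat n * s + of_nat n * \<i>) = F x s u"
    and inv_x: "\<And>x u. Im u > t + 2 * (Im x)\<^sup>2 \<Longrightarrow>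
         F (x + 1) 0 u = F x 0 u \<and> F (x + \<i>) 0 (u + 4 * x + of_real c + 2 * \<i>) = F x 0 u"
    and dich: "\<And>x. (\<forall>(s, u) \<in> parabolic_domain n (t + 2 * (Im x)\<^sup>2). F x s u \<noteq> 0) \<or>
         (\<forall>(s, u) \<in> parabolic_domain n (t + 2 * (Im x)\<^sup>2). F x s u = 0)"
begin

text \<open>A sample point for s = 0, at height 1 above the boundary of the half-plane of u.\<close>

definition base :: "complex \<Rightarrow> complex" where
  "base x = of_real (t + 1 + 2 * (Im x)\<^sup>2) * \<i>"

definition nonzero :: "complex \<Rightarrow> bool" where
  "nonzero x \<longleftrightarrow> F x 0 (base x) \<noteq> 0"

definition mean_modulus :: "complex \<Rightarrow> real" where
  "mean_modulus x = (if nonzero x then exp (log_mean (F x 0) (base x)) else 0)"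

lemma Im_base: "Im (base x) = t + 1 + 2 * (Im x)\<^sup>2"
  by (simp add: base_def)

lemma zero_iff: "(s, u) \<in> parabolic_domain n (t + 2 * (Im x)\<^sup>2) \<Longrightarrow> F x s u = 0 \<longleftrightarrow> \<not> nonzero x"
proof -
  assume su: "(s, u) \<in> parabolic_domain n (t + 2 * (Im x)\<^sup>2)"
  have "(0, base x) \<in> parabolic_domain n (t + 2 * (Im x)\<^sup>2)"
    by (simp add: parabolic_domain_def Im_base)
  then show ?thesis using dich[of x] su unfolding nonzero_def by blast
qed

lemma zero_iff0: "Im u > t + 2 * (Im x)\<^sup>2 \<Longrightarrow> F x 0 u = 0 \<longleftrightarrow> \<not> nonzero x"
  by (rule zero_iff) (simp add: parabolic_domain_def)

lemma continuous_on_F: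
  assumes "continuous_on A f" "continuous_on A g" "continuous_on A h"
    and "\<And>z. z \<in> A \<Longrightarrow> (g z, h z) \<in> parabolic_domain n (t + 2 * (Im (f z))\<^sup>2)"
  shows "continuous_on A (\<lambda>z. F (f z) (g z) (h z))"
proof -
  have "continuous_on A (\<lambda>z. (f z, g z, h z))" by (intro continuous_intros assms)
  from continuous_on_compose2[OF cont this] show ?thesis using assms(4) by (auto simp: image_subset_iff)
qed

text \<open>The mean concerns s = 0 only, but the periodicity of the logarithm that makes it
  independent of u comes from a logarithm on the whole domain of (s, u), where the Heisenberg
  translations act.\<close>

lemma log_mean_base:
  assumes "nonzero x" "Im u > t + 2 * (Im x)\<^sup>2"
  shows "log_mean (F x 0) u = log_mean (F x 0) (base x)"
proof -
  let ?t = "t + 2 * (Im x)\<^sup>2"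
  have "continuous_on (parabolic_domain n ?t) (\<lambda>(s, u). F x s u)"
    unfolding case_prod_unfold by (intro continuous_on_F continuous_intros) auto
  then obtain G where G: "continuous_on (parabolic_domain n ?t) G"
    "\<And>z. z \<in> parabolic_domain n ?t \<Longrightarrow> (\<lambda>(s, u). F x s u) z = exp (G z)"
    "\<And>s u. (s, u) \<in> parabolic_domain n ?t \<Longrightarrow> G (s, u + 1) = G (s, u)"
  proof (rule Heisenberg_invariant_log_periodic[OF n_pos])
    show "(\<lambda>(s, u). F x s u) z \<noteq> 0" if "z \<in> parabolic_domain n ?t" for z
      using that zero_iff[of "fst z" "snd z" x] assms(1) by (simp add: case_prod_unfold)
  qed (use inv in auto)
  have mem: "(0, u) \<in> parabolic_domain n ?t" if "Im u > ?t" for u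
    using that by (simp add: parabolic_domain_def)
  show ?thesis
  proof (rule log_mean_constant[where t = ?t and g = "\<lambda>u. G (0, u)"])
    show "F x 0 holomorphic_on {u. ?t < Im u}"
      using hol_u by (auto simp: holomorphic_on_def field_differentiable_at_within)
    show "continuous_on {u. ?t < Im u} (\<lambda>u. G (0, u))"
      using mem by (intro continuous_on_compose2[OF G(1)] continuous_intros) auto
    show "F x 0 u = exp (G (0, u))" if "?t < Im u" for u using G(2)[OF mem[OF that]] by simp
    show "G (0, u + 1) = G (0, u)" if "?t < Im u" for u by (rule G(3)[OF mem[OF that]])
  qed (simp_all add: assms(2) Im_base)
qed

text \<open>Near such a point F has a logarithm that is continuous in x and u jointly. Its integral
  over a period segment is holomorphic in x, and the exponential of this integral has modulus
  \<open>mean_modulus\<close>.\<close>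

lemma mean_modulus_local:
  assumes "nonzero x"
  shows "\<exists>r>0. \<exists>h. h holomorphic_on ball x r \<and> (\<forall>y\<in>ball x r. mean_modulus y = cmod (h y))"
proof -
  have "continuous_on UNIV (\<lambda>y. F y 0 (base y))"
    unfolding base_def by (intro continuous_on_F continuous_intros) (auto simp: parabolic_domain_def)
  then have "open {y. nonzero y}"
    unfolding nonzero_def by (intro open_Collect_neq continuous_intros)
  then obtain r0 where r0: "r0 > 0" "ball x r0 \<subseteq> {y. nonzero y}"
    using assms unfolding open_contains_ball by blast
  define r where "r = min r0 1"
  have good: "nonzero y" if "y \<in> ball x r" for y
    using r0(2) that by (simp add: r_def subset_iff)
  then have r: "r > 0" "r \<le> 1" using r0(1) by (auto simp: r_def)
  \<comment> \<open>One segment that lies in the domain for all y in the ball, because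
    \<open>r \<le> 1\<close> keeps the modulus of Im y below that of Im x plus 1. By
    \<open>log_mean_base\<close> the mean may be computed on it for every y.\<close>
  define u0 where "u0 = of_real (t + 1 + 2 * (\<bar>Im x\<bar> + 1)\<^sup>2) * \<i>"
  let ?S = "closed_segment u0 (u0 + 1)"
  have Im_S: "Im u = t + 1 + 2 * (\<bar>Im x\<bar> + 1)\<^sup>2" if "u \<in> ?S" for u
    using that by (auto simp: closed_segment_def u0_def algebra_simps)
  have dom: "Im u > t + 2 * (Im y)\<^sup>2" if "y \<in> ball x r" "u \<in> ?S" for y u
  proof -
    have "\<bar>Im y - Im x\<bar> \<le> cmod (y - x)" by (metis abs_Im_le_cmod minus_complex.sel(2))
    also have "\<dots> < 1" using that r by (simp add: dist_norm norm_minus_commute)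
    finally have "\<bar>Im y\<bar> \<le> \<bar>\<bar>Im x\<bar> + 1\<bar>" by linarith
    then have "(Im y)\<^sup>2 \<le> (\<bar>Im x\<bar> + 1)\<^sup>2" by (simp only: abs_le_square_iff)
    then show ?thesis using Im_S[OF that(2)] by simp
  qed
  have contF: "continuous_on (ball x r \<times> ?S) (\<lambda>z. F (fst z) 0 (snd z))"
    using dom by (intro continuous_on_F continuous_intros) (auto simp: parabolic_domain_def)
  have "contractible (ball x r \<times> ?S)"
    by (intro convex_imp_contractible convex_Times convex_ball convex_closed_segment)
  then obtain L where L: "continuous_on (ball x r \<times> ?S) L"
    "\<And>z. z \<in> ball x r \<times> ?S \<Longrightarrow> F (fst z) 0 (snd z) = exp (L z)"
    using continuous_logarithm_on_contractible[OF contF] zero_iff0 dom good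
    by (metis (no_types, lifting) mem_Sigma_iff prod.collapse)
  let ?c = "\<lambda>y. contour_integral (linepath u0 (u0 + 1)) (\<lambda>u. L (y, u))"
  have "?c holomorphic_on ball x r"
  proof (rule holomorphic_contour_integral_param)
    fix u assume u: "u \<in> ?S"
    show "(\<lambda>y. L (y, u)) holomorphic_on ball x r"
    proof (rule continuous_log_holomorphic)
      show "continuous_on (ball x r) (\<lambda>y. L (y, u))"
        by (rule continuous_on_compose2[OF L(1) continuous_on_Pair[OF continuous_on_id continuous_on_const]])
          (use u in auto)
      have "(\<lambda>y. F y 0 u) holomorphic_on ball x r"
        using hol_x dom[OF _ u] by (auto simp: holomorphic_on_def field_differentiable_at_within)
      then show "(\<lambda>y. exp (L (y, u))) holomorphic_on ball x r"
        by (rule holomorphic_transform) (use L(2)[of "(_, u)"] u in auto)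
    qed auto
  qed (use L(1) in auto)
  then have "(\<lambda>y. exp (?c y)) holomorphic_on ball x r" by (intro holomorphic_intros)
  moreover have "mean_modulus y = cmod (exp (?c y))" if y: "y \<in> ball x r" for y
  proof -
    have "Re (?c y) = log_mean (F y 0) u0"
    proof (rule Re_contour_integral_log)
      show "continuous_on ?S (\<lambda>u. L (y, u))"
        by (rule continuous_on_compose2[OF L(1) continuous_on_Pair[OF continuous_on_const continuous_on_id]])
          (use y in auto)
    qed (use L(2)[of "(y, _)"] y in auto)
    also have "\<dots> = log_mean (F y 0) (base y)"
      by (rule log_mean_base[OF good[OF y] dom[OF y]]) simp
    finally show ?thesis using good[OF y] by (simp add: mean_modulus_def)
  qed
  ultimately show ?thesis using r(1) by blast
qed

text \<open>Uniform continuity on a compact set makes F small on the whole period segment of every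
  point near x, and a geometric mean is at most the supremum.\<close>

lemma mean_modulus_tendsto_0:
  assumes "\<not> nonzero x" "e > 0"
  shows "\<exists>d>0. \<forall>y. dist y x < d \<longrightarrow> mean_modulus y \<le> e"
proof -
  let ?K = "cball x 1 \<times> {0..1::real}"
  let ?f = "\<lambda>z. F (fst z) 0 (base (fst z) + of_real (snd z))"
  have "continuous_on ?K ?f"
    unfolding base_def by (intro continuous_on_F continuous_intros) (auto simp: parabolic_domain_def)
  moreover have "compact ?K" by (intro compact_Times) auto
  ultimately have "uniformly_continuous_on ?K ?f" by (rule compact_uniformly_continuous)
  then obtain d where d: "d > 0" "\<forall>z\<in>?K. \<forall>w\<in>?K. dist w z < d \<longrightarrow> dist (?f w) (?f z) < e"
    unfolding uniformly_continuous_on_def using assms(2) by blast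
  have "mean_modulus y \<le> e" if y: "dist y x < min d 1" for y
  proof (cases "nonzero y")
    case True
    have bound: "cmod (F y 0 (base y + of_real \<xi>)) \<le> e" "F y 0 (base y + of_real \<xi>) \<noteq> 0" if "\<xi> \<in> {0..1}" for \<xi>
    proof -
      have "dist (y, \<xi>) (x, \<xi>) < d" using y by (simp add: dist_Pair_Pair)
      then have "dist (?f (y, \<xi>)) (?f (x, \<xi>)) < e"
        using d(2) y that by (auto simp: dist_commute)
      moreover have "?f (x, \<xi>) = 0" using zero_iff0[of x "base x + of_real \<xi>"] assms(1) by (simp add: Im_base)
      ultimately show "cmod (F y 0 (base y + of_real \<xi>)) \<le> e" by simp
      show "F y 0 (base y + of_real \<xi>) \<noteq> 0"
        using zero_iff0[of y "base y + of_real \<xi>"] True by (simp add: Im_base)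
    qed
    have "continuous_on {0..1} (\<lambda>\<xi>. F y 0 (base y + of_real \<xi>))"
      by (intro continuous_on_F continuous_intros) (auto simp: parabolic_domain_def Im_base)
    then have "continuous_on {0..1} (\<lambda>\<xi>. ln (cmod (F y 0 (base y + of_real \<xi>))))"
      using bound(2) by (intro continuous_intros) auto
    then have "log_mean (F y 0) (base y) \<le> integral {0..1::real} (\<lambda>_. ln e)"
      unfolding log_mean_def using bound assms(2)
      by (intro integral_le integrable_continuous_real) auto
    then have "exp (log_mean (F y 0) (base y)) \<le> exp (ln e)" by simp
    then show ?thesis using True assms(2) by (simp add: mean_modulus_def)
  qed (use assms(2) in \<open>simp add: mean_modulus_def\<close>)
  then show ?thesis using d(1) by (intro exI[of _ "min d 1"]) auto
qed

lemma mean_modulus_pos_iff: "mean_modulus x > 0 \<longleftrightarrow> nonzero x"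
  unfolding mean_modulus_def by (cases "nonzero x") simp_all

lemma mean_modulus_periodic: "mean_modulus (x + 1) = mean_modulus x" "mean_modulus (x + \<i>) = mean_modulus x"
proof -
  have seq: "F (x + 1) 0 u = F x 0 u" if "Im u > t + 2 * (Im x)\<^sup>2" for u
    using inv_x[OF that] by blast
  have nz1: "nonzero (x + 1) \<longleftrightarrow> nonzero x"
    using zero_iff0[of "x + 1" "base x"] zero_iff0[of x "base x"] seq[of "base x"] by (simp add: Im_base)
  have "base (x + 1) = base x" by (simp add: base_def)
  moreover have "log_mean (F (x + 1) 0) (base x) = log_mean (F x 0) (base x)"
    unfolding log_mean_def by (intro integral_cong) (simp add: seq Im_base)
  ultimately show "mean_modulus (x + 1) = mean_modulus x"
    by (simp add: mean_modulus_def nz1)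
next
  \<comment> \<open>The translation by i sends \<open>base x\<close> to this point, which has the
    height of \<open>base (x + \<i>)\<close> but in general another real part;
    \<open>log_mean_base\<close> removes the difference.\<close>
  let ?u = "base x + 4 * x + of_real c + 2 * \<i>"
  have seq: "F (x + \<i>) 0 (u + 4 * x + of_real c + 2 * \<i>) = F x 0 u" if "Im u > t + 2 * (Im x)\<^sup>2" for u
    using inv_x[OF that] by blast
  have u: "Im ?u > t + 2 * (Im (x + \<i>))\<^sup>2"
    by (simp add: Im_base power2_eq_square algebra_simps)
  have nz: "nonzero (x + \<i>) \<longleftrightarrow> nonzero x"
    using zero_iff0[OF u] zero_iff0[of x "base x"] seq[of "base x"] by (simp add: Im_base)
  show "mean_modulus (x + \<i>) = mean_modulus x"
  proof (cases "nonzero x")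
    case True
    have "log_mean (F (x + \<i>) 0) ?u = log_mean (F x 0) (base x)"
      unfolding log_mean_def
    proof (intro integral_cong)
      fix \<xi> :: real
      have "?u + of_real \<xi> = base x + of_real \<xi> + 4 * x + of_real c + 2 * \<i>" by simp
      then show "ln (cmod (F (x + \<i>) 0 (?u + of_real \<xi>))) = ln (cmod (F x 0 (base x + of_real \<xi>)))"
        using seq[of "base x + of_real \<xi>"] by (simp only:) (simp add: Im_base)
    qed
    then show ?thesis
      using log_mean_base[of "x + \<i>" ?u] u True nz by (simp add: mean_modulus_def)
  qed (simp add: mean_modulus_def nz)
qed

text \<open>The mean modulus is continuous, doubly periodic, and locally the modulus of a
  holomorphic function where it is positive. Hence it is constant, and it vanishes everywhere or
  nowhere.\<close>

theorem nonzero_const: "nonzero x \<longleftrightarrow> nonzero y"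
proof -
  have "isCont mean_modulus x" for x
  proof (cases "nonzero x")
    case True
    then obtain r h where r: "r > 0" "h holomorphic_on ball x r" "\<forall>y\<in>ball x r. mean_modulus y = cmod (h y)"
      using mean_modulus_local by blast
    have "continuous_on (ball x r) mean_modulus"
      using r by (subst continuous_on_cong[OF refl, where g = "\<lambda>y. cmod (h y)"])
        (auto intro!: continuous_intros holomorphic_on_imp_continuous_on)
    then show ?thesis using r(1) by (simp add: continuous_on_eq_continuous_at)
  next
    case False
    have "\<forall>e>0. \<exists>d>0. \<forall>y. dist y x < d \<longrightarrow> dist (mean_modulus y) (mean_modulus x) < e"
    proof (intro allI impI)
      fix e :: real assume "e > 0"
      then obtain d where "d > 0" "\<forall>y. dist y x < d \<longrightarrow> mean_modulus y \<le> e / 2"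
        using mean_modulus_tendsto_0[OF False, of "e / 2"] by auto
      moreover have "mean_modulus x = 0" "mean_modulus y \<ge> 0" for y
        using False by (auto simp: mean_modulus_def)
      ultimately show "\<exists>d>0. \<forall>y. dist y x < d \<longrightarrow> dist (mean_modulus y) (mean_modulus x) < e"
        using \<open>e > 0\<close> by (intro exI[of _ d]) (fastforce simp: dist_real_def)
    qed
    then show ?thesis unfolding continuous_at_eps_delta .
  qed
  then have "continuous_on UNIV mean_modulus" by (simp add: continuous_at_imp_continuous_on)
  moreover have "mean_modulus x \<ge> 0" for x by (simp add: mean_modulus_def)
  ultimately have "mean_modulus x = mean_modulus y"
    by (rule doubly_periodic_modulus_constant)
      (simp_all only: mean_modulus_periodic mean_modulus_pos_iff mean_modulus_local)
  then show ?thesis using mean_modulus_pos_iff by metis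
qed

end

section \<open>Signature of the K3 form\<close>

lemma k3_form_commute: "z \<cdot> w = w \<cdot> z"
  by (simp add: k3_form_def mult.commute add.commute)

lemma k3_form_add: "(x + y) \<cdot> w = x \<cdot> w + y \<cdot> w" "w \<cdot> (x + y) = w \<cdot> x + w \<cdot> y"
  by (simp_all add: k3_form_def sum.distrib algebra_simps)

lemma k3_form_scale: "(c *s x) \<cdot> w = c * (x \<cdot> w)" "w \<cdot> (c *s x) = c * (w \<cdot> x)"
  by (simp_all add: k3_form_def sum_distrib_left algebra_simps)

lemma k3_form_minus: "(- x) \<cdot> w = - (x \<cdot> w)" "w \<cdot> (- x) = - (w \<cdot> x)"
  by (simp_all add: k3_form_def sum_negf sum_subtractf algebra_simps flip: sum.distrib)

lemma k3_form_diff: "(x - y) \<cdot> w = x \<cdot> w - y \<cdot> w" "w \<cdot> (x - y) = w \<cdot> x - w \<cdot> y"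
  using k3_form_add(1)[of x "- y" w] k3_form_add(2)[of w x "- y"] by (simp_all add: k3_form_minus)

lemma k3_form_zero: "0 \<cdot> w = 0" "w \<cdot> 0 = 0"
  by (simp_all add: k3_form_def)

lemmas k3_bilinear = k3_form_add k3_form_scale k3_form_minus k3_form_diff

lemma conj_vec_simps [simp]:
  "conj_vec (x + y) = conj_vec x + conj_vec y" "conj_vec (x - y) = conj_vec x - conj_vec y"
  "conj_vec (c *s x) = cnj c *s conj_vec x" "conj_vec (conj_vec x) = x" "conj_vec (- x) = - conj_vec x"
  "conj_vec (axis k a) = axis k (cnj a)" "conj_vec x $ k = cnj (x $ k)"
  by (simp_all add: conj_vec_def vec_eq_iff axis_def)

lemma k3_form_conj: "conj_vec z \<cdot> conj_vec w = cnj (z \<cdot> w)"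
  by (simp add: k3_form_def)

lemma k3_form_axis:
  "z \<cdot> axis (E i) a = a * z $ F i" "z \<cdot> axis (F i) a = a * z $ E i"
  "z \<cdot> axis (R1 j) a = - (a * z $ R1 j)" "z \<cdot> axis (R2 j) a = - (a * z $ R2 j)"
  "axis (E i) a \<cdot> z = a * z $ F i" "axis (F i) a \<cdot> z = a * z $ E i"
  "axis (R1 j) a \<cdot> z = - (a * z $ R1 j)" "axis (R2 j) a \<cdot> z = - (a * z $ R2 j)"
  by (simp_all add: k3_form_def axis_def if_distrib[of "\<lambda>x. _ * x"] if_distrib[of "\<lambda>x. x * _"]
      mult.commute cong: if_cong)

lemma k3_form_h: "z \<cdot> h_vec g = z $ F 3 + (of_int g - 1) * z $ E 3"
  by (simp add: h_vec_def k3_bilinear k3_form_axis algebra_simps)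

lemma h_h: "h_vec g \<cdot> h_vec g = 2 * of_int g - 2"
  by (simp add: k3_form_h) (simp add: h_vec_def axis_def)

lemma conj_h [simp]: "conj_vec (h_vec g) = h_vec g"
  by (simp add: h_vec_def)

lemma Re_form_conj:
  "Re (z \<cdot> conj_vec z) = - (\<Sum>i\<in>UNIV. (cmod (z $ R1 i))\<^sup>2) - (\<Sum>i\<in>UNIV. (cmod (z $ R2 i))\<^sup>2)
     + 2 * (\<Sum>i\<in>UNIV. Re (z $ E i * cnj (z $ F i)))"
  by (simp add: k3_form_def complex_mult_cnj cmod_power2 sum.distrib mult.commute)

lemma Im_form_conj: "Im (z \<cdot> conj_vec z) = 0"
  using k3_form_conj[of z "conj_vec z"] k3_form_commute[of z "conj_vec z"]
  by (metis complex.sel(2) cnj.simps(2) conj_vec_simps(4) equal_neg_zero)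

lemma of_real_form_conj: "of_real (Re (z \<cdot> conj_vec z)) = z \<cdot> conj_vec z"
  by (simp add: complex_eq_iff Im_form_conj)

text \<open>The two equations force \<open>F i\<close> to be minus \<open>E i\<close> in the first
  two hyperbolic planes and so remove their positive directions; orthogonality to
  \<open>h_vec g\<close> does the same in the third. What remains is negative definite, of
  codimension two in the complement of \<open>h_vec g\<close>.\<close>

lemma nonpos_of_isotropic_part:
  assumes g: "g > 1" and h: "w \<cdot> h_vec g = 0"
    and EF: "w $ E 1 + w $ F 1 = 0" "w $ E 2 + w $ F 2 = 0"
  shows "Re (w \<cdot> conj_vec w) \<le> 0" "Re (w \<cdot> conj_vec w) = 0 \<Longrightarrow> w = 0"
proof -
  let ?R = "(\<Sum>i\<in>UNIV. (cmod (w $ R1 i))\<^sup>2) + (\<Sum>i\<in>UNIV. (cmod (w $ R2 i))\<^sup>2)"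
  have F: "w $ F 1 = - w $ E 1" "w $ F 2 = - w $ E 2" "w $ F 3 = - ((of_int g - 1) * w $ E 3)"
    using EF h by (simp_all add: k3_form_h add_eq_0_iff)
  have r: "Re (a * cnj (- a)) = - (cmod a)\<^sup>2" "Re (a * cnj (- ((of_int g - 1) * a))) = - ((of_int g - 1) * (cmod a)\<^sup>2)" for a
    by (simp_all only: cmod_power2) (simp_all add: power2_eq_square algebra_simps)
  have eq: "Re (w \<cdot> conj_vec w) = - ?R - 2 * (cmod (w $ E 1))\<^sup>2 - 2 * (cmod (w $ E 2))\<^sup>2
      - 2 * (of_int g - 1) * (cmod (w $ E 3))\<^sup>2"
    unfolding Re_form_conj sum_3 F r by simp
  have R: "(\<Sum>i\<in>UNIV. (cmod (w $ R1 i))\<^sup>2) \<ge> 0" "(\<Sum>i\<in>UNIV. (cmod (w $ R2 i))\<^sup>2) \<ge> 0"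
    by (simp_all add: sum_nonneg)
  have E3: "2 * (real_of_int g - 1) * (cmod (w $ E 3))\<^sup>2 \<ge> 0" using g by simp
  show "Re (w \<cdot> conj_vec w) \<le> 0" unfolding eq using R E3 zero_le_power2[of "cmod (w $ E 1)"] zero_le_power2[of "cmod (w $ E 2)"]
    by linarith
  assume "Re (w \<cdot> conj_vec w) = 0"
  then have z: "(\<Sum>i\<in>UNIV. (cmod (w $ R1 i))\<^sup>2) = 0" "(\<Sum>i\<in>UNIV. (cmod (w $ R2 i))\<^sup>2) = 0"
    "(cmod (w $ E 1))\<^sup>2 = 0" "(cmod (w $ E 2))\<^sup>2 = 0" "2 * (real_of_int g - 1) * (cmod (w $ E 3))\<^sup>2 = 0"
    unfolding eq using R E3 zero_le_power2[of "cmod (w $ E 1)"] zero_le_power2[of "cmod (w $ E 2)"]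
    by linarith+
  have R0: "w $ R1 i = 0" "w $ R2 i = 0" for i using z(1,2) by (simp_all add: sum_nonneg_eq_0_iff)
  have EF0: "w $ E i = 0 \<and> w $ F i = 0" for i
    using exhaust_3[of i] z(3-5) F g by auto
  show "w = 0" unfolding vec_eq_iff
  proof
    fix i show "w $ i = 0 $ i" using R0 EF0 by (cases i) auto
  qed
qed

lemma exists_kernel_2_3:
  fixes a b :: "complex ^ 3"
  obtains c :: "complex ^ 3" where "c \<noteq> 0" "a $ 1 * c $ 1 + a $ 2 * c $ 2 + a $ 3 * c $ 3 = 0"
    "b $ 1 * c $ 1 + b $ 2 * c $ 2 + b $ 3 * c $ 3 = 0"
proof -
  define A :: "complex ^ 3 ^ 3" where "A = (\<chi> i. if i = 1 then a else if i = 2 then b else 0)"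
  have "row 3 A = 0" by (simp add: row_def A_def vec_eq_iff)
  then have "det A = 0" by (rule det_zero_row(1))
  then have "\<not> invertible A" by (simp add: invertible_det_nz)
  then obtain c where c: "A *v c = 0" "c \<noteq> 0"
    by (auto simp: invertible_left_inverse matrix_left_invertible_ker)
  have "(A *v c) $ 1 = 0" "(A *v c) $ 2 = 0" using c(1) by simp_all
  then show ?thesis using that[OF c(2)]
    by (simp add: matrix_vector_mult_def sum_3 A_def)
qed

text \<open>The hermitian form on the complexification of \<open>\<Lambda>\<^sub>g\<close> has signature \<open>(2,19)\<close>, and \<open>z\<close> and its
  conjugate span a positive definite plane.\<close>

lemma orthogonal_negative_definite:
  assumes g: "g > 1" and z: "z \<cdot> h_vec g = 0" "z \<cdot> z = 0" "Re (z \<cdot> conj_vec z) > 0"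
    and v: "v \<cdot> h_vec g = 0" "v \<cdot> z = 0" "v \<cdot> conj_vec z = 0" "Re (v \<cdot> conj_vec v) \<ge> 0"
  shows "v = 0"
proof -
  let ?y = "conj_vec z"
  \<comment> \<open>Two linear conditions on the coefficients of three vectors: some combination of
    \<open>v\<close>, \<open>z\<close> and the conjugate of \<open>z\<close> falls into the negative
    definite subspace of \<open>nonpos_of_isotropic_part\<close>.\<close>
  obtain c :: "complex ^ 3" where c: "c \<noteq> 0"
    "(v $ E 1 + v $ F 1) * c $ 1 + (z $ E 1 + z $ F 1) * c $ 2 + (?y $ E 1 + ?y $ F 1) * c $ 3 = 0"
    "(v $ E 2 + v $ F 2) * c $ 1 + (z $ E 2 + z $ F 2) * c $ 2 + (?y $ E 2 + ?y $ F 2) * c $ 3 = 0"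
    by (rule exists_kernel_2_3[of "vector [v $ E 1 + v $ F 1, z $ E 1 + z $ F 1, ?y $ E 1 + ?y $ F 1]"
          "vector [v $ E 2 + v $ F 2, z $ E 2 + z $ F 2, ?y $ E 2 + ?y $ F 2]"]) simp
  define w where "w = c $ 1 *s v + c $ 2 *s z + c $ 3 *s ?y"
  have y: "?y \<cdot> h_vec g = 0" "?y \<cdot> ?y = 0" "h_vec g \<cdot> z = 0" "?y \<cdot> conj_vec v = 0"
    "z \<cdot> conj_vec v = 0" "?y \<cdot> z = z \<cdot> ?y"
    using k3_form_conj[of z "h_vec g"] k3_form_conj[of z z] z v k3_form_conj[of z v] k3_form_conj[of "?y" v]
    by (simp_all add: k3_form_commute)
  have "w \<cdot> h_vec g = 0" unfolding w_def by (simp add: k3_bilinear v z y)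
  moreover have EF: "w $ E 1 + w $ F 1 = 0" "w $ E 2 + w $ F 2 = 0"
    using c(2,3) by (simp_all add: w_def algebra_simps)
  ultimately have w: "Re (w \<cdot> conj_vec w) \<le> 0" "Re (w \<cdot> conj_vec w) = 0 \<Longrightarrow> w = 0"
    using nonpos_of_isotropic_part[OF g] by blast+
  have "w \<cdot> conj_vec w = c $ 1 * cnj (c $ 1) * (v \<cdot> conj_vec v)
      + (c $ 2 * cnj (c $ 2) + c $ 3 * cnj (c $ 3)) * (z \<cdot> ?y)"
    unfolding w_def by (simp add: k3_bilinear v z y) (simp add: algebra_simps)
  then have "w \<cdot> conj_vec w = of_real ((cmod (c $ 1))\<^sup>2) * (v \<cdot> conj_vec v)
      + of_real ((cmod (c $ 2))\<^sup>2 + (cmod (c $ 3))\<^sup>2) * (z \<cdot> ?y)"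
    by (simp add: complex_norm_square del: of_real_power)
  then have eq: "Re (w \<cdot> conj_vec w) = (cmod (c $ 1))\<^sup>2 * Re (v \<cdot> conj_vec v)
      + ((cmod (c $ 2))\<^sup>2 + (cmod (c $ 3))\<^sup>2) * Re (z \<cdot> ?y)"
    by (simp only: plus_complex.sel Re_complex_of_real times_complex.sel Im_complex_of_real mult_zero_left diff_zero)
  \<comment> \<open>The expansion shows a sum of nonnegative terms, the choice of \<open>c\<close>
    makes it nonpositive; so every term vanishes, and \<open>c $ 2\<close> and \<open>c $ 3\<close>
    with it.\<close>
  have "(cmod (c $ 1))\<^sup>2 * Re (v \<cdot> conj_vec v) \<ge> 0"
    "((cmod (c $ 2))\<^sup>2 + (cmod (c $ 3))\<^sup>2) * Re (z \<cdot> ?y) \<ge> 0"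
    using v z by simp_all
  then have "((cmod (c $ 2))\<^sup>2 + (cmod (c $ 3))\<^sup>2) * Re (z \<cdot> ?y) = 0" "Re (w \<cdot> conj_vec w) = 0"
    using w(1) eq by linarith+
  then have c23: "c $ 2 = 0" "c $ 3 = 0" and "w = 0"
    using z w(2) by (auto simp: add_nonneg_eq_0_iff)
  then have "c $ 1 *s v = 0" by (simp add: w_def)
  moreover have "c $ 1 \<noteq> 0" using c(1) c23 exhaust_3 by (metis vec_eq_iff zero_index)
  ultimately show ?thesis by simp
qed

text \<open>The form is nonpositive on the component of \<open>e\<close> orthogonal to \<open>h\<close>, \<open>z\<close>, its conjugate, and \<open>v\<close>.\<close>

lemma root_product_bound:
  assumes g: "g > 1" and z: "z \<cdot> h_vec g = 0" "z \<cdot> z = 0" "Re (z \<cdot> conj_vec z) > 0"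
    and v: "conj_vec v = v" "v \<cdot> h_vec g = 0" "v \<cdot> z = 0" "v \<cdot> v = - 2"
    and e: "conj_vec e = e"
  shows "(cmod (e \<cdot> v))\<^sup>2 \<le> 2 * (- Re (e \<cdot> e) + (cmod (e \<cdot> h_vec g))\<^sup>2 / (2 * of_int g - 2)
            + 2 * (cmod (e \<cdot> z))\<^sup>2 / Re (z \<cdot> conj_vec z))"
proof -
  let ?y = "conj_vec z" and ?h = "h_vec g"
  let ?P = "z \<cdot> ?y"
  \<comment> \<open>The coefficients of \<open>z\<close> and its conjugate are interchanged because
    each is isotropic and pairs with the other. The last sign is a plus since v \<cdot> v =
    -2.\<close>
  define u where "u = e - (e \<cdot> ?h / (2 * of_int g - 2)) *s ?h - (e \<cdot> ?y / ?P) *s z - (e \<cdot> z / ?P) *s ?y + (e \<cdot> v / 2) *s v"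
  have P: "?P \<noteq> 0" using z(3) by auto
  have "(of_int (2 * g - 2) :: complex) \<noteq> 0" using g by (subst of_int_eq_0_iff) simp
  then have g0: "2 * of_int g - 2 \<noteq> (0 :: complex)" by simp
  have real: "conj_vec v = v" "cnj (e \<cdot> ?h) = e \<cdot> ?h" "cnj (e \<cdot> v) = e \<cdot> v" "cnj (e \<cdot> z) = e \<cdot> ?y" "cnj (e \<cdot> ?y) = e \<cdot> z"
    "cnj ?P = ?P" "cnj (e \<cdot> e) = e \<cdot> e"
    using k3_form_conj[of e ?h] k3_form_conj[of e v] k3_form_conj[of e z] k3_form_conj[of e ?y] e v
      k3_form_conj[of z ?y] k3_form_conj[of e e] by (simp_all add: k3_form_commute)
  have comm: "?y \<cdot> z = ?P" "?h \<cdot> z = 0" "?y \<cdot> ?h = 0" "?h \<cdot> ?y = 0" "v \<cdot> ?y = 0" "?y \<cdot> v = 0" "z \<cdot> v = 0" "?h \<cdot> v = 0"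
    "?y \<cdot> ?y = 0"
    using k3_form_conj[of z ?h] k3_form_conj[of v z] k3_form_conj[of z z] z v by (simp_all add: k3_form_commute)
  have u_real: "conj_vec u = u"
    unfolding u_def by (simp add: real e)
  have orth: "u \<cdot> ?h = 0" "u \<cdot> z = 0" "u \<cdot> ?y = 0" "u \<cdot> v = 0"
    unfolding u_def using P g0 by (simp_all add: k3_bilinear comm z v h_h)
  have "u \<cdot> u = u \<cdot> e"
    by (subst (2) u_def) (simp add: k3_bilinear orth)
  also have "\<dots> = e \<cdot> e - (e \<cdot> ?h) * (e \<cdot> ?h) / (2 * of_int g - 2) - 2 * ((e \<cdot> z) * (e \<cdot> ?y)) / ?P + (e \<cdot> v) * (e \<cdot> v) / 2"
    unfolding u_def
    by (simp add: k3_bilinear k3_form_commute[of ?h e] k3_form_commute[of z e] k3_form_commute[of ?y e]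
        k3_form_commute[of v e])
  finally have uu: "u \<cdot> u = \<dots>" .
  have sq: "(e \<cdot> ?h) * (e \<cdot> ?h) = of_real ((cmod (e \<cdot> ?h))\<^sup>2)" "(e \<cdot> v) * (e \<cdot> v) = of_real ((cmod (e \<cdot> v))\<^sup>2)"
    "(e \<cdot> z) * (e \<cdot> ?y) = of_real ((cmod (e \<cdot> z))\<^sup>2)"
    by (simp_all only: complex_norm_square real(2-4))
  have "u \<cdot> u = e \<cdot> e - of_real ((cmod (e \<cdot> ?h))\<^sup>2 / (2 * of_int g - 2))
      - of_real (2 * (cmod (e \<cdot> z))\<^sup>2 / Re ?P) + of_real ((cmod (e \<cdot> v))\<^sup>2 / 2)"
    unfolding uu sq by (simp add: of_real_form_conj)
  then have "Re (u \<cdot> u) = Re (e \<cdot> e) - (cmod (e \<cdot> ?h))\<^sup>2 / (2 * of_int g - 2)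
      - 2 * (cmod (e \<cdot> z))\<^sup>2 / Re ?P + (cmod (e \<cdot> v))\<^sup>2 / 2"
    by (simp only: minus_complex.sel plus_complex.sel Re_complex_of_real)
  moreover have "Re (u \<cdot> u) \<le> 0"
  proof (rule ccontr)
    assume *: "\<not> Re (u \<cdot> u) \<le> 0"
    then have "u = 0"
      by (intro orthogonal_negative_definite[OF g z orth(1-3)]) (simp add: u_real)
    with * show False by (simp add: k3_form_def)
  qed
  ultimately show ?thesis by argo
qed

section \<open>The lattice and its transvections\<close>

lemma half_Ints_imp_real: "2 * x \<in> \<int> \<Longrightarrow> cnj x = x" for x :: complex
proof -
  assume "2 * x \<in> \<int>"
  then obtain m where "2 * x = of_int m" by (auto elim: Ints_cases)
  then have x: "x = of_int m / 2" by (metis nonzero_mult_div_cancel_left zero_neq_numeral)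
  show ?thesis unfolding x by simp
qed

lemma E8_lattice_half: "x \<in> E8_lattice \<Longrightarrow> 2 * x $ i \<in> \<int>"
proof -
  assume "x \<in> E8_lattice"
  then consider "x $ i \<in> \<int>" | "x $ i - 1 / 2 \<in> \<int>" by (auto simp: E8_lattice_def)
  then show ?thesis
  proof cases
    case 2
    then have "2 * (x $ i - 1 / 2) + 1 \<in> \<int>" by (intro Ints_add Ints_mult) auto
    then show ?thesis by (simp add: algebra_simps)
  qed auto
qed

lemma E8_lattice_add:
  assumes "x \<in> E8_lattice" "y \<in> E8_lattice"
  shows "x + y \<in> E8_lattice"
proof -
  have "(\<Sum>i\<in>UNIV. (x + y) $ i) / 2 = (\<Sum>i\<in>UNIV. x $ i) / 2 + (\<Sum>i\<in>UNIV. y $ i) / 2"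
    by (simp add: sum.distrib add_divide_distrib)
  then have s: "(\<Sum>i\<in>UNIV. (x + y) $ i) / 2 \<in> \<int>"
    by (simp only:) (rule Ints_add, use assms in \<open>auto simp: E8_lattice_def\<close>)
  from assms consider "(\<forall>i. x $ i \<in> \<int>) \<and> (\<forall>i. y $ i \<in> \<int>)"
    | "(\<forall>i. x $ i \<in> \<int>) \<and> (\<forall>i. y $ i - 1 / 2 \<in> \<int>)"
    | "(\<forall>i. x $ i - 1 / 2 \<in> \<int>) \<and> (\<forall>i. y $ i \<in> \<int>)"
    | "(\<forall>i. x $ i - 1 / 2 \<in> \<int>) \<and> (\<forall>i. y $ i - 1 / 2 \<in> \<int>)"
    unfolding E8_lattice_def by blast
  then have "(\<forall>i. (x + y) $ i \<in> \<int>) \<or> (\<forall>i. (x + y) $ i - 1 / 2 \<in> \<int>)"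
  proof cases
    case 2
    then have "x $ i + (y $ i - 1 / 2) \<in> \<int>" for i by (intro Ints_add) auto
    then show ?thesis by (simp add: add_diff_eq)
  next
    case 3
    then have "(x $ i - 1 / 2) + y $ i \<in> \<int>" for i by (intro Ints_add) auto
    then show ?thesis by (simp add: algebra_simps)
  next
    case 4
    then have "(x $ i - 1 / 2) + (y $ i - 1 / 2) + 1 \<in> \<int>" for i by (intro Ints_add) auto
    then show ?thesis by (simp add: algebra_simps)
  qed auto
  with s show ?thesis by (simp add: E8_lattice_def)
qed

lemma E8_lattice_minus:
  assumes "x \<in> E8_lattice" shows "- x \<in> E8_lattice"
proof -
  have "(\<Sum>i\<in>UNIV. (- x) $ i) / 2 = - ((\<Sum>i\<in>UNIV. x $ i) / 2)" by (simp add: sum_negf)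
  then have s: "(\<Sum>i\<in>UNIV. (- x) $ i) / 2 \<in> \<int>" using assms by (simp only: Ints_minus E8_lattice_def mem_Collect_eq)
  moreover have "(\<forall>i. (- x) $ i \<in> \<int>) \<or> (\<forall>i. (- x) $ i - 1 / 2 \<in> \<int>)"
  proof (cases "\<forall>i. x $ i \<in> \<int>")
    case False
    then have "\<forall>i. x $ i - 1 / 2 \<in> \<int>" using assms by (auto simp: E8_lattice_def)
    then have "- (x $ i - 1 / 2) - 1 \<in> \<int>" for i by (metis Ints_1 Ints_diff Ints_minus)
    then show ?thesis by (simp add: algebra_simps)
  qed simp
  ultimately show ?thesis by (simp add: E8_lattice_def)
qed

lemma Ints_product_half: "x \<in> \<int> \<Longrightarrow> x * (x - 1) / 2 \<in> \<int>" for x :: complex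
proof -
  assume "x \<in> \<int>"
  then obtain m where m: "x = of_int m" by (auto elim: Ints_cases)
  have "even (m * (m - 1))" by simp
  then obtain k where "m * (m - 1) = 2 * k" by blast
  then have "x * (x - 1) = 2 * of_int k" unfolding m by (metis of_int_1 of_int_diff of_int_mult of_int_numeral)
  then show ?thesis by simp
qed

text \<open>For integral entries x^2 = x + x (x - 1), and the last product is even. For
  half-integral entries x^2 = (x + 1/2) (x - 1/2) + 1/4, and the eight quarters add up to 2.\<close>

lemma E8_lattice_even:
  assumes "x \<in> E8_lattice" shows "(\<Sum>i\<in>UNIV. x $ i * x $ i) / 2 \<in> \<int>"
proof (cases "\<forall>i. x $ i \<in> \<int>")
  case True
  have "(\<Sum>i\<in>UNIV. x $ i * x $ i) / 2 = (\<Sum>i\<in>UNIV. x $ i) / 2 + (\<Sum>i\<in>UNIV. x $ i * (x $ i - 1) / 2)"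
    by (simp add: sum_divide_distrib sum.distrib[symmetric] field_simps)
  also have "\<dots> \<in> \<int>"
    using assms True by (intro Ints_add Ints_sum Ints_product_half) (auto simp: E8_lattice_def)
  finally show ?thesis .
next
  case False
  then have half: "x $ i - 1 / 2 \<in> \<int>" for i using assms by (auto simp: E8_lattice_def)
  have h: "x $ i + 1 / 2 \<in> \<int>" for i using Ints_add[OF half[of i] Ints_1] by (simp add: algebra_simps)
  have "(\<Sum>i\<in>UNIV. x $ i * x $ i) / 2 = (\<Sum>i\<in>UNIV. (x $ i + 1 / 2) * (x $ i + 1 / 2 - 1) / 2 + 1 / 8)"
    by (simp add: sum_divide_distrib field_simps)
  also have "\<dots> = (\<Sum>i\<in>UNIV. (x $ i + 1 / 2) * (x $ i + 1 / 2 - 1) / 2) + 1"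
    by (simp add: sum.distrib)
  also have "\<dots> \<in> \<int>" by (rule Ints_add[OF Ints_sum[OF Ints_product_half[OF h]] Ints_1])
  finally show ?thesis .
qed

lemma K3_lattice_add: "x \<in> K3_lattice \<Longrightarrow> y \<in> K3_lattice \<Longrightarrow> x + y \<in> K3_lattice"
  using E8_lattice_add[of "\<chi> i. x $ R1 i" "\<chi> i. y $ R1 i"] E8_lattice_add[of "\<chi> i. x $ R2 i" "\<chi> i. y $ R2 i"]
  by (simp add: K3_lattice_def plus_vec_def)

lemma K3_lattice_minus: "x \<in> K3_lattice \<Longrightarrow> - x \<in> K3_lattice"
  using E8_lattice_minus[of "\<chi> i. x $ R1 i"] E8_lattice_minus[of "\<chi> i. x $ R2 i"]
  by (simp add: K3_lattice_def uminus_vec_def)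

lemma K3_lattice_diff: "x \<in> K3_lattice \<Longrightarrow> y \<in> K3_lattice \<Longrightarrow> x - y \<in> K3_lattice"
  using K3_lattice_add[of x "- y"] K3_lattice_minus[of y] by simp

lemma K3_lattice_0: "0 \<in> K3_lattice"
  by (simp add: K3_lattice_def E8_lattice_def)

lemma K3_lattice_scale: "x \<in> K3_lattice \<Longrightarrow> c \<in> \<int> \<Longrightarrow> c *s x \<in> K3_lattice"
proof -
  assume x: "x \<in> K3_lattice" and "c \<in> \<int>"
  then obtain m where m: "c = of_int m" by (auto elim: Ints_cases)
  have n: "of_nat k *s x \<in> K3_lattice" for k
  proof (induction k)
    case (Suc k)
    then show ?case using K3_lattice_add[OF x] by (simp add: vec.scale_left_distrib)
  qed (simp add: K3_lattice_0)
  show ?thesis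
  proof (cases "m \<ge> 0")
    case True
    then show ?thesis using n[of "nat m"] m by simp
  next
    case False
    then show ?thesis using K3_lattice_minus[OF n[of "nat (- m)"]] m by simp
  qed
qed

lemma K3_lattice_half: "x \<in> K3_lattice \<Longrightarrow> 2 * x $ k \<in> \<int>"
  using E8_lattice_half[of "\<chi> i. x $ R1 i"] E8_lattice_half[of "\<chi> i. x $ R2 i"]
  by (cases k) (auto simp: K3_lattice_def)

lemma K3_lattice_real: "x \<in> K3_lattice \<Longrightarrow> conj_vec x = x"
  by (simp add: vec_eq_iff half_Ints_imp_real K3_lattice_half)

lemma K3_lattice_even:
  assumes "x \<in> K3_lattice" shows "x \<cdot> x / 2 \<in> \<int>"
proof -
  have "x \<cdot> x / 2 = - ((\<Sum>i\<in>UNIV. x $ R1 i * x $ R1 i) / 2) - (\<Sum>i\<in>UNIV. x $ R2 i * x $ R2 i) / 2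
      + (\<Sum>i\<in>UNIV. x $ E i * x $ F i)"
    by (simp add: k3_form_def sum_3 field_simps)
  also have "\<dots> \<in> \<int>"
    using E8_lattice_even[of "\<chi> i. x $ R1 i"] E8_lattice_even[of "\<chi> i. x $ R2 i"] assms
    by (intro Ints_add Ints_diff Ints_minus Ints_sum Ints_mult) (auto simp: K3_lattice_def)
  finally show ?thesis .
qed

lemma K3_lattice_EF: "x \<in> K3_lattice \<Longrightarrow> x $ E i \<in> \<int>" "x \<in> K3_lattice \<Longrightarrow> x $ F i \<in> \<int>"
  by (auto simp: K3_lattice_def)

text \<open>The generator of the complement of \<open>h_vec g\<close> in the third hyperbolic plane;
  its square is 2 - 2 g.\<close>

definition kappa :: "int \<Rightarrow> k3_vec" where
  "kappa g = axis (E 3) 1 - (of_int g - 1) *s axis (F 3) 1"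

lemma E8_lattice_axis: "axis j 2 \<in> E8_lattice"
  by (auto simp: E8_lattice_def axis_def if_distrib cong: if_cong)

lemma K3_lattice_axis: "axis (E i) 1 \<in> K3_lattice" "axis (F i) 1 \<in> K3_lattice"
  "axis (R1 j) 2 \<in> K3_lattice" "axis (R2 j) 2 \<in> K3_lattice"
proof -
  have "(\<chi> i. axis (R1 j) 2 $ R1 i) = (axis j 2 :: complex ^ 8)" "(\<chi> i. axis (R2 j) 2 $ R2 i) = (axis j 2 :: complex ^ 8)"
    by (auto simp: vec_eq_iff axis_def)
  moreover have "(0 :: complex ^ 8) \<in> E8_lattice" by (simp add: E8_lattice_def)
  ultimately show "axis (R1 j) 2 \<in> K3_lattice" "axis (R2 j) 2 \<in> K3_lattice"
    using E8_lattice_axis[of j] by (simp_all add: K3_lattice_def axis_def zero_vec_def)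
  show "axis (E i) 1 \<in> K3_lattice" "axis (F i) 1 \<in> K3_lattice"
    using \<open>0 \<in> E8_lattice\<close> by (auto simp: K3_lattice_def axis_def zero_vec_def)
qed

lemma kappa_lattice: "kappa g \<in> K3_lattice"
  unfolding kappa_def by (intro K3_lattice_diff K3_lattice_scale K3_lattice_axis) auto

lemma h_lattice: "h_vec g \<in> K3_lattice"
  unfolding h_vec_def by (intro K3_lattice_add K3_lattice_scale K3_lattice_axis) auto

lemma kappa_form: "z \<cdot> kappa g = z $ F 3 - (of_int g - 1) * z $ E 3"
  by (simp add: kappa_def k3_bilinear k3_form_axis algebra_simps)

lemma Lambda_g_generators: "kappa g \<in> Lambda_g g" "axis (R1 j) 2 \<in> Lambda_g g" "axis (R2 j) 2 \<in> Lambda_g g"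
  "i \<noteq> 3 \<Longrightarrow> axis (E i) 1 \<in> Lambda_g g" "i \<noteq> 3 \<Longrightarrow> axis (F i) 1 \<in> Lambda_g g"
  by (auto simp: Lambda_g_def kappa_lattice K3_lattice_axis k3_form_h)
    (auto simp: kappa_def axis_def)

text \<open>Twice the coordinate vectors of the E8 parts, the bases of the first two hyperbolic
  planes and \<open>kappa g\<close> are lattice vectors that span the complement of
  \<open>h_vec g\<close>. This turns the span in \<open>period_cone\<close> into a linear
  equation.\<close>

lemma span_Lambda_g: "vec.span (Lambda_g g) = {z. z \<cdot> h_vec g = 0}"
proof
  show "vec.span (Lambda_g g) \<subseteq> {z. z \<cdot> h_vec g = 0}"
    by (rule vec.span_minimal) (auto simp: Lambda_g_def vec.subspace_def k3_bilinear k3_form_zero)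
  show "{z. z \<cdot> h_vec g = 0} \<subseteq> vec.span (Lambda_g g)"
  proof
    fix z assume "z \<in> {z. z \<cdot> h_vec g = 0}"
    then have F3: "z $ F 3 = - (of_int g - 1) * z $ E 3" by (simp add: k3_form_h algebra_simps add_eq_0_iff)
    have "z = (\<Sum>i\<in>UNIV. (z $ R1 i / 2) *s axis (R1 i) 2) + (\<Sum>i\<in>UNIV. (z $ R2 i / 2) *s axis (R2 i) 2)
        + z $ E 1 *s axis (E 1) 1 + z $ F 1 *s axis (F 1) 1 + z $ E 2 *s axis (E 2) 1 + z $ F 2 *s axis (F 2) 1
        + z $ E 3 *s kappa g" (is "_ = ?s")
      unfolding vec_eq_iff
    proof
      fix k show "z $ k = ?s $ k"
      proof (cases k)
        case (E i)
        then show ?thesis using exhaust_3[of i] by (auto simp: kappa_def axis_def)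
      next
        case (F i)
        then show ?thesis using exhaust_3[of i] F3 by (auto simp: kappa_def axis_def algebra_simps)
      qed (auto simp: kappa_def axis_def if_distrib cong: if_cong)
    qed
    moreover have "?s \<in> vec.span (Lambda_g g)"
      by (intro vec.span_add vec.span_scale vec.span_sum vec.span_base Lambda_g_generators) auto
    ultimately show "z \<in> vec.span (Lambda_g g)" by simp
  qed
qed

lemma period_cone_iff:
  "z \<in> period_cone g \<longleftrightarrow> z \<cdot> h_vec g = 0 \<and> z \<cdot> z = 0 \<and> Re (z \<cdot> conj_vec z) > 0"
  by (simp add: period_cone_def span_Lambda_g)

section \<open>Eichler transvections and their action on the period domain\<close>

definition eichler :: "k3_vec \<Rightarrow> k3_vec \<Rightarrow> k3_vec \<Rightarrow> k3_vec" where
  "eichler e w x = x + (x \<cdot> e) *s w - (x \<cdot> w) *s e - (w \<cdot> w / 2 * (x \<cdot> e)) *s e"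

lemma eichler_isometry:
  assumes "e \<cdot> e = 0" "e \<cdot> w = 0"
  shows "eichler e w x \<cdot> eichler e w y = x \<cdot> y"
  using assms k3_form_commute[of w e]
  by (simp add: eichler_def k3_bilinear k3_form_commute[of e x] k3_form_commute[of e y]
      k3_form_commute[of w x] k3_form_commute[of w y]) (simp add: field_simps)

lemma eichler_linear: "Vector_Spaces.linear (*s) (*s) (eichler e w)"
  by unfold_locales (auto simp: eichler_def k3_bilinear vec_eq_iff algebra_simps)

lemma eichler_inverse:
  assumes "e \<cdot> e = 0" "e \<cdot> w = 0"
  shows "eichler e w (eichler e (- w) x) = x"
  using assms k3_form_commute[of w e]
  by (simp add: eichler_def k3_bilinear) (simp add: vec_eq_iff field_simps)

lemma eichler_conj:
  assumes "conj_vec e = e" "conj_vec w = w"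
  shows "conj_vec (eichler e w z) = eichler e w (conj_vec z)"
  using k3_form_conj[of z e] k3_form_conj[of z w] k3_form_conj[of w w]
  by (simp add: eichler_def assms)

lemma continuous_on_k3_form [continuous_intros]:
  assumes "continuous_on A f" "continuous_on A g"
  shows "continuous_on A (\<lambda>x. f x \<cdot> g x)"
  unfolding k3_form_def by (intro continuous_intros assms)

lemma continuous_on_conj_vec [continuous_intros]:
  "continuous_on A f \<Longrightarrow> continuous_on A (\<lambda>x. conj_vec (f x))"
  unfolding conj_vec_def by (intro continuous_intros)

lemma continuous_on_scale_vec [continuous_intros]:
  fixes f :: "'a::topological_space \<Rightarrow> complex" and g :: "'a \<Rightarrow> complex ^ 'n"
  shows "continuous_on A f \<Longrightarrow> continuous_on A g \<Longrightarrow> continuous_on A (\<lambda>x. f x *s g x)"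
  unfolding vector_scalar_mult_def by (intro continuous_intros)

lemma component_meets:
  assumes "C \<in> components (period_cone g)" "connected T" "T \<subseteq> period_cone g" "z \<in> C" "z \<in> T"
  shows "T \<subseteq> C"
  using components_maximal[OF assms(1-3)] assms(4,5) by blast

lemma component_scale:
  assumes C: "C \<in> components (period_cone g)" and z: "z \<in> C" and c: "c \<noteq> 0"
  shows "c *s z \<in> C"
proof -
  let ?T = "(\<lambda>c. c *s z) ` (- {0})"
  have zp: "z \<in> period_cone g" using C z in_components_subset by blast
  have "connected ?T"
    by (intro connected_continuous_image continuous_intros connected_punctured_universe) simp
  moreover have "?T \<subseteq> period_cone g"
  proof
    fix y assume "y \<in> ?T"
    then obtain a where a: "a \<noteq> 0" "y = a *s z" by auto
    have "y \<cdot> conj_vec y = of_real ((cmod a)\<^sup>2) * (z \<cdot> conj_vec z)"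
      by (simp add: a k3_bilinear complex_norm_square del: of_real_power)
    then have "Re (y \<cdot> conj_vec y) = (cmod a)\<^sup>2 * Re (z \<cdot> conj_vec z)"
      by (simp only: times_complex.sel Re_complex_of_real Im_complex_of_real mult_zero_left diff_zero)
    then show "y \<in> period_cone g" using zp a by (simp add: period_cone_iff k3_bilinear)
  qed
  moreover have "z \<in> ?T" by (rule image_eqI[of _ _ 1]) auto
  ultimately have "?T \<subseteq> C" using component_meets[OF C] z by blast
  then show ?thesis using c by blast
qed

text \<open>The transvections with l w in place of w, for l from 0 to 1, join z to its image by a
  path inside the period cone.\<close>

lemma component_eichler:
  assumes C: "C \<in> components (period_cone g)" and z: "z \<in> C"
    and ew: "e \<in> Lambda_g g" "w \<in> Lambda_g g" "e \<cdot> e = 0" "e \<cdot> w = 0"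
  shows "eichler e w z \<in> C"
proof -
  let ?f = "\<lambda>l::real. eichler e (of_real l *s w) z"
  have zp: "z \<in> period_cone g" using C z in_components_subset by blast
  have real: "conj_vec e = e" "conj_vec w = w" and h: "e \<cdot> h_vec g = 0" "w \<cdot> h_vec g = 0"
    using ew by (auto simp: Lambda_g_def K3_lattice_real)
  have "connected (?f ` {0..1})"
    unfolding eichler_def by (intro connected_continuous_image continuous_intros) auto
  moreover have "?f ` {0..1} \<subseteq> period_cone g"
  proof
    fix y assume "y \<in> ?f ` {0..1}"
    then obtain l where l: "y = ?f l" by blast
    have "conj_vec y = eichler e (of_real l *s w) (conj_vec z)"
      unfolding l by (rule eichler_conj) (simp_all add: real)
    then have "y \<cdot> conj_vec y = z \<cdot> conj_vec z" "y \<cdot> y = z \<cdot> z"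
      unfolding l by (simp_all add: eichler_isometry ew k3_bilinear)
    moreover have "y \<cdot> h_vec g = 0" using zp h by (simp add: l eichler_def k3_bilinear period_cone_iff)
    ultimately show "y \<in> period_cone g" using zp by (simp add: period_cone_iff)
  qed
  moreover have "?f 0 = z" by (simp add: eichler_def k3_bilinear k3_form_zero)
  then have "z \<in> ?f ` {0..1}" by (intro image_eqI[of _ _ 0]) auto
  ultimately have "?f ` {0..1} \<subseteq> C" using component_meets[OF C] z by blast
  then have "?f 1 \<in> C" by (metis atLeastAtMost_iff image_subset_iff order_refl zero_le_one)
  then show ?thesis by simp
qed

text \<open>The factor w \<cdot> w / 2 is an integer because the K3 lattice is even, so the lattice
  is mapped into itself. Surjectivity on the lattice and on C comes from the inverse
  \<open>eichler e (- w)\<close>.\<close>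

lemma eichler_Gamma:
  assumes C: "C \<in> components (period_cone g)"
    and ew: "e \<in> Lambda_g g" "w \<in> Lambda_g g" "e \<cdot> e = 0" "e \<cdot> w = 0"
    and int: "\<And>x. x \<in> K3_lattice \<Longrightarrow> x \<cdot> e \<in> \<int>" "\<And>x. x \<in> K3_lattice \<Longrightarrow> x \<cdot> w \<in> \<int>"
  shows "eichler e w \<in> Gamma_g g C"
proof -
  have L: "e \<in> K3_lattice" "w \<in> K3_lattice" and h: "e \<cdot> h_vec g = 0" "w \<cdot> h_vec g = 0"
    using ew by (auto simp: Lambda_g_def)
  have w': "- w \<in> Lambda_g g" "e \<cdot> (- w) = 0" using ew by (auto simp: Lambda_g_def K3_lattice_minus k3_bilinear)
  have lat: "eichler e v x \<in> K3_lattice" if "x \<in> K3_lattice" "v = w \<or> v = - w" for v x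
  proof -
    have "v \<in> K3_lattice" "x \<cdot> v \<in> \<int>" "v \<cdot> v / 2 \<in> \<int>"
      using that int K3_lattice_minus L K3_lattice_even by (auto simp: k3_bilinear)
    then show ?thesis unfolding eichler_def using that(1) L int
      by (intro K3_lattice_diff K3_lattice_add K3_lattice_scale Ints_mult) auto
  qed
  have image: "eichler e w ` S = S"
    if "\<And>x. x \<in> S \<Longrightarrow> eichler e w x \<in> S" "\<And>x. x \<in> S \<Longrightarrow> eichler e (- w) x \<in> S" for S
  proof
    show "eichler e w ` S \<subseteq> S" using that by blast
    show "S \<subseteq> eichler e w ` S" using that(2) eichler_inverse[OF ew(3,4)] by (metis image_eqI subsetI)
  qed
  have "eichler e w ` K3_lattice = K3_lattice" by (rule image) (use lat in auto)
  moreover have "eichler e w ` C = C"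
    by (rule image) (use component_eichler[OF C] ew w' in auto)
  moreover have "eichler e w (h_vec g) = h_vec g"
    using h by (simp add: eichler_def k3_form_commute[of "h_vec g"])
  ultimately show ?thesis
    unfolding Gamma_g_def O_K3_def using eichler_linear eichler_isometry[OF ew(3,4)] by blast
qed

lemma orbit_class_eichler:
  assumes C: "C \<in> components (period_cone g)"
    and ew: "e \<in> Lambda_g g" "w \<in> Lambda_g g" "e \<cdot> e = 0" "e \<cdot> w = 0"
    and int: "\<And>x. x \<in> K3_lattice \<Longrightarrow> x \<cdot> e \<in> \<int>" "\<And>x. x \<in> K3_lattice \<Longrightarrow> x \<cdot> w \<in> \<int>"
  shows "orbit_class g C (eichler e w z) = orbit_class g C z"
proof -
  have comp: "\<gamma> \<circ> \<delta> \<in> Gamma_g g C" if "\<gamma> \<in> Gamma_g g C" "\<delta> \<in> Gamma_g g C" for \<gamma> \<delta>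
  proof -
    have "(\<gamma> \<circ> \<delta>) ` S = \<gamma> ` \<delta> ` S" for S by (rule image_comp[symmetric])
    moreover have "Vector_Spaces.linear (*s) (*s) (\<gamma> \<circ> \<delta>)"
      by (rule Vector_Spaces.linear_compose) (use that in \<open>auto simp: Gamma_g_def O_K3_def\<close>)
    ultimately show ?thesis
      using that unfolding Gamma_g_def O_K3_def
      by (simp only: mem_Collect_eq o_apply simp_thms)
  qed
  have G1: "eichler e w \<in> Gamma_g g C" by (rule eichler_Gamma[OF C ew int])
  have G2: "eichler e (- w) \<in> Gamma_g g C"
    by (rule eichler_Gamma[OF C]) (use ew int in \<open>auto simp: Lambda_g_def K3_lattice_minus k3_bilinear\<close>)
  have inverse: "eichler e (- w) (eichler e w z) = z"
    using eichler_inverse[of e "- w" z] ew by (simp add: k3_bilinear)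
  have "orbit_class g C (\<delta> x) \<subseteq> orbit_class g C x" if "\<delta> \<in> Gamma_g g C" for \<delta> x
    unfolding orbit_class_def using comp[OF _ that] by (auto, metis comp_apply)
  from this[OF G1, of z] this[OF G2, of "eichler e w z"] show ?thesis by (simp add: inverse)
qed

section \<open>Coordinates near a one-dimensional boundary component\<close>

text \<open>The points of the period domain normalized by \<open>z \<cdot> e\<^sub>1 = 1\<close>; only the entries \<open>R1\<close>, \<open>R2\<close> of \<open>r\<close> are
  used, and the entry \<open>E 1\<close> is determined by \<open>z \<cdot> z = 0\<close>.\<close>

definition pt :: "int \<Rightarrow> k3_vec \<Rightarrow> complex \<Rightarrow> complex \<Rightarrow> complex \<Rightarrow> k3_vec" where
  "pt g r s u \<tau> = (\<chi> k. case k of R1 i \<Rightarrow> r $ R1 i | R2 i \<Rightarrow> r $ R2 i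
     | E i \<Rightarrow> if i = 1 then ((\<Sum>j\<in>UNIV. (r $ R1 j)\<^sup>2) + (\<Sum>j\<in>UNIV. (r $ R2 j)\<^sup>2)) / 2 + (of_int g - 1) * s\<^sup>2 - \<tau> * u
             else if i = 2 then u else s
     | F i \<Rightarrow> if i = 1 then 1 else if i = 2 then \<tau> else - (of_int g - 1) * s)"

lemma pt_simps [simp]:
  "pt g r s u \<tau> $ R1 i = r $ R1 i" "pt g r s u \<tau> $ R2 i = r $ R2 i"
  "pt g r s u \<tau> $ E 1 = ((\<Sum>j\<in>UNIV. (r $ R1 j)\<^sup>2) + (\<Sum>j\<in>UNIV. (r $ R2 j)\<^sup>2)) / 2 + (of_int g - 1) * s\<^sup>2 - \<tau> * u"
  "pt g r s u \<tau> $ E 2 = u" "pt g r s u \<tau> $ E 3 = s"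
  "pt g r s u \<tau> $ F 1 = 1" "pt g r s u \<tau> $ F 2 = \<tau>" "pt g r s u \<tau> $ F 3 = - (of_int g - 1) * s"
  by (simp_all add: pt_def)

definition im_norm :: "k3_vec \<Rightarrow> real" where
  "im_norm r = (\<Sum>j\<in>UNIV. (Im (r $ R1 j))\<^sup>2) + (\<Sum>j\<in>UNIV. (Im (r $ R2 j))\<^sup>2)"

lemma pt_h: "pt g r s u \<tau> \<cdot> h_vec g = 0"
  by (simp add: k3_form_h algebra_simps)

lemma pt_isotropic: "pt g r s u \<tau> \<cdot> pt g r s u \<tau> = 0"
  by (simp add: k3_form_def sum_3) (simp add: power2_eq_square algebra_simps)

lemma sum_Re_square: "Re (\<Sum>j\<in>A. (f j)\<^sup>2) = (\<Sum>j\<in>A. (cmod (f j))\<^sup>2) - 2 * (\<Sum>j\<in>A. (Im (f j))\<^sup>2)"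
proof -
  have "Re ((f j)\<^sup>2) = (cmod (f j))\<^sup>2 - 2 * (Im (f j))\<^sup>2" for j by (simp add: cmod_power2 Re_power2)
  then show ?thesis by (simp add: sum_subtractf sum_distrib_left)
qed

lemma pt_norm: "Re (pt g r s u \<tau> \<cdot> conj_vec (pt g r s u \<tau>))
    = 4 * Im \<tau> * Im u - 2 * im_norm r - 4 * (of_int g - 1) * (Im s)\<^sup>2"
proof -
  have "Re (pt g r s u \<tau> $ E 1) = ((\<Sum>j\<in>UNIV. (cmod (r $ R1 j))\<^sup>2) + (\<Sum>j\<in>UNIV. (cmod (r $ R2 j))\<^sup>2)) / 2 - im_norm r
      + (of_int g - 1) * ((Re s)\<^sup>2 - (Im s)\<^sup>2) - (Re \<tau> * Re u - Im \<tau> * Im u)"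
    unfolding pt_simps im_norm_def plus_complex.sel minus_complex.sel Re_divide_numeral sum_Re_square
    by (simp add: Re_power2 field_simps)
  then show ?thesis
    unfolding Re_form_conj sum_3 by (simp add: power2_eq_square algebra_simps)
qed

lemma pt_eqI:
  assumes "z \<cdot> h_vec g = 0" "z \<cdot> z = 0" "z $ F 1 = 1"
    and "\<And>i. z $ R1 i = r $ R1 i" "\<And>i. z $ R2 i = r $ R2 i"
    and "z $ E 3 = s" "z $ E 2 = u" "z $ F 2 = \<tau>"
  shows "z = pt g r s u \<tau>"
proof -
  have F3: "z $ F 3 = - ((of_int g - 1) * s)" using assms(1,6) by (simp add: k3_form_h add_eq_0_iff)
  have "2 * (z $ E 1 - pt g r s u \<tau> $ E 1) = 0"
    using assms(2) by (simp add: k3_form_def sum_3 assms F3) (simp add: power2_eq_square algebra_simps)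
  then have E1: "z $ E 1 = pt g r s u \<tau> $ E 1" by (metis eq_iff_diff_eq_0 mult_eq_0_iff zero_neq_numeral)
  show ?thesis unfolding vec_eq_iff
  proof
    fix k show "z $ k = pt g r s u \<tau> $ k"
    proof (cases k)
      case (E i)
      then show ?thesis using exhaust_3[of i] E1 assms by auto
    next
      case (F i)
      then show ?thesis using exhaust_3[of i] F3 assms by (auto simp: algebra_simps)
    qed (use assms in auto)
  qed
qed

lemma continuous_on_pt [continuous_intros]:
  assumes "continuous_on A r" "continuous_on A s" "continuous_on A u" "continuous_on A \<tau>"
  shows "continuous_on A (\<lambda>x. pt g (r x) (s x) (u x) (\<tau> x))"
  unfolding pt_def
proof (intro continuous_on_vec_lambda)
  fix k show "continuous_on A (\<lambda>x. case k of R1 i \<Rightarrow> r x $ R1 i | R2 i \<Rightarrow> r x $ R2 i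
     | E i \<Rightarrow> if i = 1 then ((\<Sum>j\<in>UNIV. (r x $ R1 j)\<^sup>2) + (\<Sum>j\<in>UNIV. (r x $ R2 j)\<^sup>2)) / 2 + (of_int g - 1) * (s x)\<^sup>2 - \<tau> x * u x
             else if i = 2 then u x else s x
     | F i \<Rightarrow> if i = 1 then 1 else if i = 2 then \<tau> x else - (of_int g - 1) * s x)"
  proof (cases k)
    case (E i)
    then show ?thesis by (cases "i = 1"; cases "i = 2") (auto intro!: continuous_intros assms)
  next
    case (F i)
    then show ?thesis by (cases "i = 1"; cases "i = 2") (auto intro!: continuous_intros assms)
  qed (auto intro!: continuous_intros assms)
qed

text \<open>By \<open>pt_norm\<close> the second condition says that z \<cdot>
  \<open>conj_vec z\<close> is positive. It forces Im \<tau> and Im u to have the same sign, and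
  this sign \<sigma> tells the two components apart.\<close>

definition pt_domain :: "int \<Rightarrow> real \<Rightarrow> (k3_vec \<times> complex \<times> complex \<times> complex) set" where
  "pt_domain g \<sigma> = {(r, s, u, \<tau>). \<sigma> * Im \<tau> > 0 \<and> 2 * Im \<tau> * Im u > im_norm r + 2 * (of_int g - 1) * (Im s)\<^sup>2}"

lemma im_norm_nonneg: "im_norm r \<ge> 0"
  by (simp add: im_norm_def sum_nonneg)

lemma im_norm_scale: "im_norm (of_real l *s r) = l\<^sup>2 * im_norm r"
  by (simp add: im_norm_def power_mult_distrib sum_distrib_left distrib_left)

text \<open>The domain is starlike about the point with r = s = 0 and u = \<tau> = \<sigma> i: along
  a segment from there, the product of the imaginary parts of \<tau> and u acquires only nonnegative
  mixed terms.\<close>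

lemma pt_domain_connected:
  assumes g: "g > 1" and \<sigma>: "\<sigma>\<^sup>2 = 1"
  shows "connected (pt_domain g \<sigma>)"
proof (rule starlike_imp_connected)
  let ?o = "(0, 0, of_real \<sigma> * \<i>, of_real \<sigma> * \<i>) :: k3_vec \<times> complex \<times> complex \<times> complex"
  show "starlike (pt_domain g \<sigma>)"
    unfolding starlike_def
  proof (intro bexI ballI subsetI)
    have s1: "\<sigma> * \<sigma> = 1" using \<sigma> by (simp add: power2_eq_square)
    show "?o \<in> pt_domain g \<sigma>" using s1 by (simp add: pt_domain_def im_norm_def)
    fix p q assume p: "p \<in> pt_domain g \<sigma>" and q: "q \<in> closed_segment ?o p"
    obtain r s u \<tau> where [simp]: "p = (r, s, u, \<tau>)" by (cases p) auto
    from q obtain l where l: "0 \<le> l" "l \<le> 1" "q = (1 - l) *\<^sub>R ?o + l *\<^sub>R p" by (auto simp: in_segment)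
    let ?t = "Im \<tau>" and ?u = "Im u" and ?N = "im_norm r + 2 * (of_int g - 1) * (Im s)\<^sup>2"
    have N: "?N \<ge> 0" using g im_norm_nonneg by simp
    have t: "\<sigma> * ?t > 0" and tu: "2 * ?t * ?u > ?N" using p by (auto simp: pt_domain_def)
    have "(\<sigma> * ?t) * (\<sigma> * ?u) = ?t * ?u" using s1 by (simp add: algebra_simps)
    then have "(\<sigma> * ?t) * (\<sigma> * ?u) > 0" using tu N by linarith
    then have u: "\<sigma> * ?u > 0" using t by (simp add: zero_less_mult_iff)
    have q': "q = (of_real l *s r, of_real l * s, of_real ((1 - l) * \<sigma>) * \<i> + of_real l * u,
        of_real ((1 - l) * \<sigma>) * \<i> + of_real l * \<tau>)"
    proof -
      have "l *\<^sub>R r = of_real l *s r" by (simp add: vec_eq_iff) (simp add: scaleR_conv_of_real)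
      then show ?thesis unfolding l(3) by simp (simp add: scaleR_conv_of_real)
    qed
    have "\<sigma> * ((1 - l) * \<sigma> + l * ?t) = (1 - l) + l * (\<sigma> * ?t)"
      using s1 by (simp add: algebra_simps)
    moreover have pos: "(1 - l) + l * (\<sigma> * ?t) > 0"
    proof (cases "l = 1")
      case False
      then show ?thesis using l t by (intro add_pos_nonneg) auto
    qed (use t in simp)
    ultimately have c1: "\<sigma> * ((1 - l) * \<sigma> + l * ?t) > 0" by simp
    have "((1 - l) * \<sigma> + l * ?t) * ((1 - l) * \<sigma> + l * ?u)
        = (1 - l)\<^sup>2 * (\<sigma> * \<sigma>) + (1 - l) * l * (\<sigma> * ?t + \<sigma> * ?u) + l\<^sup>2 * (?t * ?u)"
      by (simp add: power2_eq_square algebra_simps)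
    then have e: "2 * ((1 - l) * \<sigma> + l * ?t) * ((1 - l) * \<sigma> + l * ?u)
        = 2 * (1 - l)\<^sup>2 + 2 * (1 - l) * l * (\<sigma> * ?t + \<sigma> * ?u) + l\<^sup>2 * (2 * ?t * ?u)"
      unfolding s1 by (simp add: algebra_simps)
    have k: "2 * (1 - l) * l * (\<sigma> * ?t + \<sigma> * ?u) \<ge> 0" using l t u by simp
    have "2 * (1 - l)\<^sup>2 + l\<^sup>2 * (2 * ?t * ?u) > l\<^sup>2 * ?N"
    proof (cases "l = 1")
      case False
      have "l\<^sup>2 * (2 * ?t * ?u) \<ge> l\<^sup>2 * ?N" using tu by (intro mult_left_mono) auto
      moreover have "(1 - l)\<^sup>2 > 0" using False by simp
      ultimately show ?thesis by linarith
    qed (use tu in simp)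
    then have c2: "2 * ((1 - l) * \<sigma> + l * ?t) * ((1 - l) * \<sigma> + l * ?u) > l\<^sup>2 * ?N"
      unfolding e using k by linarith
    show "q \<in> pt_domain g \<sigma>"
      unfolding q' pt_domain_def using c1 c2 by (simp add: im_norm_scale power_mult_distrib algebra_simps)
  qed
qed

text \<open>Some point of C, scaled to have product 1 with the first isotropic basis vector, lies in
  the connected image of one of the two coordinate domains, so C contains this whole image.\<close>

lemma component_contains_pt:
  assumes g: "g > 1" and C: "C \<in> components (period_cone g)"
  obtains \<sigma> :: int where "\<sigma> = 1 \<or> \<sigma> = - 1"
    "\<And>r s u \<tau>. (r, s, u, \<tau>) \<in> pt_domain g (of_int \<sigma>) \<Longrightarrow> pt g r s u \<tau> \<in> C"
proof -
  obtain z where z: "z \<in> C" using C in_components_nonempty by blast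
  then have zp: "z \<cdot> h_vec g = 0" "z \<cdot> z = 0" "Re (z \<cdot> conj_vec z) > 0"
    using C in_components_subset period_cone_iff by blast+
  \<comment> \<open>Otherwise the isotropic vector \<open>axis (E 1) 1\<close> would be orthogonal
    to \<open>z\<close> and its conjugate, where the form is negative definite.\<close>
  have "z $ F 1 \<noteq> 0"
  proof
    assume F1: "z $ F 1 = 0"
    have "axis (E 1) 1 = (0 :: k3_vec)"
      by (rule orthogonal_negative_definite[OF g zp]) (simp_all add: k3_form_axis F1, simp_all add: h_vec_def axis_def)
    then show False by (simp add: axis_eq_0_iff)
  qed
  define y where "y = (1 / z $ F 1) *s z"
  have yC: "y \<in> C" unfolding y_def by (rule component_scale[OF C z]) (use \<open>z $ F 1 \<noteq> 0\<close> in simp)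
  then have yp: "y \<cdot> h_vec g = 0" "y \<cdot> y = 0" "Re (y \<cdot> conj_vec y) > 0"
    using C in_components_subset period_cone_iff by blast+
  have "y $ F 1 = 1" using \<open>z $ F 1 \<noteq> 0\<close> by (simp add: y_def)
  then have y: "y = pt g y (y $ E 3) (y $ E 2) (y $ F 2)" by (intro pt_eqI yp) auto
  let ?\<tau> = "y $ F 2" and ?u = "y $ E 2" and ?s = "y $ E 3"
  have pos: "4 * Im ?\<tau> * Im ?u - 2 * im_norm y - 4 * (of_int g - 1) * (Im ?s)\<^sup>2 > 0"
    using yp(3) by (subst (asm) y, subst (asm) (2) y) (simp add: pt_norm)
  define \<sigma> :: int where "\<sigma> = (if Im ?\<tau> > 0 then 1 else - 1)"
  have "(of_int g - 1) * (Im ?s)\<^sup>2 \<ge> 0" "im_norm y \<ge> 0" using g im_norm_nonneg by auto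
  then have "Im ?\<tau> * Im ?u > 0" using pos by (simp add: algebra_simps)
  then have "Im ?\<tau> \<noteq> 0" by auto
  then have "(y, ?s, ?u, ?\<tau>) \<in> pt_domain g (of_int \<sigma>)"
    using pos by (auto simp: pt_domain_def \<sigma>_def algebra_simps)
  let ?T = "(\<lambda>(r, s, u, \<tau>). pt g r s u \<tau>) ` pt_domain g (of_int \<sigma>)"
  have "connected ?T"
    unfolding case_prod_unfold
    by (intro connected_continuous_image pt_domain_connected g continuous_intros) (simp add: \<sigma>_def)
  moreover have "?T \<subseteq> period_cone g"
    by (auto simp: period_cone_iff pt_h pt_isotropic pt_norm pt_domain_def algebra_simps)
  moreover have "y \<in> ?T" using \<open>(y, ?s, ?u, ?\<tau>) \<in> pt_domain g (of_int \<sigma>)\<close>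
    by (intro image_eqI[of _ _ "(y, ?s, ?u, ?\<tau>)"]) (use y in auto)
  ultimately have "?T \<subseteq> C" by (rule component_meets[OF C _ _ yC])
  then show ?thesis by (intro that[of \<sigma>]) (auto simp: \<sigma>_def)
qed

lemma Lambda_gD: "v \<in> Lambda_g g \<Longrightarrow> v \<in> K3_lattice" "v \<in> Lambda_g g \<Longrightarrow> v \<cdot> h_vec g = 0"
  by (simp_all add: Lambda_g_def)

lemma int_dvd_of_square_mult: "k \<noteq> 0 \<Longrightarrow> k\<^sup>2 * y = m\<^sup>2 \<Longrightarrow> k dvd m" for k y m :: int
  by (metis dvd_triv_left pow_divides_pow_iff zero_less_numeral)

text \<open>Since \<open>v\<close> has no entry at \<open>E 3\<close>, that entry of
  \<open>x\<close> is the coefficient of \<open>h_vec g\<close>. The rest \<open>y\<close> satisfies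
  k y = m v; comparing squares, evenness of y \<cdot> y shows that k^2 divides m^2, so k divides
  m.\<close>

lemma root_in_N_g:
  assumes v: "v \<in> Lambda_g g" "v \<cdot> v = - 2" "v $ E 3 = 0"
  shows "v \<in> N_g g"
proof -
  have "\<exists>a b :: int. x = of_int a *s v + of_int b *s h_vec g"
    if x: "x \<in> K3_lattice" and k: "k \<noteq> 0" and eq: "of_int k *s x = of_int m *s v + of_int n *s h_vec g"
    for x and k m n :: int
  proof -
    from x K3_lattice_EF obtain j where j: "x $ E 3 = of_int j" by (metis Ints_cases)
    have "(of_int k *s x) $ E 3 = of_int n"
      unfolding eq by (simp add: v(3)) (simp add: h_vec_def axis_def)
    then have "(of_int (k * j) :: complex) = of_int n" by (simp add: j)
    then have n: "n = k * j" by (metis of_int_eq_iff)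
    define y where "y = x - of_int j *s h_vec g"
    have y: "y \<in> K3_lattice"
      unfolding y_def by (intro K3_lattice_diff K3_lattice_scale x h_lattice Ints_of_int)
    have ky: "of_int k *s y = of_int m *s v"
      using eq by (simp add: y_def n vec_eq_iff algebra_simps)
    obtain Y where Y: "y \<cdot> y / 2 = of_int Y" using K3_lattice_even[OF y] by (metis Ints_cases)
    have "of_int k * of_int k * (y \<cdot> y) = (of_int k *s y) \<cdot> (of_int k *s y)" by (simp add: k3_bilinear)
    also have "\<dots> = of_int m * of_int m * (- 2)" unfolding ky by (simp add: k3_bilinear v)
    finally have "of_int k * of_int k * (y \<cdot> y / 2) = - (of_int m * of_int m)" by simp
    then have "(of_int (k\<^sup>2 * (- Y)) :: complex) = of_int (m\<^sup>2)"
      unfolding Y by (simp add: power2_eq_square)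
    then have "k\<^sup>2 * (- Y) = m\<^sup>2" by (metis of_int_eq_iff)
    then have "k dvd m" by (rule int_dvd_of_square_mult[OF k])
    then obtain a where a: "m = k * a" by blast
    have "of_int k *s y = of_int k *s (of_int a *s v)" unfolding ky a by simp
    then have "y = of_int a *s v" using k by (simp only: vec.scale_left_imp_eq[of "of_int k"] vec.scale_cancel_left) simp
    then have "x = of_int a *s v + of_int j *s h_vec g" by (simp add: y_def diff_eq_eq)
    then show ?thesis by blast
  qed
  then show ?thesis using v unfolding N_g_def Let_def by blast
qed

section \<open>Slices of fixed \<tau> and the roots near them\<close>

abbreviation rho :: k3_vec where "rho \<equiv> axis (R1 0) 2"

text \<open>The factor \<sigma> in u and \<tau> gives both components the same inequality for Im u.
  The coordinate x belongs to \<open>rho\<close>, the smallest positive multiple of its coordinate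
  vector that lies in the E8 lattice.\<close>

definition slice :: "int \<Rightarrow> int \<Rightarrow> k3_vec \<Rightarrow> complex \<Rightarrow> complex \<Rightarrow> complex \<Rightarrow> k3_vec" where
  "slice g \<sigma> p x s u = pt g (p + x *s rho) s (of_int \<sigma> * u) (of_int \<sigma> * \<i>)"

locale slice_data =
  fixes g \<sigma> :: int and p :: k3_vec
  assumes g: "g > 2" and \<sigma>: "\<sigma> = 1 \<or> \<sigma> = - 1" and p_real: "conj_vec p = p"
begin

definition a0 :: k3_vec where "a0 = axis (E 1) 1"
text \<open>The sign \<open>\<sigma>\<close> selects the component of the period domain.\<close>

definition b0 :: k3_vec where "b0 = of_int \<sigma> *s axis (E 2) 1"

lemma sigma_square: "of_int \<sigma> * of_int \<sigma> = (1 :: complex)" "of_int \<sigma> * (of_int \<sigma> * y) = (y :: complex)"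
  using \<sigma> by auto

lemma a0_form: "z \<cdot> a0 = z $ F 1" and b0_form: "z \<cdot> b0 = of_int \<sigma> * z $ F 2"
  and rho_form: "z \<cdot> rho = - (2 * z $ R1 0)"
  by (simp_all add: a0_def b0_def k3_bilinear k3_form_axis)

lemma generators: "a0 \<in> Lambda_g g" "b0 \<in> Lambda_g g" "kappa g \<in> Lambda_g g" "rho \<in> Lambda_g g"
  using Lambda_g_generators(2-4) Lambda_g_generators(1) \<sigma>
  by (auto simp: a0_def b0_def Lambda_g_def K3_lattice_minus k3_bilinear)

lemma products: "a0 \<cdot> a0 = 0" "b0 \<cdot> b0 = 0" "a0 \<cdot> b0 = 0" "a0 \<cdot> kappa g = 0" "b0 \<cdot> kappa g = 0"
  "a0 \<cdot> rho = 0" "b0 \<cdot> rho = 0" "kappa g \<cdot> kappa g = - (2 * (of_int g - 1))" "rho \<cdot> rho = - 4"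
  by (simp_all add: a0_form b0_form kappa_form rho_form)
    (simp_all add: a0_def b0_def kappa_def axis_def)

lemma integral_forms: "x \<in> K3_lattice \<Longrightarrow> x \<cdot> a0 \<in> \<int>" "x \<in> K3_lattice \<Longrightarrow> x \<cdot> b0 \<in> \<int>"
  "x \<in> K3_lattice \<Longrightarrow> x \<cdot> kappa g \<in> \<int>" "x \<in> K3_lattice \<Longrightarrow> x \<cdot> rho \<in> \<int>"
  using K3_lattice_half[of x "R1 0"]
  by (auto simp: a0_form b0_form kappa_form rho_form intro!: Ints_mult Ints_diff Ints_minus K3_lattice_EF)

text \<open>All five are verified by comparing the free coordinates with \<open>pt_eqI\<close>. The
  first three are the Heisenberg translations of \<open>jacobi_family\<close> for n = g - 1, the
  last two its periods in x.\<close>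

lemma eichler_slice:
  "eichler a0 b0 (slice g \<sigma> p x s u) = slice g \<sigma> p x s (u + 1)"
  "eichler a0 (kappa g) (slice g \<sigma> p x s u) = slice g \<sigma> p x (s + 1) u"
  "eichler b0 (kappa g) (slice g \<sigma> p x s u)
     = slice g \<sigma> p x (s + \<i>) (u + 2 * (of_int g - 1) * s + (of_int g - 1) * \<i>)"
  "eichler a0 rho (slice g \<sigma> p x s u) = slice g \<sigma> p (x + 1) s u"
  "eichler b0 rho (slice g \<sigma> p x s u) = slice g \<sigma> p (x + \<i>) s (u + 4 * x + 2 * p $ R1 0 + 2 * \<i>)"
proof -
  let ?z = "slice g \<sigma> p x s u"
  have z: "?z \<cdot> h_vec g = 0" "?z \<cdot> ?z = 0" by (simp_all add: slice_def pt_h pt_isotropic)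
  have h: "eichler e w ?z \<cdot> h_vec g = 0" "eichler e w ?z \<cdot> eichler e w ?z = 0"
    if "e \<in> Lambda_g g" "w \<in> Lambda_g g" "e \<cdot> e = 0" "e \<cdot> w = 0" for e w
  proof -
    show "eichler e w ?z \<cdot> h_vec g = 0"
      using that z by (simp add: eichler_def k3_bilinear Lambda_gD)
    show "eichler e w ?z \<cdot> eichler e w ?z = 0"
      using eichler_isometry[OF that(3,4)] z by simp
  qed
  have coords: "a0 $ k = (if k = E 1 then 1 else 0)" "b0 $ k = (if k = E 2 then of_int \<sigma> else 0)"
    "kappa g $ k = (if k = E 3 then 1 else if k = F 3 then - (of_int g - 1) else 0)"
    "rho $ k = (if k = R1 0 then 2 else 0)" for k
    by (auto simp: a0_def b0_def kappa_def axis_def)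
  note simps = eichler_def a0_form b0_form kappa_form rho_form products coords slice_def sigma_square algebra_simps
  show "eichler a0 b0 ?z = slice g \<sigma> p x s (u + 1)"
    by (subst (2) slice_def, rule pt_eqI) (use h[OF generators(1,2) products(1,3)] in \<open>simp_all add: simps\<close>)
  show "eichler a0 (kappa g) ?z = slice g \<sigma> p x (s + 1) u"
    by (subst (2) slice_def, rule pt_eqI) (use h[OF generators(1,3) products(1,4)] in \<open>simp_all add: simps\<close>)
  show "eichler b0 (kappa g) ?z = slice g \<sigma> p x (s + \<i>) (u + 2 * (of_int g - 1) * s + (of_int g - 1) * \<i>)"
    by (subst (2) slice_def, rule pt_eqI) (use h[OF generators(2,3) products(2,5)] in \<open>simp_all add: simps, simp_all add: field_simps\<close>)
  show "eichler a0 rho ?z = slice g \<sigma> p (x + 1) s u"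
    by (subst (2) slice_def, rule pt_eqI) (use h[OF generators(1,4) products(1,6)] in \<open>simp_all add: simps\<close>)
  show "eichler b0 rho ?z = slice g \<sigma> p (x + \<i>) s (u + 4 * x + 2 * p $ R1 0 + 2 * \<i>)"
    by (subst (2) slice_def, rule pt_eqI) (use h[OF generators(2,4) products(2,7)] in \<open>simp_all add: simps\<close>)
qed

lemma p_Im: "Im (p $ k) = 0"
  using p_real by (metis conj_vec_simps(7) complex.sel(2) cnj.simps(2) equal_neg_zero)

lemma im_norm_slice: "im_norm (p + x *s rho) = 4 * (Im x)\<^sup>2"
proof -
  have "Im (axis (R1 0) 2 $ R1 j) = 0" for j :: 8 by (simp add: axis_def)
  have "(Im ((p + x *s rho) $ R1 j))\<^sup>2 = (if j = 0 then 4 * (Im x)\<^sup>2 else 0)" "Im ((p + x *s rho) $ R2 j) = 0" for j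
    by (auto simp: axis_def p_Im power_mult_distrib)
  then show ?thesis by (simp add: im_norm_def)
qed

lemma slice_norm: "Re (slice g \<sigma> p x s u \<cdot> conj_vec (slice g \<sigma> p x s u))
    = 4 * (Im u - 2 * (Im x)\<^sup>2 - (of_int g - 1) * (Im s)\<^sup>2)"
  using \<sigma> by (auto simp: slice_def pt_norm im_norm_slice)

lemma slice_pt_domain:
  assumes "Im u > 2 * (Im x)\<^sup>2 + (of_int g - 1) * (Im s)\<^sup>2"
  shows "(p + x *s rho, s, of_int \<sigma> * u, of_int \<sigma> * \<i>) \<in> pt_domain g (of_int \<sigma>)"
  using \<sigma> assms by (auto simp: pt_domain_def im_norm_slice algebra_simps)

text \<open>A root orthogonal to a point far out towards the boundary component is orthogonal to its isotropic
  plane, because the projections of \<open>a0\<close> and \<open>b0\<close> to the complement of the point are short.\<close>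

lemma root_orthogonal_slice:
  assumes v: "v \<in> Lambda_g g" "v \<cdot> v = - 2" "v \<cdot> slice g \<sigma> p x s u = 0"
    and far: "Im u - 2 * (Im x)\<^sup>2 - (of_int g - 1) * (Im s)\<^sup>2 > 1"
  shows "v $ F 1 = 0" "v $ F 2 = 0" "v $ E 3 = 0" "v $ F 3 = 0"
proof -
  let ?z = "slice g \<sigma> p x s u"
  have z: "?z \<cdot> h_vec g = 0" "?z \<cdot> ?z = 0" "Re (?z \<cdot> conj_vec ?z) > 4"
    using far by (simp_all add: slice_norm) (simp_all add: slice_def pt_h pt_isotropic)
  have vL: "v \<in> K3_lattice" "v \<cdot> h_vec g = 0" using v by (auto simp: Lambda_g_def)
  \<comment> \<open>For these isotropic vectors \<open>root_product_bound\<close> leaves only 4 / Re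
    (z \<cdot> \<open>conj_vec z\<close>), which is less than 1 far out, and the product is an
    integer.\<close>
  have zero: "e \<cdot> v = 0"
    if e: "e \<in> Lambda_g g" "e \<cdot> e = 0" "cmod (e \<cdot> ?z) = 1" "e \<cdot> v \<in> \<int>" for e
  proof -
    have eL: "e \<in> K3_lattice" "e \<cdot> h_vec g = 0" using e by (auto simp: Lambda_g_def)
    have "(cmod (e \<cdot> v))\<^sup>2 \<le> 2 * (- Re (e \<cdot> e) + (cmod (e \<cdot> h_vec g))\<^sup>2 / (2 * of_int g - 2)
            + 2 * (cmod (e \<cdot> ?z))\<^sup>2 / Re (?z \<cdot> conj_vec ?z))"
      by (rule root_product_bound) (use g z v vL eL K3_lattice_real in auto)
    also have "\<dots> = 4 / Re (?z \<cdot> conj_vec ?z)" by (simp add: eL e)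
    also have "\<dots> < 1" using z(3) by simp
    finally have "cmod (e \<cdot> v) < 1" by (simp add: power_less_one_iff abs_square_less_1)
    moreover obtain m where "e \<cdot> v = of_int m" using e(4) by (auto elim: Ints_cases)
    ultimately show ?thesis by simp
  qed
  have zF: "?z $ F 1 = 1" "?z $ F 2 = of_int \<sigma> * \<i>" by (simp_all add: slice_def)
  have "a0 \<cdot> v = 0"
    by (rule zero) (use generators products vL integral_forms in
      \<open>auto simp: k3_form_commute[of a0] a0_form zF\<close>)
  then show F1: "v $ F 1 = 0" by (simp add: k3_form_commute[of a0] a0_form)
  have "b0 \<cdot> v = 0"
    by (rule zero) (use generators products vL integral_forms \<sigma> in
      \<open>auto simp: k3_form_commute[of b0] b0_form zF norm_mult\<close>)
  then show F2: "v $ F 2 = 0" using \<sigma> by (auto simp: k3_form_commute[of b0] b0_form)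
  have F3: "v $ F 3 = - ((of_int g - 1) * v $ E 3)" using vL by (simp add: k3_form_h add_eq_0_iff)
  obtain k where k: "v $ E 3 = of_int k" using K3_lattice_EF(1)[OF vL(1)] by (metis Ints_cases)
  \<comment> \<open>The remaining entries give 2 (g - 1) k^2 \<le> 2. Here g > 2 excludes roots with
    a component along \<open>kappa g\<close>.\<close>
  have "Re (v \<cdot> conj_vec v) = - 2" using v K3_lattice_real[OF vL(1)] by simp
  then have "(\<Sum>i\<in>UNIV. (cmod (v $ R1 i))\<^sup>2) + (\<Sum>i\<in>UNIV. (cmod (v $ R2 i))\<^sup>2) + 2 * ((of_int g - 1) * (of_int k)\<^sup>2) = 2"
    unfolding Re_form_conj sum_3 F1 F2 F3 k by (simp add: power2_eq_square algebra_simps)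
  moreover have "(\<Sum>i\<in>UNIV. (cmod (v $ R1 i))\<^sup>2) \<ge> 0" "(\<Sum>i\<in>UNIV. (cmod (v $ R2 i))\<^sup>2) \<ge> 0"
    by (simp_all add: sum_nonneg)
  ultimately have "(real_of_int g - 1) * (of_int k)\<^sup>2 \<le> 1" by linarith
  then have "real_of_int ((g - 1) * k\<^sup>2) \<le> of_int 1" by simp
  then have le: "(g - 1) * k\<^sup>2 \<le> 1" by (simp only: of_int_le_iff)
  have "k = 0"
  proof (rule ccontr)
    assume "k \<noteq> 0"
    then have "k\<^sup>2 \<ge> 1" by (simp add: int_one_le_iff_zero_less)
    then have "(g - 1) * 1 \<le> (g - 1) * k\<^sup>2" using g by (intro mult_left_mono) auto
    then have "g - 1 \<le> 1" using le by (metis mult.right_neutral order_trans)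
    then show False using g by simp
  qed
  then show "v $ E 3 = 0" "v $ F 3 = 0" using k F3 by simp_all
qed

text \<open>Neither s nor u occurs on the right-hand side, so whether such a root is orthogonal to a
  point of the slice depends on x only. This yields \<open>dich\<close> in
  \<open>jacobi_family\<close>.\<close>

lemma root_form_slice:
  assumes "v $ F 1 = 0" "v $ F 2 = 0" "v $ E 3 = 0" "v $ F 3 = 0"
  shows "v \<cdot> slice g \<sigma> p x s u = v $ E 1 + of_int \<sigma> * \<i> * v $ E 2
     - (\<Sum>i\<in>UNIV. v $ R1 i * (p + x *s rho) $ R1 i) - (\<Sum>i\<in>UNIV. v $ R2 i * (p + x *s rho) $ R2 i)"
  unfolding k3_form_def sum_3 slice_def pt_simps assms by simp

end

section \<open>Generic base points\<close>

lemma countable_K3_lattice: "countable K3_lattice"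
proof (rule countable_subset)
  let ?f = "\<lambda>m :: k3_index \<Rightarrow> int. (\<chi> k. of_int (m k) / 2) :: k3_vec"
  show "K3_lattice \<subseteq> range ?f"
  proof
    fix x assume x: "x \<in> K3_lattice"
    have "\<exists>m. 2 * x $ k = of_int m" for k using K3_lattice_half[OF x, of k] by (auto elim: Ints_cases)
    then obtain m where m: "2 * x $ k = of_int (m k)" for k by metis
    have "x = ?f m" by (simp add: vec_eq_iff flip: m)
    then show "x \<in> range ?f" by blast
  qed
qed simp

text \<open>For a lattice vector with a nonzero E8 part, an integral product puts the real point on
  one of countably many hyperplanes, and their union is a null set.\<close>

lemma exists_generic_point:
  obtains p :: k3_vec where "conj_vec p = p"
    "\<And>v. v \<in> K3_lattice \<Longrightarrow>
       (\<Sum>i\<in>UNIV. v $ R1 i * p $ R1 i) + (\<Sum>i\<in>UNIV. v $ R2 i * p $ R2 i) \<in> \<int> \<Longrightarrow>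
       (\<forall>i. v $ R1 i = 0 \<and> v $ R2 i = 0)"
proof -
  define a :: "k3_vec \<Rightarrow> (real ^ 8) \<times> (real ^ 8)" where
    "a v = (\<chi> i. Re (v $ R1 i), \<chi> i. Re (v $ R2 i))" for v
  define B where "B = (\<lambda>(v, m :: int). {x. a v \<bullet> x = of_int m}) ` ({v \<in> K3_lattice. a v \<noteq> 0} \<times> UNIV)"
  have "negligible (\<Union>B)"
  proof (rule negligible_countable_Union)
    have "countable {v \<in> K3_lattice. a v \<noteq> 0}"
      by (rule countable_subset[OF _ countable_K3_lattice]) auto
    then show "countable B" unfolding B_def by (intro countable_image countable_SIGMA) auto
  qed (auto simp: B_def intro!: negligible_hyperplane)
  then have "\<Union>B \<noteq> UNIV" using non_negligible_UNIV by metis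
  then obtain x where x: "x \<notin> \<Union>B" by blast
  define p :: k3_vec where "p = (\<chi> k. case k of R1 i \<Rightarrow> of_real (fst x $ i) | R2 i \<Rightarrow> of_real (snd x $ i) | _ \<Rightarrow> 0)"
  show ?thesis
  proof (rule that)
    show "conj_vec p = p" unfolding vec_eq_iff
    proof
      fix k show "conj_vec p $ k = p $ k" by (cases k) (simp_all add: p_def)
    qed
    fix v assume v: "v \<in> K3_lattice"
      and int: "(\<Sum>i\<in>UNIV. v $ R1 i * p $ R1 i) + (\<Sum>i\<in>UNIV. v $ R2 i * p $ R2 i) \<in> \<int>"
    have re: "of_real (Re (v $ k)) = v $ k" for k
      using half_Ints_imp_real[OF K3_lattice_half[OF v, of k]] by (simp add: complex_eq_iff)
    have "(\<Sum>i\<in>UNIV. v $ R1 i * p $ R1 i) + (\<Sum>i\<in>UNIV. v $ R2 i * p $ R2 i)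
        = (\<Sum>i\<in>UNIV. of_real (Re (v $ R1 i)) * p $ R1 i) + (\<Sum>i\<in>UNIV. of_real (Re (v $ R2 i)) * p $ R2 i)"
      by (simp only: re)
    also have "\<dots> = of_real (a v \<bullet> x)"
      by (cases x) (simp add: a_def p_def inner_vec_def)
    finally have eq: "(\<Sum>i\<in>UNIV. v $ R1 i * p $ R1 i) + (\<Sum>i\<in>UNIV. v $ R2 i * p $ R2 i) = of_real (a v \<bullet> x)" .
    obtain m where "of_real (a v \<bullet> x) = (of_int m :: complex)" using int unfolding eq by (auto elim: Ints_cases)
    then have "a v \<bullet> x = of_int m" by (metis of_real_eq_iff of_real_of_int_eq)
    then have "a v = 0" using x v unfolding B_def by blast
    then have "Re (v $ R1 i) = 0" "Re (v $ R2 i) = 0" for i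
      by (simp_all add: a_def zero_prod_def vec_eq_iff)
    then show "\<forall>i. v $ R1 i = 0 \<and> v $ R2 i = 0" by (metis re of_real_0)
  qed
qed

section \<open>Continuity and holomorphy along curves\<close>

lemma holo_on_imp_continuous_on:
  assumes "holo_on \<Phi> A" shows "continuous_on A \<Phi>"
  unfolding continuous_on_eq_continuous_within
proof
  fix z assume z: "z \<in> A"
  then obtain S G where S: "z \<in> S" "holo_open G S" "\<forall>x\<in>S \<inter> A. G x = \<Phi> x"
    using assms unfolding holo_on_def by blast
  then obtain L where "(G has_derivative L) (at z)" and "open S" unfolding holo_open_def by blast
  then have "continuous (at z within A) G"
    using has_derivative_continuous continuous_at_imp_continuous_at_within by blast
  moreover have "\<forall>\<^sub>F x in at z within A. G x = \<Phi> x"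
    using \<open>open S\<close> S(1,3) unfolding eventually_at_topological by blast
  ultimately show "continuous (at z within A) \<Phi>"
    using S(1,3) z unfolding continuous_within by (metis (mono_tags, lifting) IntI tendsto_cong)
qed

lemma has_derivative_scale_vec:
  assumes "(f has_field_derivative f') (at x)"
  shows "((\<lambda>x. f x *s (c :: complex ^ 'n)) has_derivative (\<lambda>h. (f' * h) *s c)) (at x)"
proof -
  have "linear (\<lambda>a :: complex. a *s c)"
    by (rule linearI) (simp_all add: vec.scale_left_distrib, simp add: vec_eq_iff)
  then have "bounded_linear (\<lambda>a :: complex. a *s c)" by (simp add: linear_conv_bounded_linear)
  then show ?thesis
    using assms unfolding has_field_derivative_def by (rule bounded_linear.has_derivative)
qed

text \<open>The chain rule for a local holomorphic extension of \<Phi>. Quadratic curves suffice: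
  along a slice the entry \<open>E 1\<close> is quadratic in x, while the other entries are affine
  in x, and all entries are affine in u.\<close>

lemma holo_on_quadratic_curve:
  assumes \<Phi>: "holo_on \<Phi> A" and S: "open S" "x0 \<in> S"
    and \<gamma>: "\<And>x. x \<in> S \<Longrightarrow> \<gamma> x \<in> A" "\<And>x. \<gamma> x = c0 + x *s c1 + x\<^sup>2 *s c2"
  shows "(\<lambda>x. \<Phi> (\<gamma> x)) field_differentiable (at x0)"
proof -
  obtain T G where T: "\<gamma> x0 \<in> T" "holo_open G T" "\<forall>z\<in>T \<inter> A. G z = \<Phi> z"
    using \<Phi> \<gamma>(1)[OF S(2)] unfolding holo_on_def by blast
  then obtain L where L: "(G has_derivative L) (at (\<gamma> x0))" "\<And>c v. L (c *s v) = c * L v" and "open T"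
    unfolding holo_open_def by blast
  let ?d = "c1 + (2 * x0) *s c2"
  have d1: "((\<lambda>x. x *s c1) has_derivative (\<lambda>h. (1 * h) *s c1)) (at x0)"
    by (rule has_derivative_scale_vec) (rule DERIV_ident)
  have d2: "((\<lambda>x. x\<^sup>2 *s c2) has_derivative (\<lambda>h. (2 * x0 * h) *s c2)) (at x0)"
    by (rule has_derivative_scale_vec) (auto intro!: derivative_eq_intros)
  have "((\<lambda>x. c0 + x *s c1 + x\<^sup>2 *s c2) has_derivative (\<lambda>h. 0 + (1 * h) *s c1 + (2 * x0 * h) *s c2)) (at x0)"
    by (intro has_derivative_add has_derivative_const d1 d2)
  moreover have "\<gamma> = (\<lambda>x. c0 + x *s c1 + x\<^sup>2 *s c2)" using \<gamma>(2) by blast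
  moreover have "(\<lambda>h. 0 + (1 * h) *s c1 + (2 * x0 * h) *s c2) = (\<lambda>h. h *s ?d)"
    by (simp add: vec_eq_iff fun_eq_iff algebra_simps)
  ultimately have d\<gamma>: "(\<gamma> has_derivative (\<lambda>h. h *s ?d)) (at x0)" by simp
  have DL: "((\<lambda>x. G (\<gamma> x)) has_derivative (\<lambda>h. L (h *s ?d))) (at x0)"
    by (rule has_derivative_compose[OF d\<gamma> L(1)])
  have D: "((\<lambda>x. G (\<gamma> x)) has_field_derivative L ?d) (at x0)"
  proof -
    have "(\<lambda>h. L (h *s ?d)) = (*) (L ?d)" by (rule ext) (simp only: L(2) mult.commute)
    then show ?thesis using DL by (simp add: has_field_derivative_def)
  qed
  have "continuous_on UNIV \<gamma>" unfolding \<gamma>(2) by (intro continuous_intros)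
  then have "open (\<gamma> -` T)" using \<open>open T\<close> by (simp add: open_vimage)
  then have op: "open (S \<inter> \<gamma> -` T)" using S(1) by blast
  have "((\<lambda>x. \<Phi> (\<gamma> x)) has_field_derivative L ?d) (at x0)"
    by (rule has_field_derivative_transform_within_open[OF D op]) (use T(1,3) S(2) \<gamma>(1) in auto)
  then show ?thesis unfolding field_differentiable_def by blast
qed

section \<open>The contradiction on a slice\<close>

context slice_data begin

lemma sum_rho: "(\<Sum>j\<in>UNIV. ((p + x *s rho) $ R1 j)\<^sup>2) = (\<Sum>j\<in>UNIV. (p $ R1 j)\<^sup>2) + 4 * x * p $ R1 0 + 4 * x\<^sup>2"
proof -
  have "((p + x *s rho) $ R1 j)\<^sup>2 = (p $ R1 j)\<^sup>2 + (if j = 0 then 4 * x * p $ R1 0 + 4 * x\<^sup>2 else 0)" for j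
    by (simp add: axis_def power2_eq_square algebra_simps)
  then show ?thesis by (simp add: sum.distrib)
qed

lemma slice_E1: "slice g \<sigma> p x s u $ E 1 = ((\<Sum>j\<in>UNIV. (p $ R1 j)\<^sup>2) + 4 * x * p $ R1 0 + 4 * x\<^sup>2
    + (\<Sum>j\<in>UNIV. (p $ R2 j)\<^sup>2)) / 2 + (of_int g - 1) * s\<^sup>2 - \<i> * u"
  unfolding slice_def pt_simps sum_rho
  by (simp add: axis_def) (simp add: algebra_simps sigma_square)

lemma slice_quadratic_x: "slice g \<sigma> p x s u = slice g \<sigma> p 0 s u + x *s (rho + (2 * p $ R1 0) *s a0) + x\<^sup>2 *s (2 *s a0)"
  unfolding vec_eq_iff
proof
  fix k
  show "slice g \<sigma> p x s u $ k = (slice g \<sigma> p 0 s u + x *s (rho + (2 * p $ R1 0) *s a0) + x\<^sup>2 *s (2 *s a0)) $ k"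
  proof (cases k)
    case (E i)
    then show ?thesis using exhaust_3[of i]
      by (auto simp: slice_E1) (auto simp: slice_def axis_def a0_def field_simps)
  next
    case (F i)
    then show ?thesis using exhaust_3[of i]
      by (auto simp: slice_def) (auto simp: axis_def a0_def)
  qed (auto simp: slice_def axis_def a0_def)
qed

text \<open>The zero quadratic term gives the equation the shape that
  \<open>holo_on_quadratic_curve\<close> expects.\<close>

lemma slice_linear_u: "slice g \<sigma> p x s u = slice g \<sigma> p x s 0 + u *s (b0 - \<i> *s a0) + u\<^sup>2 *s 0"
  unfolding vec_eq_iff
proof
  fix k
  show "slice g \<sigma> p x s u $ k = (slice g \<sigma> p x s 0 + u *s (b0 - \<i> *s a0) + u\<^sup>2 *s 0) $ k"
  proof (cases k)
    case (E i)
    then show ?thesis using exhaust_3[of i]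
      by (auto simp: slice_E1) (auto simp: slice_def axis_def a0_def b0_def algebra_simps sigma_square)
  next
    case (F i)
    then show ?thesis using exhaust_3[of i]
      by (auto simp: slice_def) (auto simp: axis_def a0_def b0_def)
  qed (auto simp: slice_def axis_def a0_def b0_def)
qed

text \<open>The common core of both claims: \<Phi> is either the pullback of a local equation, with
  A the trace of a neighbourhood of a boundary point, or an automorphic form with A = C. For generic
  p the slice gives a \<open>jacobi_family\<close> that is nonzero at x = 0 and zero at some other
  x, against \<open>nonzero_const\<close>.\<close>

theorem no_form_vanishing_on_roots:
  fixes t :: real
  assumes generic: "\<And>v. v \<in> K3_lattice \<Longrightarrow>
       (\<Sum>i\<in>UNIV. v $ R1 i * p $ R1 i) + (\<Sum>i\<in>UNIV. v $ R2 i * p $ R2 i) \<in> \<int> \<Longrightarrow>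
       (\<forall>i. v $ R1 i = 0 \<and> v $ R2 i = 0)"
    and holo: "holo_on \<Phi> A" and t: "t \<ge> 1"
    and mem: "\<And>x s u. Im u > t + 2 * (Im x)\<^sup>2 + (of_int g - 1) * (Im s)\<^sup>2 \<Longrightarrow> slice g \<sigma> p x s u \<in> A"
    and inv: "\<And>e w z. z \<in> A \<Longrightarrow> e \<in> Lambda_g g \<Longrightarrow> w \<in> Lambda_g g \<Longrightarrow> e \<cdot> e = 0 \<Longrightarrow> e \<cdot> w = 0 \<Longrightarrow>
       (\<And>x. x \<in> K3_lattice \<Longrightarrow> x \<cdot> e \<in> \<int>) \<Longrightarrow> (\<And>x. x \<in> K3_lattice \<Longrightarrow> x \<cdot> w \<in> \<int>) \<Longrightarrow>
       \<Phi> (eichler e w z) = \<Phi> z"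
    and zero: "\<And>z v. z \<in> A \<Longrightarrow> v \<in> N_g g \<Longrightarrow> z \<cdot> v = 0 \<Longrightarrow> \<Phi> z = 0"
    and nonzero: "\<And>z. z \<in> A \<Longrightarrow> (\<And>v. v \<in> Lambda_g g \<Longrightarrow> v \<cdot> v = - 2 \<Longrightarrow> z \<cdot> v \<noteq> 0) \<Longrightarrow> \<Phi> z \<noteq> 0"
  shows False
proof -
  define n where "n = nat (g - 1)"
  have n: "n > 0" "real n = of_int g - 1" "(of_nat n :: complex) = of_int g - 1"
    using g by (simp_all add: n_def)
  let ?Z = "slice g \<sigma> p"
  let ?F = "\<lambda>x s u. \<Phi> (?Z x s u)"
  define c where "c = 2 * Re (p $ R1 0)"
  have c: "of_real c = 2 * p $ R1 0" using p_Im[of "R1 0"] by (simp add: c_def complex_eq_iff)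
  have memP: "?Z x s u \<in> A" if "(s, u) \<in> parabolic_domain n (t + 2 * (Im x)\<^sup>2)" for x s u
    using that n(2) by (intro mem) (simp add: parabolic_domain_def)
  have mem0: "?Z x 0 u \<in> A" if "Im u > t + 2 * (Im x)\<^sup>2" for x u
    using that by (intro mem) simp
  have invs: "?F x s (u + 1) = ?F x s u" "?F x (s + 1) u = ?F x s u"
    "?F x (s + \<i>) (u + 2 * (of_int g - 1) * s + (of_int g - 1) * \<i>) = ?F x s u"
    "?F (x + 1) s u = ?F x s u" "?F (x + \<i>) s (u + 4 * x + 2 * p $ R1 0 + 2 * \<i>) = ?F x s u"
    if "?Z x s u \<in> A" for x s u
    unfolding eichler_slice[symmetric]
    by (intro inv that generators products integral_forms; assumption)+
  have dich: "(\<forall>(s, u) \<in> parabolic_domain n (t + 2 * (Im x)\<^sup>2). ?F x s u \<noteq> 0) \<or>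
         (\<forall>(s, u) \<in> parabolic_domain n (t + 2 * (Im x)\<^sup>2). ?F x s u = 0)" for x
  proof (cases "\<exists>(s, u) \<in> parabolic_domain n (t + 2 * (Im x)\<^sup>2). ?F x s u = 0")
    case True
    then obtain s u where su: "(s, u) \<in> parabolic_domain n (t + 2 * (Im x)\<^sup>2)" "?F x s u = 0" by blast
    then obtain v where v: "v \<in> Lambda_g g" "v \<cdot> v = - 2" "v \<cdot> ?Z x s u = 0"
      using nonzero[OF memP] by (metis k3_form_commute)
    have "Im u - 2 * (Im x)\<^sup>2 - (of_int g - 1) * (Im s)\<^sup>2 > 1"
      using su(1) t n(2) by (simp add: parabolic_domain_def)
    \<comment> \<open>The root found at one zero is orthogonal to the isotropic plane; by
      \<open>root_form_slice\<close> it is then orthogonal to all points of the slice with the same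
      x.\<close>
    note r = root_orthogonal_slice[OF v this]
    have "?F x s' u' = 0" if "(s', u') \<in> parabolic_domain n (t + 2 * (Im x)\<^sup>2)" for s' u'
    proof (rule zero[OF memP[OF that] root_in_N_g[OF v(1,2) r(3)]])
      show "?Z x s' u' \<cdot> v = 0"
        using v(3) unfolding k3_form_commute[of _ v] root_form_slice[OF r] .
    qed
    then show ?thesis by blast
  qed auto
  interpret J: jacobi_family ?F n c t
  proof
    show "n > 0" by (rule n)
    show "continuous_on {(x, s, u). (s, u) \<in> parabolic_domain n (t + 2 * (Im x)\<^sup>2)} (\<lambda>(x, s, u). ?F x s u)"
      unfolding case_prod_unfold slice_def
      by (rule continuous_on_compose2[OF holo_on_imp_continuous_on[OF holo]])
        (use memP in \<open>auto simp: slice_def intro!: continuous_intros\<close>)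
    fix x u :: complex assume xu: "Im u > t + 2 * (Im x)\<^sup>2"
    have "open {x. t + 2 * (Im x)\<^sup>2 < Im u}" by (intro open_Collect_less continuous_intros)
    then show "(\<lambda>x. ?F x 0 u) field_differentiable (at x)"
      by (rule holo_on_quadratic_curve[OF holo _ _ _ slice_quadratic_x]) (use xu mem0 in auto)
    have "open {u. t + 2 * (Im x)\<^sup>2 < Im u}" by (intro open_Collect_less continuous_intros)
    then show "(\<lambda>u. ?F x 0 u) field_differentiable (at u)"
      by (rule holo_on_quadratic_curve[OF holo _ _ _ slice_linear_u]) (use xu mem0 in auto)
    show "?F (x + 1) 0 u = ?F x 0 u \<and> ?F (x + \<i>) 0 (u + 4 * x + of_real c + 2 * \<i>) = ?F x 0 u"
      using invs(4,5)[OF mem0[OF xu]] by (simp add: c)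
  next
    fix x s u assume "(s, u) \<in> parabolic_domain n (t + 2 * (Im x)\<^sup>2)"
    then show "?F x s (u + 1) = ?F x s u \<and> ?F x (s + 1) u = ?F x s u \<and>
         ?F x (s + \<i>) (u + 2 * of_nat n * s + of_nat n * \<i>) = ?F x s u"
      unfolding n(3) using invs(1-3)[OF memP] by blast
  qed (rule dich)
  have base: "Im (J.base x) > t + 2 * (Im x)\<^sup>2" for x by (simp add: J.Im_base)
  \<comment> \<open>At x = 0 an orthogonal root would have a real product with p that equals
    \<open>v $ E 1 + of_int \<sigma> * \<i> * v $ E 2\<close>, hence an integer. By genericity its
    E8 parts vanish, and then v \<cdot> v = 0.\<close>
  have "J.nonzero 0"
    unfolding J.nonzero_def
  proof (rule nonzero[OF mem0[OF base]])
    fix v assume v: "v \<in> Lambda_g g" "v \<cdot> v = - 2"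
    show "?Z 0 0 (J.base 0) \<cdot> v \<noteq> 0"
    proof
      assume "?Z 0 0 (J.base 0) \<cdot> v = 0"
      then have vz: "v \<cdot> ?Z 0 0 (J.base 0) = 0" by (simp only: k3_form_commute)
      have "Im (J.base 0) - 2 * (Im 0)\<^sup>2 - (of_int g - 1) * (Im 0)\<^sup>2 > 1" using base[of 0] t by simp
      note r = root_orthogonal_slice[OF v vz this]
      let ?T = "(\<Sum>i\<in>UNIV. v $ R1 i * p $ R1 i) + (\<Sum>i\<in>UNIV. v $ R2 i * p $ R2 i)"
      have eq: "v $ E 1 + of_int \<sigma> * \<i> * v $ E 2 = ?T"
        using vz unfolding root_form_slice[OF r] by (simp add: algebra_simps)
      have vL: "v \<in> K3_lattice" by (rule Lambda_gD[OF v(1)])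
      obtain k l where kl: "v $ E 1 = of_int k" "v $ E 2 = of_int l"
        using K3_lattice_EF(1)[OF vL] by (metis Ints_cases)
      have "cnj (v $ k) = v $ k" for k by (rule half_Ints_imp_real[OF K3_lattice_half[OF vL]])
      then have "Im (v $ k) = 0" for k by (metis complex.sel(2) cnj.simps(2) equal_neg_zero)
      then have "Im ?T = 0" by (simp add: p_Im)
      then have "of_int \<sigma> * of_int l = (0 :: real)" unfolding eq[symmetric] kl by simp
      then have "l = 0" using \<sigma> by auto
      then have "?T = of_int k" using eq kl by simp
      then have "?T \<in> \<int>" by (metis Ints_of_int)
      then have "v $ R1 i = 0" "v $ R2 i = 0" for i using generic[OF vL] by blast+
      then have "v \<cdot> v = 0" by (simp add: k3_form_def sum_3 r)
      then show False using v by simp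
    qed
  qed
  \<comment> \<open>This x is the zero of \<open>- (p $ R1 0 + 2 * x + p $ R1 1)\<close>, the
    product of the slice with the E8 root that has entries 1 at \<open>R1 0\<close> and
    \<open>R1 1\<close>.\<close>
  moreover have "\<not> J.nonzero (- (p $ R1 0 + p $ R1 1) / 2)" (is "\<not> J.nonzero ?x")
  proof -
    define v :: k3_vec where "v = axis (R1 0) 1 + axis (R1 1) 1"
    have "(\<chi> i. v $ R1 i) \<in> E8_lattice"
      by (auto simp: E8_lattice_def v_def axis_def sum.distrib)
    moreover have "(\<chi> i. v $ R2 i) \<in> E8_lattice"
      by (auto simp: E8_lattice_def v_def axis_def)
    ultimately have "v \<in> Lambda_g g"
      by (auto simp: Lambda_g_def K3_lattice_def k3_form_h) (auto simp: v_def axis_def)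
    moreover have "v \<cdot> v = - 2"
      by (subst (2) v_def) (simp add: k3_bilinear k3_form_axis, simp add: v_def axis_def)
    moreover have "v $ E 3 = 0" by (simp add: v_def axis_def)
    ultimately have "v \<in> N_g g" by (rule root_in_N_g)
    moreover have "?Z ?x 0 (J.base ?x) \<cdot> v = 0"
      by (simp add: v_def k3_bilinear k3_form_axis slice_def) (simp add: axis_def field_simps)
    ultimately show ?thesis
      unfolding J.nonzero_def using zero[OF mem0[OF base]] by blast
  qed
  ultimately show False using J.nonzero_const by blast
qed

end

section \<open>The divisor in the Satake topology\<close>

lemma Gamma_gD:
  assumes "\<gamma> \<in> Gamma_g g C"
  shows "\<gamma> x \<cdot> \<gamma> y = x \<cdot> y" "\<gamma> ` K3_lattice = K3_lattice" "\<gamma> (h_vec g) = h_vec g" "\<gamma> ` C = C"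
  using assms by (auto simp: Gamma_g_def O_K3_def)

lemma id_in_Gamma: "id \<in> Gamma_g g C"
  by (simp add: Gamma_g_def O_K3_def vec.linear_id)

lemma orbit_class_refl: "z \<in> orbit_class g C z"
  unfolding orbit_class_def using id_in_Gamma[of g C]
  by (intro CollectI exI[of _ 1] exI[of _ id]) auto

lemma orbit_class_eqD:
  assumes "orbit_class g C z = orbit_class g C z'"
  obtains c \<gamma> where "c \<noteq> 0" "\<gamma> \<in> Gamma_g g C" "z = c *s \<gamma> z'"
  using orbit_class_refl[of z g C] unfolding assms unfolding orbit_class_def by blast

text \<open>All \<open>(-2)\<close>-vectors are used here instead of \<open>N\<^sub>g\<close>, so that invariance is immediate. For \<open>g > 2\<close> it
  is the same set.\<close>

definition root_free :: "int \<Rightarrow> k3_vec set \<Rightarrow> k3_vec set" where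
  "root_free g C = {z \<in> C. \<forall>v\<in>Lambda_g g. v \<cdot> v = - 2 \<longrightarrow> z \<cdot> v \<noteq> 0}"

lemma N_g_subset: "v \<in> N_g g \<Longrightarrow> v \<in> Lambda_g g \<and> v \<cdot> v = - 2"
  by (simp add: N_g_def)

lemma root_free_orbit:
  assumes z: "z \<in> root_free g C" and z': "z' \<in> C" and eq: "orbit_class g C z = orbit_class g C z'"
  shows "z' \<in> root_free g C"
proof -
  obtain c \<gamma> where c: "c \<noteq> 0" "\<gamma> \<in> Gamma_g g C" "z = c *s \<gamma> z'" by (rule orbit_class_eqD[OF eq])
  note G = Gamma_gD[OF c(2)]
  have "z' \<cdot> v \<noteq> 0" if v: "v \<in> Lambda_g g" "v \<cdot> v = - 2" for v
  proof
    assume 0: "z' \<cdot> v = 0"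
    have "\<gamma> v \<in> Lambda_g g"
      using v(1) G(2) G(1)[of v "h_vec g"] G(3) by (auto simp: Lambda_g_def)
    moreover have "\<gamma> v \<cdot> \<gamma> v = - 2" using v G(1) by simp
    moreover have "z \<cdot> \<gamma> v = 0" using 0 G(1) by (simp add: c(3) k3_bilinear)
    ultimately show False using z by (auto simp: root_free_def)
  qed
  then show ?thesis using z' by (simp add: root_free_def)
qed

text \<open>Boundary vectors are complex combinations of real vectors spanning an isotropic
  subspace. This separates them from C, where the hermitian form is positive.\<close>

lemma boundary_cone_null: "w \<in> boundary_cone g C \<Longrightarrow> w \<cdot> conj_vec w = 0"
proof -
  assume "w \<in> boundary_cone g C"
  then consider (plane) a b z where "isotropic_pair g a b" "w = plane_proj a b z"
    | (line) c e where "e \<in> isotropic_vecs g" "w = c *s e"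
    unfolding boundary_cone_def plane_stratum_def by blast
  then show ?thesis
  proof cases
    case plane
    then have "conj_vec a = a" "conj_vec b = b" "a \<cdot> a = 0" "a \<cdot> b = 0" "b \<cdot> b = 0" "b \<cdot> a = 0"
      by (auto simp: isotropic_pair_def Lambda_g_def K3_lattice_real k3_form_commute)
    then show ?thesis by (simp add: plane plane_proj_def k3_bilinear)
  next
    case line
    then have "conj_vec e = e" "e \<cdot> e = 0" by (auto simp: isotropic_vecs_def Lambda_g_def K3_lattice_real)
    then show ?thesis by (simp add: line k3_bilinear)
  qed
qed

section \<open>Local finiteness of the root hyperplanes\<close>

lemma finite_bounded_lattice: "finite {v \<in> K3_lattice. \<forall>k. cmod (v $ k) \<le> B k}"
proof -
  let ?Q = "\<lambda>k. {m :: int. \<bar>m\<bar> \<le> \<lfloor>2 * B k\<rfloor>}"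
  have fin: "finite (?Q k)" for k
    by (rule finite_subset[of _ "{- \<lfloor>2 * B k\<rfloor>..\<lfloor>2 * B k\<rfloor>}"]) auto
  have "{v \<in> K3_lattice. \<forall>k. cmod (v $ k) \<le> B k} \<subseteq> (\<lambda>m. \<chi> k. of_int (m k) / 2) ` Pi\<^sub>E UNIV ?Q"
  proof
    fix v assume v: "v \<in> {v \<in> K3_lattice. \<forall>k. cmod (v $ k) \<le> B k}"
    have "\<exists>m. 2 * v $ k = of_int m" for k
      using v K3_lattice_half[of v k] by (auto elim: Ints_cases)
    then obtain m where m: "2 * v $ k = of_int (m k)" for k by metis
    have "\<bar>m k\<bar> \<le> \<lfloor>2 * B k\<rfloor>" for k
    proof -
      have "of_int \<bar>m k\<bar> = cmod (2 * v $ k)" unfolding m by simp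
      also have "\<dots> \<le> 2 * B k" using v by (simp add: norm_mult)
      finally show ?thesis by (simp add: le_floor_iff)
    qed
    moreover have "v = (\<chi> k. of_int (m k) / 2)" by (simp add: vec_eq_iff flip: m)
    ultimately show "v \<in> (\<lambda>m. \<chi> k. of_int (m k) / 2) ` Pi\<^sub>E UNIV ?Q" by (intro image_eqI[of _ _ m]) auto
  qed
  moreover have "finite (Pi\<^sub>E UNIV ?Q)" by (intro finite_PiE fin) auto
  ultimately show ?thesis by (meson finite_imageI finite_subset)
qed

text \<open>Applied to dual coordinate vectors, \<open>root_product_bound\<close> bounds each entry
  of a root orthogonal to z by a continuous function of z. So only finitely many root hyperplanes
  meet a neighbourhood of a given point.\<close>

lemma root_free_open:
  assumes g: "g > 1" and C: "C \<in> components (period_cone g)"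
  shows "openin (top_of_set C) (root_free g C)"
proof (subst openin_subopen, intro ballI)
  fix z0 assume z0: "z0 \<in> root_free g C"
  define dual :: "k3_index \<Rightarrow> k3_vec" where
    "dual k = (case k of R1 i \<Rightarrow> axis (R1 i) 1 | R2 i \<Rightarrow> axis (R2 i) 1 | E i \<Rightarrow> axis (F i) 1 | F i \<Rightarrow> axis (E i) 1)" for k
  have dual: "cmod (dual k \<cdot> v) = cmod (v $ k)" "conj_vec (dual k) = dual k" for k v
    by (cases k; simp add: dual_def k3_form_axis)+
  define q where "q k z = 2 * (- Re (dual k \<cdot> dual k) + (cmod (dual k \<cdot> h_vec g))\<^sup>2 / (2 * of_int g - 2)
            + 2 * (cmod (dual k \<cdot> z))\<^sup>2 / Re (z \<cdot> conj_vec z))" for k z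
  have pc: "z \<cdot> h_vec g = 0" "z \<cdot> z = 0" "Re (z \<cdot> conj_vec z) > 0" if "z \<in> C" for z
    using that C in_components_subset period_cone_iff by blast+
  \<comment> \<open>On U each bound stays below its value at \<open>z0\<close> plus 1, so one finite
    set of roots serves all points of U.\<close>
  define U where "U = (\<Inter>k. {z \<in> C. q k z < q k z0 + 1})"
  have contq: "continuous_on C (q k)" for k
  proof -
    have "Re (z \<cdot> conj_vec z) \<noteq> 0" if "z \<in> C" for z using pc(3)[OF that] by simp
    then show ?thesis unfolding q_def by (intro continuous_intros) auto
  qed
  have "openin (top_of_set C) {z \<in> C. q k z < q k z0 + 1}" for k
    using continuous_openin_preimage_gen[OF contq open_lessThan[of "q k z0 + 1"]] by (simp add: Int_def vimage_def)
  then have "openin (top_of_set C) U"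
    unfolding U_def by (intro openin_INT2) auto
  let ?V = "{v \<in> K3_lattice. \<forall>k. cmod (v $ k) \<le> sqrt (q k z0 + 1)}"
  let ?V' = "{v \<in> ?V. v \<cdot> h_vec g = 0 \<and> v \<cdot> v = - 2}"
  have finV: "finite ?V'" by (rule finite_subset[OF _ finite_bounded_lattice[of "\<lambda>k. sqrt (q k z0 + 1)"]]) auto
  have V: "v \<in> ?V'" if v: "v \<in> Lambda_g g" "v \<cdot> v = - 2" "z \<cdot> v = 0" and z: "z \<in> U" for v z
  proof -
    have zC: "z \<in> C" using z by (auto simp: U_def)
    have vL: "v \<in> K3_lattice" "v \<cdot> h_vec g = 0" using v by (auto simp: Lambda_g_def)
    have "cmod (v $ k) \<le> sqrt (q k z0 + 1)" for k
    proof -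
      have "(cmod (dual k \<cdot> v))\<^sup>2 \<le> q k z"
        unfolding q_def
        by (rule root_product_bound[OF g pc[OF zC]])
          (use v vL dual K3_lattice_real in \<open>auto simp: k3_form_commute\<close>)
      also have "\<dots> < q k z0 + 1" using z unfolding U_def by blast
      finally show ?thesis unfolding dual by (intro real_le_rsqrt less_imp_le)
    qed
    then show ?thesis using vL v by simp
  qed
  let ?T = "U \<inter> (\<Inter>v\<in>?V'. {z \<in> C. z \<cdot> v \<noteq> 0})"
  have "openin (top_of_set C) {z \<in> C. z \<cdot> v \<noteq> 0}" for v
  proof -
    have "continuous_on C (\<lambda>z. z \<cdot> v)" by (intro continuous_intros)
    from continuous_openin_preimage_gen[OF this, of "- {0}"] show ?thesis by (simp add: Int_def vimage_def open_Compl)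
  qed
  then have "openin (top_of_set C) ?T"
  proof (cases "?V' = {}")
    case True
    then show ?thesis using \<open>openin (top_of_set C) U\<close> by (simp only: True) simp
  next
    case False
    then show ?thesis using finV \<open>openin (top_of_set C) U\<close> \<open>\<And>v. openin (top_of_set C) {z \<in> C. z \<cdot> v \<noteq> 0}\<close>
      by (intro openin_Int openin_INT2) auto
  qed
  moreover have "z0 \<in> ?T" using z0 by (auto simp: U_def root_free_def Lambda_g_def)
  moreover have "?T \<subseteq> root_free g C"
  proof
    fix z assume z: "z \<in> ?T"
    then have "z \<in> C" by (auto simp: U_def)
    moreover have "z \<cdot> v \<noteq> 0" if v: "v \<in> Lambda_g g" "v \<cdot> v = - 2" for v
    proof
      assume 0: "z \<cdot> v = 0"
      then have "v \<in> ?V'" using V[OF v 0] z by blast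
      then show False using z 0 by blast
    qed
    ultimately show "z \<in> root_free g C" by (simp add: root_free_def)
  qed
  ultimately show "\<exists>T. openin (top_of_set C) T \<and> z0 \<in> T \<and> T \<subseteq> root_free g C" by blast
qed

text \<open>The orbit class of a point of C lies in C, so no boundary point can be added, and being
  orthogonal to no root is invariant under the group.\<close>

lemma preimage_root_free:
  assumes C: "C \<in> components (period_cone g)"
  shows "preimage g C (orbit_class g C ` root_free g C) = root_free g C"
proof
  show "root_free g C \<subseteq> preimage g C (orbit_class g C ` root_free g C)"
    by (auto simp: preimage_def root_free_def)
  show "preimage g C (orbit_class g C ` root_free g C) \<subseteq> root_free g C"
  proof
    fix y assume "y \<in> preimage g C (orbit_class g C ` root_free g C)"
    then obtain z where y: "y \<in> C \<union> boundary_cone g C" and z: "z \<in> root_free g C"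
      and eq: "orbit_class g C y = orbit_class g C z" by (auto simp: preimage_def)
    obtain c \<gamma> where c: "c \<noteq> 0" "\<gamma> \<in> Gamma_g g C" "y = c *s \<gamma> z" by (rule orbit_class_eqD[OF eq])
    have "\<gamma> z \<in> C" using Gamma_gD(4)[OF c(2)] z by (auto simp: root_free_def)
    then have yC: "y \<in> C" unfolding c(3) by (rule component_scale[OF C _ c(1)])
    show "y \<in> root_free g C" by (rule root_free_orbit[OF z yC eq[symmetric]])
  qed
qed

lemma root_free_boundary:
  assumes C: "C \<in> components (period_cone g)"
  shows "root_free g C \<inter> boundary_cone g C = {}"
  using C in_components_subset[OF C] boundary_cone_null[of _ g C] period_cone_iff[of _ g]
  by (force simp: root_free_def)

text \<open>The image of \<open>root_free g C\<close> is an open set that misses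
  \<open>D_g g C\<close>. The conditions of \<open>satake_open\<close> at the boundary hold
  vacuously, since the set contains no boundary points.\<close>

lemma root_free_not_in_closure:
  assumes g: "g > 1" and C: "C \<in> components (period_cone g)" and z: "z \<in> root_free g C"
  shows "orbit_class g C z \<notin> X_bb g C closure_of D_g g C"
proof
  let ?W = "orbit_class g C ` root_free g C"
  have no_boundary: "w \<notin> root_free g C" if "w \<in> boundary_cone g C" for w
    using root_free_boundary[OF C] that by blast
  have "satake_open g C (root_free g C)"
    unfolding satake_open_def
  proof (intro conjI allI impI ballI)
    show "openin (top_of_set C) (root_free g C \<inter> C)"
      using root_free_open[OF g C] by (simp add: root_free_def Int_def conj_commute)
  next
    fix a b w assume "isotropic_pair g a b \<and> w \<in> root_free g C \<inter> plane_stratum C a b"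
    then show "\<exists>\<epsilon>>0. \<exists>t. \<forall>z\<in>plane_nbhd C a b w \<epsilon> t. z \<in> root_free g C \<and> plane_proj a b z \<in> root_free g C"
      using no_boundary[of w] by (auto simp: boundary_cone_def)
  next
    fix e assume e: "e \<in> root_free g C \<inter> isotropic_vecs g"
    then have "1 *s e \<in> boundary_cone g C" unfolding boundary_cone_def
      by (intro UnI2 CollectI exI[of _ 1] exI[of _ e]) auto
    then show "\<exists>t. \<forall>z\<in>line_nbhd g C e t. z \<in> root_free g C \<and>
        (\<forall>b. isotropic_pair g e b \<longrightarrow> plane_proj e b z \<in> root_free g C)"
      using e no_boundary by simp
  qed
  then have "openin (X_bb g C) ?W"
    by (auto simp: openin_X_bb preimage_root_free[OF C]) (auto simp: X_bb_set_def X_g_def root_free_def)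
  moreover assume "orbit_class g C z \<in> X_bb g C closure_of D_g g C"
  ultimately obtain y where y: "y \<in> D_g g C" "y \<in> ?W"
    using z unfolding in_closure_of by blast
  then obtain z1 z2 v where z1: "y = orbit_class g C z1" "z1 \<in> root_free g C"
    and z2: "y = orbit_class g C z2" "z2 \<in> C" "v \<in> N_g g" "z2 \<cdot> v = 0"
    unfolding D_g_def by blast
  have "z2 \<in> root_free g C" using root_free_orbit[OF z1(2) z2(2)] z1(1) z2(1) by simp
  then show False using z2 N_g_subset by (auto simp: root_free_def)
qed

lemma topspace_X_bb: "topspace (X_bb g C) = X_bb_set g C"
proof -
  have "satake_open g C (C \<union> boundary_cone g C)"
    unfolding satake_open_def
    by (auto simp: plane_nbhd_def line_nbhd_def boundary_cone_def plane_stratum_def intro!: exI[of _ "1 :: real"])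
  moreover have "preimage g C (X_bb_set g C) = C \<union> boundary_cone g C"
    by (auto simp: preimage_def X_bb_set_def X_g_def)
  ultimately have "openin (X_bb g C) (X_bb_set g C)" by (simp add: openin_X_bb)
  moreover have "topspace (X_bb g C) \<subseteq> X_bb_set g C"
    using openin_topspace[of "X_bb g C"] unfolding openin_X_bb by blast
  ultimately show ?thesis using openin_subset by blast
qed

text \<open>Where f has order m > 0 along D, the generator of the ideal vanishes and so does f. Such
  points are dense in the part of D inside W, and f is continuous.\<close>

lemma divisor_multiple_vanishes:
  assumes W: "openin T W" and cont: "continuous_map (subtopology T W) euclidean f"
    and div: "divisor_is_multiple T \<O> D W f m" "m > 0" and y: "y \<in> W" "y \<in> D"
  shows "f y = 0"
proof (rule ccontr)
  assume fy: "f y \<noteq> 0"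
  let ?K = "{x \<in> W \<inter> D. has_order_at T \<O> D f m x}"
  have K0: "f x = 0" if x: "x \<in> ?K" for x
  proof -
    obtain W' t u where "generates_ideal_at T \<O> D x W' t" "\<forall>y\<in>W'. f y = u y * t y ^ m"
      using x unfolding has_order_at_def by blast
    then show ?thesis using x div(2) unfolding generates_ideal_at_def by auto
  qed
  let ?U = "{x \<in> topspace (subtopology T W). f x \<in> - {0}}"
  have "openin (subtopology T W) ?U"
    by (rule openin_continuous_map_preimage[OF cont]) (simp add: open_Compl flip: open_openin)
  then have "openin T ?U" using W by (metis openin_trans_full)
  moreover have "y \<in> ?U" using y fy openin_subset[OF W] by (auto simp: topspace_subtopology)
  moreover have "y \<in> T closure_of ?K" using div(1) y unfolding divisor_is_multiple_def by blast
  ultimately have "\<exists>x\<in>?K. x \<in> ?U"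
    using in_closure_of[of y T ?K, THEN iffD1, THEN conjunct2, THEN spec[of _ ?U]] by auto
  then obtain x where "x \<in> ?K" "x \<in> ?U" by (elim bexE)
  then show False using K0[of x] by simp
qed

lemma D_g_subset_closure: "D_g g C \<subseteq> X_bb g C closure_of D_g g C"
  by (rule closure_of_subset) (auto simp: topspace_X_bb D_g_def X_bb_set_def X_g_def)

context slice_data begin

lemma isotropic_pair_a0_b0: "isotropic_pair g a0 b0"
proof -
  have "a0 $ E 1 \<noteq> b0 $ E 1" by (simp add: a0_def b0_def axis_def)
  then have ne: "a0 \<noteq> b0" by metis
  have "a0 \<noteq> c *s b0" for c
  proof
    assume "a0 = c *s b0"
    then have "a0 $ E 1 = (c *s b0) $ E 1" by (rule arg_cong)
    then show False by (simp add: a0_def b0_def axis_def)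
  qed
  moreover have "b0 $ E 2 \<noteq> 0" using \<sigma> by (auto simp: b0_def)
  then have "b0 \<noteq> 0" by auto
  ultimately have "vec.independent {a0, b0}"
    using ne by (subst vec.independent_insert) (auto simp: vec.span_singleton)
  then show ?thesis using ne generators products by (simp add: isotropic_pair_def)
qed

text \<open>Since \<tau> is constant, the whole slice lies over one boundary point; by
  \<open>slice_plane_nbhd\<close> it enters every plane neighbourhood of this point for large Im
  u.\<close>

lemma plane_proj_slice: "plane_proj a0 b0 (slice g \<sigma> p x s u) = \<i> *s a0 - b0"
  by (simp add: plane_proj_def a0_form b0_form slice_def sigma_square)

lemma slice_plane_nbhd:
  assumes "slice g \<sigma> p x s u \<in> C" "\<epsilon> > 0" "4 * (Im u - 2 * (Im x)\<^sup>2 - (of_int g - 1) * (Im s)\<^sup>2) > t"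
  shows "slice g \<sigma> p x s u \<in> plane_nbhd C a0 b0 (\<i> *s a0 - b0) \<epsilon> t"
proof -
  have "slice g \<sigma> p x s u \<cdot> a0 = 1" "slice g \<sigma> p x s u \<cdot> b0 = \<i>"
    by (simp_all add: a0_form b0_form slice_def sigma_square)
  then show ?thesis using assms by (simp add: plane_nbhd_def plane_proj_slice slice_norm)
qed

end

section \<open>The theorem\<close>

theorem mainTheorem10:
  fixes g :: int and C :: "k3_vec set"
  assumes "g > 2"
    and "C \<in> components (period_cone g)"
  shows "\<not> Q_Cartier (X_bb g C) (X_bb_regular g C) (X_bb g C closure_of D_g g C)
       \<and> \<not> (\<exists>k \<Phi>. automorphic_form g C k \<Phi> \<and> zero_support g C \<Phi> = D_g g C)"
proof -
  note C = assms(2)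
  have g1: "g > 1" using assms(1) by simp
  obtain \<sigma> where sg: "\<sigma> = 1 \<or> \<sigma> = - 1"
    "\<And>r s u \<tau>. (r, s, u, \<tau>) \<in> pt_domain g (of_int \<sigma>) \<Longrightarrow> pt g r s u \<tau> \<in> C"
    using component_contains_pt[OF g1 C] by blast
  obtain p where p: "conj_vec p = p"
    "\<And>v. v \<in> K3_lattice \<Longrightarrow>
       (\<Sum>i\<in>UNIV. v $ R1 i * p $ R1 i) + (\<Sum>i\<in>UNIV. v $ R2 i * p $ R2 i) \<in> \<int> \<Longrightarrow>
       (\<forall>i. v $ R1 i = 0 \<and> v $ R2 i = 0)"
    using exists_generic_point by blast
  interpret slice_data g \<sigma> p by unfold_locales (use assms(1) sg(1) p(1) in auto)
  have slice_C: "slice g \<sigma> p x s u \<in> C"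
    if "Im u > 2 * (Im x)\<^sup>2 + (of_int g - 1) * (Im s)\<^sup>2" for x s u
    unfolding slice_def by (rule sg(2)[OF slice_pt_domain[OF that]])
  have root_freeI: "z \<in> root_free g C"
    if "z \<in> C" "\<And>v. v \<in> Lambda_g g \<Longrightarrow> v \<cdot> v = - 2 \<Longrightarrow> z \<cdot> v \<noteq> 0" for z
    using that by (simp add: root_free_def)
  have in_D: "orbit_class g C z \<in> D_g g C" if "z \<in> C" "v \<in> N_g g" "z \<cdot> v = 0" for z v
    using that unfolding D_g_def by blast
  have "\<not> Q_Cartier (X_bb g C) (X_bb_regular g C) (X_bb g C closure_of D_g g C)"
  proof
    \<comment> \<open>The boundary point below the slice, at which a local equation of a multiple is
      refuted.\<close>
    let ?w = "\<i> *s a0 - b0" and ?D = "X_bb g C closure_of D_g g C"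
    have "slice g \<sigma> p 0 0 \<i> \<in> C" by (rule slice_C) simp
    then have w: "?w \<in> plane_stratum C a0 b0"
      unfolding plane_stratum_def using plane_proj_slice by (metis image_eqI)
    then have wb: "?w \<in> boundary_cone g C" using isotropic_pair_a0_b0 unfolding boundary_cone_def by blast
    then have "orbit_class g C ?w \<in> topspace (X_bb g C)" by (simp add: topspace_X_bb X_bb_set_def)
    moreover assume "Q_Cartier (X_bb g C) (X_bb_regular g C) ?D"
    ultimately obtain m W f where m: "m > 0" and W: "openin (X_bb g C) W" "orbit_class g C ?w \<in> W"
      and f: "divisor_is_multiple (X_bb g C) (X_bb_regular g C) ?D W f m"
      unfolding Q_Cartier_def by blast
    have reg: "f \<in> X_bb_regular g C W" using f by (simp add: divisor_is_multiple_def)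
    let ?A = "preimage g C W \<inter> C"
    let ?\<Phi> = "\<lambda>z. f (orbit_class g C z)"
    have "?w \<in> preimage g C W" using W(2) wb by (simp add: preimage_def)
    moreover have "satake_open g C (preimage g C W)" using W(1) by (simp add: openin_X_bb)
    ultimately obtain \<epsilon> t where \<epsilon>: "\<epsilon> > 0" "\<forall>z\<in>plane_nbhd C a0 b0 ?w \<epsilon> t. z \<in> preimage g C W"
      using w isotropic_pair_a0_b0 unfolding satake_open_def by blast
    show False
    \<comment> \<open>The parameter of the Satake neighbourhood is raised to at least 1, the height
      from which \<open>root_orthogonal_slice\<close> applies.\<close>
    proof (rule no_form_vanishing_on_roots[OF p(2), where \<Phi> = ?\<Phi> and A = ?A and t = "max 1 t"])
      show "holo_on ?\<Phi> ?A" using reg by (simp add: X_bb_regular_def)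
      show "max 1 t \<ge> 1" by simp
    next
      fix x s u :: complex assume far: "Im u > max 1 t + 2 * (Im x)\<^sup>2 + (of_int g - 1) * (Im s)\<^sup>2"
      then have "slice g \<sigma> p x s u \<in> C" by (intro slice_C) simp
      moreover from this have "slice g \<sigma> p x s u \<in> plane_nbhd C a0 b0 ?w \<epsilon> t"
        using far \<epsilon>(1) by (intro slice_plane_nbhd) auto
      ultimately show "slice g \<sigma> p x s u \<in> ?A" using \<epsilon>(2) by blast
    next
      fix e w z assume "e \<in> Lambda_g g" "w \<in> Lambda_g g" "e \<cdot> e = 0" "e \<cdot> w = 0"
        "\<And>x. x \<in> K3_lattice \<Longrightarrow> x \<cdot> e \<in> \<int>" "\<And>x. x \<in> K3_lattice \<Longrightarrow> x \<cdot> w \<in> \<int>"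
      then show "?\<Phi> (eichler e w z) = ?\<Phi> z" using orbit_class_eichler[OF C] by simp
    next
      fix z v assume "z \<in> ?A" "v \<in> N_g g" "z \<cdot> v = 0"
      then have "orbit_class g C z \<in> ?D" "orbit_class g C z \<in> W"
        using in_D D_g_subset_closure by (blast, simp add: preimage_def)
      then show "?\<Phi> z = 0"
        using divisor_multiple_vanishes[OF W(1) _ f m] reg by (simp add: X_bb_regular_def)
    next
      fix z assume z: "z \<in> ?A" and "\<And>v. v \<in> Lambda_g g \<Longrightarrow> v \<cdot> v = - 2 \<Longrightarrow> z \<cdot> v \<noteq> 0"
      then have "orbit_class g C z \<in> W - ?D"
        using root_free_not_in_closure[OF g1 C root_freeI] by (auto simp: preimage_def)
      then show "?\<Phi> z \<noteq> 0" using f unfolding divisor_is_multiple_def by blast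
    qed
  qed
  moreover have False if \<Phi>: "automorphic_form g C k \<Phi>" "zero_support g C \<Phi> = D_g g C" for k \<Phi>
  proof -
    have hol: "holo_on \<Phi> C" and hom: "\<And>z c. z \<in> C \<Longrightarrow> c \<noteq> 0 \<Longrightarrow> \<Phi> (c *s z) = c powi (- k) * \<Phi> z"
      and inv: "\<And>\<gamma> z. \<gamma> \<in> Gamma_g g C \<Longrightarrow> z \<in> C \<Longrightarrow> \<Phi> (\<gamma> z) = \<Phi> z"
      using \<Phi>(1) by (auto simp: automorphic_form_def)
    show False
    proof (rule no_form_vanishing_on_roots[OF p(2) hol, where t = 1])
      fix x s u :: complex assume "Im u > 1 + 2 * (Im x)\<^sup>2 + (of_int g - 1) * (Im s)\<^sup>2"
      then show "slice g \<sigma> p x s u \<in> C" by (intro slice_C) simp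
    next
      fix e w z assume "z \<in> C" "e \<in> Lambda_g g" "w \<in> Lambda_g g" "e \<cdot> e = 0" "e \<cdot> w = 0"
        "\<And>x. x \<in> K3_lattice \<Longrightarrow> x \<cdot> e \<in> \<int>" "\<And>x. x \<in> K3_lattice \<Longrightarrow> x \<cdot> w \<in> \<int>"
      then show "\<Phi> (eichler e w z) = \<Phi> z" by (intro inv eichler_Gamma[OF C])
    next
      fix z v assume z: "z \<in> C" and "v \<in> N_g g" "z \<cdot> v = 0"
      then have "orbit_class g C z \<in> zero_support g C \<Phi>" using in_D \<Phi>(2) by simp
      then obtain z' where z': "z' \<in> C" "orbit_class g C z = orbit_class g C z'" "\<Phi> z' = 0"
        unfolding zero_support_def by auto
      \<comment> \<open>The support provides a zero at some representative \<open>z'\<close> only;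
        homogeneity and invariance carry it over to \<open>z\<close>.\<close>
      obtain c \<gamma> where c: "c \<noteq> 0" "\<gamma> \<in> Gamma_g g C" "z = c *s \<gamma> z'" by (rule orbit_class_eqD[OF z'(2)])
      have "\<gamma> z' \<in> C" using Gamma_gD(4)[OF c(2)] z'(1) by blast
      then show "\<Phi> z = 0" using hom[of "\<gamma> z'" c] c inv[OF c(2) z'(1)] z'(3) by simp
    next
      fix z assume z: "z \<in> C" and r: "\<And>v. v \<in> Lambda_g g \<Longrightarrow> v \<cdot> v = - 2 \<Longrightarrow> z \<cdot> v \<noteq> 0"
      show "\<Phi> z \<noteq> 0"
      proof
        assume "\<Phi> z = 0"
        then have "orbit_class g C z \<in> D_g g C"
          using z unfolding \<Phi>(2)[symmetric] zero_support_def X_g_def by blast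
        then show False
          using D_g_subset_closure root_free_not_in_closure[OF g1 C root_freeI[OF z r]] by blast
      qed
    next
      show "(1 :: real) \<le> 1" by simp
    qed
  qed
  ultimately show ?thesis by blast
qed

end
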